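(* Let $p\in[1,\infty)$, $\ell:=\frac{N}{2\beta}(p-1)$, and $q\in(\ell,\infty]$ with $q\ge p$. Let $u_1$ and $u_2$ be two $L^q$-solutions of $\partial_t^\alpha u+(-\Delta)^\beta u=|u|^{p-1}u$ with the same initial datum $u_0\in L^q(\mathbb{R}^N)$ and corresponding existence times $T_1$ and $T_2$. Then $u_1(\cdot,t)=u_2(\cdot,t)$ for all $t\in(0,\min\{T_1,T_2\})$.
   Context: Throughout, $N\ge1$ is an integer, $\alpha\in(0,1)$, $\beta\in(0,1]$, and $N>4\beta$. $\partial_t^\alpha$ is the Caputo derivative, $\partial_t^\alpha u(x,t)=\frac1{\Gamma(1-\alpha)}\partial_t\int_0^t\frac{u(x,s)-u(x,0)}{(t-s)^\alpha}ds$, and $(-\Delta)^\beta$ is the operator with Fourier symbol $|\xi|^{2\beta}$. $Z$ is the fundamental solution of $\partial_t^\alpha u+(-\Delta)^\beta u=0$ (initial datum a Dirac mass at $0$), and $Y(x,t)={}^{R}\partial_t^{1-\alpha}Z(x,t)=\frac{1}{\Gamma(\alpha)}\partial_t\int_0^t\frac{Z(x,s)}{(t-s)^{1-\alpha}}ds$. Equivalently, in terms of spatial Fourier transforms, $\hat Z(\xi,t)=E_{\alpha,1}(-|\xi|^{2\beta}t^\alpha)$ and $\hat Y(\xi,t)=t^{\alpha-1}E_{\alpha,\alpha}(-|\xi|^{2\beta}t^\alpha)$, with $E_{\alpha,\gamma}$ the Mittag-Leffler functions. For $q\in[1,\infty]$ and $u_0\in L^q(\mathbb{R}^N)$, an $L^q$-solution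 of $\partial_t^\alpha u+(-\Delta)^\beta u=|u|^{p-1}u$ with initial datum $u_0$ and existence time $T\in(0,\infty]$ is a function $u\in L^\infty_{\rm loc}([0,T);L^q(\mathbb{R}^N))$ such that, for almost all $t\in(0,T)$, $$u(x,t)=\int_{\mathbb{R}^N} u_0(y)Z(x-y,t)\,dy+\int_0^t\int_{\mathbb{R}^N}|u(y,s)|^{p-1}u(y,s)Y(x-y,t-s)\,dy\,ds$$ as an identity in $L^q(\mathbb{R}^N)$, and $\operatorname{ess\,lim}_{t\to0^+}\|u(\cdot,t)-u_0\|_{L^q(\mathbb{R}^N)}=0$. For the values of $q$ in the claim, $u(\cdot,t)$ is taken to be, for every $t\in(0,T)$, the representative given by the right-hand side of this formula; it is continuous in $t$ with values in $L^q(\mathbb{R}^N)$. *)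

theory Defs
  imports "HOL-Analysis.Analysis" "HOL-Probability.Essential_Supremum"
begin

text \<open>
  Integrals and measurability refer to the (complete) Lebesgue measure throughout, so that nothing
  depends on the representative chosen within an almost-everywhere class.  This matters in
  particular for the kernel \<open>Y\<close>, which is defined by a pointwise time derivative and may take
  arbitrary values for \<open>x\<close> in a null set.
\<close>

subsection \<open>Lebesgue spaces\<close>

definition Lq :: "ereal \<Rightarrow> ('a::euclidean_space \<Rightarrow> real) \<Rightarrow> bool" where
  "Lq q f \<longleftrightarrow> f \<in> borel_measurable lebesgue \<and>
     (if q = \<infinity> then \<exists>C. AE x in lebesgue. \<bar>f x\<bar> \<le> C
      else integrable lebesgue (\<lambda>x. \<bar>f x\<bar> powr real_of_ereal q))"

text \<open>The norm is only meaningful for functions satisfying \<open>Lq q\<close>.\<close>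

definition Lq_norm :: "ereal \<Rightarrow> ('a::euclidean_space \<Rightarrow> real) \<Rightarrow> real" where
  "Lq_norm q f =
     (if q = \<infinity> then real_of_ereal (esssup lebesgue (\<lambda>x. ereal \<bar>f x\<bar>))
      else (LINT x|lebesgue. \<bar>f x\<bar> powr real_of_ereal q) powr (1 / real_of_ereal q))"

definition time_domain :: "ereal \<Rightarrow> real set" where
  "time_domain T = {t. 0 < t \<and> ereal t < T}"

text \<open>
  Strong (Bochner) measurability of \<open>t \<mapsto> u(\<cdot>,t)\<close> as an \<open>L\<^sup>q\<close>-valued function: almost everywhere in
  time it is the \<open>L\<^sup>q\<close>-limit of simple functions with values in \<open>L\<^sup>q\<close>.
\<close>

definition Lq_strongly_measurable ::
    "ereal \<Rightarrow> real set \<Rightarrow> ('a::euclidean_space \<Rightarrow> real \<Rightarrow> real) \<Rightarrow> bool" where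
  "Lq_strongly_measurable q I u \<longleftrightarrow>
     (AE t in lebesgue_on I. Lq q (\<lambda>x. u x t)) \<and>
     (\<exists>S :: nat \<Rightarrow> real \<Rightarrow> 'a \<Rightarrow> real.
        (\<forall>n. finite (range (S n)) \<and>
             (\<forall>g \<in> range (S n). Lq q g \<and> S n -` {g} \<in> sets lebesgue)) \<and>
        (AE t in lebesgue_on I. (\<lambda>n. Lq_norm q (\<lambda>x. S n t x - u x t)) \<longlonglongrightarrow> 0))"

text \<open>
  The class \<open>L\<^sup>\<infinity>\<^sub>l\<^sub>o\<^sub>c([0,T); L\<^sup>q)\<close>.  Its elements are represented by functions of \<open>(x,t)\<close> that are
  jointly measurable; every strongly measurable \<open>L\<^sup>q\<close>-valued function has such a representative.
\<close>

definition Linf_loc_Lq ::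
    "ereal \<Rightarrow> ereal \<Rightarrow> ('a::euclidean_space \<Rightarrow> real \<Rightarrow> real) \<Rightarrow> bool" where
  "Linf_loc_Lq q T u \<longleftrightarrow>
     (\<lambda>(x,t). u x t) \<in> borel_measurable (lebesgue_on (UNIV \<times> time_domain T)) \<and>
     Lq_strongly_measurable q (time_domain T) u \<and>
     (\<forall>\<tau> \<in> time_domain T. \<exists>M. AE t in lebesgue_on {0<..<\<tau>}. Lq_norm q (\<lambda>x. u x t) \<le> M)"

subsection \<open>The kernels \<open>Z\<close> and \<open>Y\<close>\<close>

definition mittag_leffler :: "real \<Rightarrow> real \<Rightarrow> real \<Rightarrow> real" where
  "mittag_leffler \<alpha> \<gamma> z = (\<Sum>k. z ^ k / Gamma (\<alpha> * real k + \<gamma>))"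

definition fourier :: "('a::euclidean_space \<Rightarrow> real) \<Rightarrow> 'a \<Rightarrow> complex" where
  "fourier f \<xi> = (LINT x|lebesgue. cis (- (x \<bullet> \<xi>)) * complex_of_real (f x))"

text \<open>
  \<open>Z\<close> is the fundamental solution of \<open>\<partial>\<^sub>t\<^sup>\<alpha> u + (-\<Delta>)\<^sup>\<beta> u = 0\<close>, i.e. the solution whose initial
  datum is a Dirac mass at the origin.  In Fourier variables the equation is the scalar Caputo
  equation \<open>\<partial>\<^sub>t\<^sup>\<alpha> v = - |\<xi>|\<^sup>2\<^sup>\<beta> v\<close> with \<open>v(0) = 1\<close>, which is solved by the function below.  By injectivity
  of the Fourier transform, \<open>Z(\<cdot>,t)\<close> is determined up to null sets.
\<close>

definition fundamental_solution ::
    "real \<Rightarrow> real \<Rightarrow> ('a::euclidean_space \<Rightarrow> real \<Rightarrow> real) \<Rightarrow> bool" where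
  "fundamental_solution \<alpha> \<beta> Z \<longleftrightarrow>
     (\<lambda>(x,t). Z x t) \<in> borel_measurable (lebesgue_on (UNIV \<times> {0<..})) \<and>
     (\<forall>t>0. integrable lebesgue (\<lambda>x. Z x t)) \<and>
     (\<forall>t>0. \<forall>\<xi>. fourier (\<lambda>x. Z x t) \<xi> =
        complex_of_real (mittag_leffler \<alpha> 1 (- (norm \<xi> powr (2 * \<beta>)) * t powr \<alpha>)))"

definition riemann_liouville_deriv :: "real \<Rightarrow> (real \<Rightarrow> real) \<Rightarrow> real \<Rightarrow> real" where
  "riemann_liouville_deriv \<mu> f t =
     1 / Gamma (1 - \<mu>) *
     deriv (\<lambda>\<tau>. LINT s:{0<..<\<tau>}|lebesgue. f s / (\<tau> - s) powr \<mu>) t"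

definition kernel_Y ::
    "real \<Rightarrow> ('a::euclidean_space \<Rightarrow> real \<Rightarrow> real) \<Rightarrow> 'a \<Rightarrow> real \<Rightarrow> real" where
  "kernel_Y \<alpha> Z x t = riemann_liouville_deriv (1 - \<alpha>) (Z x) t"

subsection \<open>\<open>L\<^sup>q\<close>-solutions\<close>

text \<open>
  The variation-of-constants formula at time \<open>t\<close>, as an identity in \<open>L\<^sup>q\<close>.  Convergence of the
  integrals is required explicitly because a divergent integral has the value \<open>0\<close> in HOL; in the
  range of \<open>q\<close> where uniqueness is claimed it is automatic for \<open>u\<close> in the above class.
\<close>

definition duhamel_identity ::
    "real \<Rightarrow> real \<Rightarrow> ereal \<Rightarrow> ('a::euclidean_space \<Rightarrow> real \<Rightarrow> real) \<Rightarrow> ('a \<Rightarrow> real) \<Rightarrow>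
     ('a \<Rightarrow> real \<Rightarrow> real) \<Rightarrow> real \<Rightarrow> bool" where
  "duhamel_identity \<alpha> p q Z u\<^sub>0 u t \<longleftrightarrow>
     Lq q (\<lambda>x. u x t) \<and>
     (AE x in lebesgue.
        integrable lebesgue (\<lambda>y. u\<^sub>0 y * Z (x - y) t) \<and>
        set_integrable lebesgue (UNIV \<times> {0<..<t})
          (\<lambda>(y,s). \<bar>u y s\<bar> powr (p - 1) * u y s * kernel_Y \<alpha> Z (x - y) (t - s)) \<and>
        u x t =
          (LINT y|lebesgue. u\<^sub>0 y * Z (x - y) t) +
          (LINT s:{0<..<t}|lebesgue. LINT y|lebesgue.
             \<bar>u y s\<bar> powr (p - 1) * u y s * kernel_Y \<alpha> Z (x - y) (t - s)))"

definition Lq_solution ::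
    "real \<Rightarrow> real \<Rightarrow> ereal \<Rightarrow> ('a::euclidean_space \<Rightarrow> real \<Rightarrow> real) \<Rightarrow> ('a \<Rightarrow> real) \<Rightarrow>
     ereal \<Rightarrow> ('a \<Rightarrow> real \<Rightarrow> real) \<Rightarrow> bool" where
  "Lq_solution \<alpha> p q Z u\<^sub>0 T u \<longleftrightarrow>
     0 < T \<and> Lq q u\<^sub>0 \<and> Linf_loc_Lq q T u \<and>
     (AE t in lebesgue_on (time_domain T). duhamel_identity \<alpha> p q Z u\<^sub>0 u t) \<and>
     (\<forall>\<epsilon>>0. \<exists>\<delta>>0. AE t in lebesgue_on ({0<..<\<delta>} \<inter> time_domain T).
        Lq_norm q (\<lambda>x. u x t - u\<^sub>0 x) < \<epsilon>)"

text \<open>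
  \<open>u(\<cdot>,t)\<close> is, for every \<open>t\<close> and not just for almost every \<open>t\<close>, the representative given by the
  right-hand side of the formula.
\<close>

definition canonical_representative ::
    "real \<Rightarrow> real \<Rightarrow> ereal \<Rightarrow> ('a::euclidean_space \<Rightarrow> real \<Rightarrow> real) \<Rightarrow> ('a \<Rightarrow> real) \<Rightarrow>
     ereal \<Rightarrow> ('a \<Rightarrow> real \<Rightarrow> real) \<Rightarrow> bool" where
  "canonical_representative \<alpha> p q Z u\<^sub>0 T u \<longleftrightarrow>
     (\<forall>t \<in> time_domain T. duhamel_identity \<alpha> p q Z u\<^sub>0 u t)"

end

theory Submission
  imports Defs "HOL-Probability.Characteristic_Functions" "HOL-Complex_Analysis.Cauchy_Integral_Formula" "HOL-Real_Asymp.Real_Asymp"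
begin

text \<open>
  Why uniqueness holds.  The difference \<open>w\<close> of two solutions satisfies
  \<open>w(t) = \<integral>\<^sub>0\<^sup>t Y(t - s) * (f(u\<^sub>1(s)) - f(u\<^sub>2(s))) ds\<close> with \<open>f(a) = |a|\<^sup>p\<^sup>-\<^sup>1 a\<close>, and
  \<open>|f(a) - f(b)| \<le> p |a - b| max(|a|,|b|)\<^sup>p\<^sup>-\<^sup>1\<close>.  On a time interval on which both solutions are
  bounded by \<open>M\<close> in \<open>L\<^sup>q\<close>, convolution with \<open>Y(t)\<close> therefore costs a factor that is bounded by a sum of
  powers \<open>t\<^sup>a\<^sup>-\<^sup>1\<close> with \<open>a > 0\<close>; this is where \<open>q > l\<close> enters.  In the norm \<open>sup e\<^sup>-\<^sup>\<rho>\<^sup>t \<parallel>w(t)\<parallel>\<^sub>q\<close> the right-hand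
  side is then a contraction once \<open>\<rho>\<close> is large (\<open>duhamel_contraction\<close>), and iterating it from the
  a priori bound gives \<open>w = 0\<close>.

  Most of the work is to get hold of \<open>Y\<close>, which is defined as a pointwise time derivative of a
  fractional integral of a kernel \<open>Z\<close> that is only known through its Fourier transform.  The explicit
  candidate is a superposition of heat kernels \<open>G\<^sub>\<tau>\<close>,
  \<open>Y(x,t) = \<integral>\<^sub>0\<^sup>\<infinity> m(t,\<tau>) G\<^sub>\<tau>(x) d\<tau>\<close>, where \<open>m\<close> is the inverse Laplace transform, in both variables, of
  \<open>1 / (z\<^sup>\<alpha> + \<nu>\<^sup>\<beta>)\<close>.  Both contours are the boundary of one sector \<open>|arg z| \<le> \<theta>\<close> with
  \<open>\<theta> > \<pi>/2\<close> and \<open>(\<alpha> + \<beta>) \<theta> < \<pi>\<close>: there the exponentials decay, \<open>|z\<^sup>\<alpha> + \<nu>\<^sup>\<beta>|\<close> is comparable to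
  \<open>|z|\<^sup>\<alpha> + |\<nu>|\<^sup>\<beta>\<close>, and all bounds on \<open>m\<close> become elementary (\<open>norm_subordinator_le\<close>,
  \<open>subordinator_weighted_bound\<close>).

  The candidate is identified with the given kernel as follows.  By Cauchy's formula
  (\<open>strip_cauchy_formula\<close>) the Laplace transform of \<open>m\<close> in \<open>\<tau>\<close> at \<open>|\<xi>|\<^sup>2\<close> and then in \<open>t\<close> at \<open>s\<close> is
  \<open>1 / (s\<^sup>\<alpha> + |\<xi>|\<^sup>2\<^sup>\<beta>)\<close>, which is also the Laplace transform of \<open>t\<^sup>\<alpha>\<^sup>-\<^sup>1 E\<^sub>\<alpha>\<^sub>,\<^sub>\<alpha>(-|\<xi>|\<^sup>2\<^sup>\<beta> t\<^sup>\<alpha>)\<close>, so that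
  injectivity of the Laplace transform gives the Fourier transform of the candidate
  (\<open>inv_laplace_eq_mittag_leffler\<close>).  Its fractional integral of order \<open>1 - \<alpha>\<close> then has the Fourier
  transform of \<open>Z\<close> and equals \<open>Z\<close> almost everywhere by injectivity of the Fourier transform
  (\<open>z_kernel_fourier\<close>, \<open>fundamental_solution_AE_eq\<close>).  A further fractional integral of order \<open>\<alpha>\<close>
  turns it into the time integral of the candidate, which is continuous in time for \<open>x \<noteq> 0\<close>, and so
  the pointwise derivative that defines \<open>Y\<close> exists and is the candidate (\<open>kernel_Y_eq\<close>).
\<close>

section \<open>Heat kernels and injectivity of the Fourier transform\<close>

text \<open>
  The heat kernel at time \<open>\<tau>\<close>.  The power of a square root in place of a real exponent makes it a
  product over the coordinates.
\<close>
definition gauss :: "real \<Rightarrow> 'a::euclidean_space \<Rightarrow> real" where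
  "gauss \<tau> x = exp (- (norm x)\<^sup>2 / (4 * \<tau>)) / sqrt (4 * pi * \<tau>) ^ DIM('a)"

lemma cis_measurable [measurable (raw)]:
  "f \<in> borel_measurable M \<Longrightarrow> (\<lambda>x. cis (f x)) \<in> borel_measurable M"
  by (rule borel_measurable_continuous_on [of cis]) (auto intro!: continuous_intros)

lemma gauss_nonneg: "0 < \<tau> \<Longrightarrow> 0 \<le> gauss \<tau> x"
  by (simp add: gauss_def)

lemma gauss_measurable' [measurable (raw)]:
  assumes "f \<in> borel_measurable M" "g \<in> borel_measurable M"
  shows "(\<lambda>z. gauss (f z) (g z :: 'a::euclidean_space)) \<in> borel_measurable M"
  unfolding gauss_def using assms by measurable

text \<open>
  The substitution \<open>u = \<surd>(2\<tau>) x\<close> reduces this to the characteristic function of the standard normal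
  distribution.
\<close>
lemma gauss_fourier_real:
  assumes "0 < \<tau>"
  shows "(LINT u|lborel. cis (- (u * s)) * complex_of_real (exp (- u\<^sup>2 / (4 * \<tau>)) / sqrt (4 * pi * \<tau>)))
    = complex_of_real (exp (- \<tau> * s\<^sup>2))" (is "integral\<^sup>L lborel ?f = _")
proof -
  define c where "c = sqrt (2 * \<tau>)"
  have c: "c > 0" "c\<^sup>2 = 2 * \<tau>" using assms by (auto simp: c_def)
  have sq: "sqrt (4 * pi * \<tau>) = sqrt (2 * pi) * c"
    unfolding c_def by (simp add: real_sqrt_mult [symmetric] mult_ac)
  have "integral\<^sup>L lborel ?f = \<bar>c\<bar> *\<^sub>R (LINT x|lborel. ?f (0 + c * x))"
    using c by (intro lborel_integral_real_affine) auto
  also have "\<dots> = (LINT x|lborel. std_normal_density x *\<^sub>R iexp ((- (c * s)) * x))"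
    unfolding integral_scaleR_right [symmetric]
  proof (rule Bochner_Integration.integral_cong)
    fix x :: real
    have e: "- (0 + c * x)\<^sup>2 / (4 * \<tau>) = - x\<^sup>2 / 2"
      using c assms by (simp add: power_mult_distrib field_simps)
    show "\<bar>c\<bar> *\<^sub>R ?f (0 + c * x) = std_normal_density x *\<^sub>R iexp ((- (c * s)) * x)"
      unfolding sq e std_normal_density_def
      using c by (simp add: scaleR_conv_of_real cis_conv_exp mult_ac)
  qed auto
  also have "\<dots> = char std_normal_distribution (- (c * s))"
    unfolding char_def by (subst integral_density) auto
  also have "\<dots> = complex_of_real (exp (- \<tau> * s\<^sup>2))"
    by (simp add: char_std_normal_distribution power_mult_distrib c)
  finally show ?thesis .
qed

lemma gauss_real_integrable:
  assumes "0 < \<tau>"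
  shows "integrable lborel (\<lambda>u::real. exp (- u\<^sup>2 / (4 * \<tau>)) / sqrt (4 * pi * \<tau>))"
proof -
  have "(\<lambda>u::real. exp (- u\<^sup>2 / (4 * \<tau>)) / sqrt (4 * pi * \<tau>)) = normal_density 0 (sqrt (2 * \<tau>))"
    using assms by (auto simp: normal_density_def fun_eq_iff)
  then show ?thesis using integrable_normal_density [of "sqrt (2 * \<tau>)" 0] assms by simp
qed

lemma gauss_eq_prod:
  fixes x :: "'a::euclidean_space"
  shows "gauss \<tau> x = (\<Prod>b\<in>Basis. exp (- (x \<bullet> b)\<^sup>2 / (4 * \<tau>)) / sqrt (4 * pi * \<tau>))"
proof -
  have "(norm x)\<^sup>2 = (\<Sum>b\<in>Basis. (x \<bullet> b)\<^sup>2)"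
    by (subst power2_norm_eq_inner, subst euclidean_inner) (simp add: power2_eq_square)
  then show ?thesis
    by (simp add: gauss_def prod_dividef exp_sum [symmetric] sum_negf [symmetric] sum_divide_distrib)
qed

lemma gauss_fourier:
  fixes \<xi> :: "'a::euclidean_space"
  assumes "0 < \<tau>"
  shows "(LINT x|lborel. cis (- (x \<bullet> \<xi>)) * complex_of_real (gauss \<tau> x))
    = complex_of_real (exp (- \<tau> * (norm \<xi>)\<^sup>2))"
proof -
  interpret product_sigma_finite "\<lambda>_::'a. lborel :: real measure" ..
  let ?g = "\<lambda>b u. cis (- (u * (\<xi> \<bullet> b))) * complex_of_real (exp (- u\<^sup>2 / (4 * \<tau>)) / sqrt (4 * pi * \<tau>))"
  have *: "cis (- (x \<bullet> \<xi>)) * complex_of_real (gauss \<tau> x) = (\<Prod>b\<in>Basis. ?g b (x \<bullet> b))" for x :: 'a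
  proof -
    have "x \<bullet> \<xi> = (\<Sum>b\<in>Basis. (x \<bullet> b) * (\<xi> \<bullet> b))" by (rule euclidean_inner)
    then have "cis (- (x \<bullet> \<xi>)) = (\<Prod>b\<in>Basis. cis (- ((x \<bullet> b) * (\<xi> \<bullet> b))))"
      by (simp add: cis_conv_exp exp_sum [symmetric] sum_negf [symmetric] sum_distrib_left)
    then show ?thesis by (simp only: gauss_eq_prod prod.distrib of_real_prod)
  qed
  have int: "integrable lborel (?g b)" for b
    using gauss_real_integrable [OF assms]
    by (rule Bochner_Integration.integrable_bound) (auto simp: norm_mult norm_divide)
  have meas[measurable]: "?g b \<in> borel_measurable borel" for b by measurable
  have "(LINT x|lborel. cis (- (x \<bullet> \<xi>)) * complex_of_real (gauss \<tau> x))
      = (LINT x|(distr (\<Pi>\<^sub>M b\<in>Basis. lborel) borel (\<lambda>f. \<Sum>b\<in>Basis. f b *\<^sub>R b)). (\<Prod>b\<in>(Basis::'a set). ?g b (x \<bullet> b)))"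
    unfolding * by (subst lborel_eq) simp
  also have "\<dots> = (LINT f|(\<Pi>\<^sub>M b\<in>Basis. lborel). (\<Prod>b\<in>(Basis::'a set). ?g b ((\<Sum>b\<in>Basis. f b *\<^sub>R b) \<bullet> b)))"
  proof (rule integral_distr)
    have [measurable]: "(\<lambda>f. f b) \<in> borel_measurable (\<Pi>\<^sub>M b\<in>(Basis::'a set). (lborel :: real measure))" if "b \<in> Basis" for b
      using measurable_component_singleton [OF that, of "\<lambda>_. lborel :: real measure"] by simp
    show "(\<lambda>f. \<Sum>b\<in>(Basis::'a set). f b *\<^sub>R b) \<in> measurable (\<Pi>\<^sub>M b\<in>(Basis::'a set). (lborel :: real measure)) borel"
      by (auto intro!: borel_measurable_sum borel_measurable_scaleR)
    show "(\<lambda>x. \<Prod>b\<in>(Basis::'a set). ?g b (x \<bullet> b)) \<in> borel_measurable borel"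
      by (intro borel_measurable_prod measurable_compose [OF _ meas]) auto
  qed
  also have "\<dots> = (LINT f|(\<Pi>\<^sub>M b\<in>Basis. lborel). (\<Prod>b\<in>(Basis::'a set). ?g b (f b)))"
    by (intro Bochner_Integration.integral_cong prod.cong refl) (simp_all add: inner_sum_left_Basis)
  also have "\<dots> = (\<Prod>b\<in>(Basis::'a set). LINT u|lborel. ?g b u)"
    by (intro product_integral_prod int) simp
  also have "\<dots> = (\<Prod>b\<in>(Basis::'a set). complex_of_real (exp (- \<tau> * (\<xi> \<bullet> b)\<^sup>2)))"
    by (simp only: gauss_fourier_real [OF assms])
  also have "\<dots> = complex_of_real (exp (- \<tau> * (norm \<xi>)\<^sup>2))"
  proof -
    have "(norm \<xi>)\<^sup>2 = (\<Sum>b\<in>Basis. (\<xi> \<bullet> b)\<^sup>2)"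
      by (subst power2_norm_eq_inner, subst euclidean_inner) (simp add: power2_eq_square)
    then show ?thesis
      by (simp add: exp_sum [symmetric] sum_negf [symmetric] sum_distrib_left flip: of_real_prod)
  qed
  finally show ?thesis .
qed

lemma gauss_nn_integral:
  assumes "0 < \<tau>"
  shows "(\<integral>\<^sup>+x. ennreal (gauss \<tau> (x::'a::euclidean_space)) \<partial>lborel) = 1"
proof -
  have 1: "(\<integral>\<^sup>+u. ennreal (exp (- u\<^sup>2 / (4 * \<tau>)) / sqrt (4 * pi * \<tau>)) \<partial>lborel) = 1"
  proof -
    have eq: "(\<lambda>u::real. exp (- u\<^sup>2 / (4 * \<tau>)) / sqrt (4 * pi * \<tau>)) = normal_density 0 (sqrt (2 * \<tau>))"
      using assms by (auto simp: normal_density_def fun_eq_iff)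
    have "prob_space (density lborel (normal_density 0 (sqrt (2 * \<tau>))))"
      using assms by (intro prob_space_normal_density) auto
    then have "emeasure (density lborel (normal_density 0 (sqrt (2 * \<tau>)))) UNIV = 1"
      using prob_space.emeasure_space_1 by fastforce
    then show ?thesis
      unfolding eq [THEN fun_cong] by (subst (asm) emeasure_density) auto
  qed
  have "(\<integral>\<^sup>+x. ennreal (gauss \<tau> (x::'a)) \<partial>lborel)
      = (\<integral>\<^sup>+x. (\<Prod>b\<in>(Basis::'a set). ennreal (exp (- (x \<bullet> b)\<^sup>2 / (4 * \<tau>)) / sqrt (4 * pi * \<tau>))) \<partial>lborel)"
    unfolding gauss_eq_prod using assms by (subst prod_ennreal) auto
  also have "\<dots> = 1"
    using 1 assms by (subst nn_integral_lborel_prod) (auto simp del: minus_divide_left)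
  finally show ?thesis .
qed

lemma gauss_integrable:
  assumes "0 < \<tau>"
  shows "integrable lborel (gauss \<tau> :: 'a::euclidean_space \<Rightarrow> real)"
  using gauss_nn_integral [OF assms, where 'a = 'a] assms
  by (intro integrableI_nonneg) (auto simp: gauss_nonneg)

text \<open>
  Boxes generate the Borel sets and are closed under intersection, so the positive and the negative
  part of \<open>f\<close> are densities of the same finite measure.
\<close>
lemma AE_zero_if_box_integrals_zero:
  fixes f :: "'a::euclidean_space \<Rightarrow> real"
  assumes f: "integrable lborel f"
    and box: "\<And>a b. (LINT x:box a b|lborel. f x) = 0"
  shows "AE x in lborel. f x = 0"
proof -
  have [measurable]: "f \<in> borel_measurable borel" using f by auto
  define P Q where "P = density lborel (\<lambda>x. ennreal (max 0 (f x)))"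
    and "Q = density lborel (\<lambda>x. ennreal (max 0 (- f x)))"
  have intP: "integrable lborel (\<lambda>x. max 0 (f x))" "integrable lborel (\<lambda>x. max 0 (- f x))"
    using f by auto
  have eP: "emeasure P A = ennreal (LINT x:A|lborel. max 0 (f x))"
    and eQ: "emeasure Q A = ennreal (LINT x:A|lborel. max 0 (- f x))" if "A \<in> sets borel" for A
  proof -
    have i: "integrable lborel (\<lambda>x. indicator A x * max 0 (f x))"
       "integrable lborel (\<lambda>x. indicator A x * max 0 (- f x))"
      using that intP by (auto intro!: integrable_real_mult_indicator simp: mult.commute [of "indicator A _"])
    show "emeasure P A = ennreal (LINT x:A|lborel. max 0 (f x))"
      unfolding P_def set_lebesgue_integral_def using that i(1)
      by (subst emeasure_density) (auto simp: nn_integral_eq_integral [symmetric] ennreal_mult mult.commute ennreal_indicator split: split_indicator intro!: nn_integral_cong)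
    show "emeasure Q A = ennreal (LINT x:A|lborel. max 0 (- f x))"
      unfolding Q_def set_lebesgue_integral_def using that i(2)
      by (subst emeasure_density) (auto simp: nn_integral_eq_integral [symmetric] ennreal_mult mult.commute ennreal_indicator split: split_indicator intro!: nn_integral_cong)
  qed
  have "P = Q"
  proof (rule measure_eqI_generator_eq)
    let ?E = "range (\<lambda>(a, b). box a b::'a set)"
    show "Int_stable ?E" by (auto simp: Int_stable_def box_Int_box)
    show "?E \<subseteq> Pow UNIV" "sets P = sigma_sets UNIV ?E" "sets Q = sigma_sets UNIV ?E"
      by (simp_all add: borel_eq_box P_def Q_def)
    let ?A = "\<lambda>n::nat. box (- (real n *\<^sub>R One)) (real n *\<^sub>R One) :: 'a set"
    show "range ?A \<subseteq> ?E" "(\<Union>i. ?A i) = UNIV" unfolding UN_box_eq_UNIV by auto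
    show "emeasure P (?A i) \<noteq> \<infinity>" for i by (subst eP) auto
    show "emeasure P X = emeasure Q X" if X: "X \<in> ?E" for X
    proof -
      obtain a b where Xb: "X = box a b" using X by auto
      have s: "set_integrable lborel X (\<lambda>x. max 0 (f x))" "set_integrable lborel X (\<lambda>x. max 0 (- f x))"
        using Xb integrable_mult_indicator [OF _ intP(1), of X] integrable_mult_indicator [OF _ intP(2), of X]
        by (auto simp: set_integrable_def)
      have "max 0 r - max 0 (- r) = r" for r :: real by (simp add: max_def)
      then have "(LINT x:X|lborel. max 0 (f x)) - (LINT x:X|lborel. max 0 (- f x)) = (LINT x:X|lborel. f x)"
        using set_integral_diff(2) [OF s] by simp
      then have "(LINT x:X|lborel. max 0 (f x)) = (LINT x:X|lborel. max 0 (- f x))"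
        using box Xb by simp
      then show ?thesis using Xb by (simp add: eP eQ)
    qed
  qed
  then have "AE x in lborel. ennreal (max 0 (f x)) = ennreal (max 0 (- f x))"
    unfolding P_def Q_def by (rule sigma_finite_measure.density_unique [OF sigma_finite_lborel, rotated 2]) auto
  then show ?thesis
    by eventually_elim (auto simp: max_def split: if_splits)
qed

text \<open>
  A Gaussian is the Fourier transform of an integrable function; Fubini's theorem moves that
  transform onto \<open>f\<close>.
\<close>
lemma gauss_convolution_eq_zero_of_fourier_zero:
  fixes f :: "'a::euclidean_space \<Rightarrow> real"
  assumes f: "integrable lborel f"
    and zero: "AE \<xi> in lborel. (LINT x|lborel. cis (- (x \<bullet> \<xi>)) * complex_of_real (f x)) = 0"
    and t: "0 < t"
  shows "(LINT x|lborel. f x * exp (- t * (norm (x - y))\<^sup>2)) = 0"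
proof -
  have [measurable]: "f \<in> borel_measurable borel" using f by auto
  let ?F = "\<lambda>x \<xi>. complex_of_real (f x) * (cis (- (\<xi> \<bullet> (x - y))) * complex_of_real (gauss t \<xi>))"
  have "integrable (lborel \<Otimes>\<^sub>M lborel) (\<lambda>z. f (fst z) * gauss t (snd z :: 'a))"
  proof (rule lborel_pair.Fubini_integrable)
    show "integrable lborel (\<lambda>x. LINT y|lborel. norm (f (fst (x, y)) * gauss t (snd (x, y) :: 'a)))"
      using f t by (auto simp: abs_mult gauss_nonneg)
  qed (use gauss_integrable [OF t, where 'a = 'a] in auto)
  then have int: "integrable (lborel \<Otimes>\<^sub>M lborel) (\<lambda>(x, \<xi>). ?F x \<xi>)"
    by (rule Bochner_Integration.integrable_bound) (auto simp: norm_mult)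
  have "complex_of_real (LINT x|lborel. f x * exp (- t * (norm (x - y))\<^sup>2))
      = (LINT x|lborel. (LINT \<xi>|lborel. ?F x \<xi>))"
    by (simp add: gauss_fourier [OF t] flip: integral_complex_of_real)
  also have "\<dots> = (LINT \<xi>|lborel. (LINT x|lborel. ?F x \<xi>))"
    by (rule lborel_pair.Fubini_integral [OF int, symmetric])
  also have "\<dots> = (LINT \<xi>|lborel. cis (y \<bullet> \<xi>) * complex_of_real (gauss t \<xi>) * (LINT x|lborel. cis (- (x \<bullet> \<xi>)) * complex_of_real (f x)))"
  proof (rule Bochner_Integration.integral_cong)
    fix \<xi> :: 'a
    have "cis (- (\<xi> \<bullet> (x - y))) = cis (y \<bullet> \<xi>) * cis (- (x \<bullet> \<xi>))" for x
      by (simp add: cis_mult inner_diff_right inner_commute)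
    then have "(LINT x|lborel. ?F x \<xi>)
      = (LINT x|lborel. cis (y \<bullet> \<xi>) * complex_of_real (gauss t \<xi>) * (cis (- (x \<bullet> \<xi>)) * complex_of_real (f x)))"
      by (simp add: mult_ac)
    then show "(LINT x|lborel. ?F x \<xi>) = cis (y \<bullet> \<xi>) * complex_of_real (gauss t \<xi>) * (LINT x|lborel. cis (- (x \<bullet> \<xi>)) * complex_of_real (f x))"
      by (simp only: integral_mult_right_zero)
  qed simp
  also have "\<dots> = (LINT \<xi>|(lborel :: 'a measure). 0)"
    using zero by (intro integral_cong_AE) auto
  finally show ?thesis by simp
qed

lemma AE_not_in_box_frontier: "AE x in lborel. x \<in> box a b \<or> x \<notin> cbox a (b::'a::euclidean_space)"
proof -
  have "emeasure lborel (cbox a b - box a b) = 0"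
  proof (cases "\<forall>i\<in>Basis. a \<bullet> i \<le> b \<bullet> i")
    case True
    then have "emeasure lborel (cbox a b - box a b) = emeasure lborel (cbox a b) - emeasure lborel (box a b)"
      by (intro emeasure_Diff) (auto simp: box_subset_cbox emeasure_lborel_box_eq)
    then show ?thesis using True by (simp add: emeasure_lborel_box_eq emeasure_lborel_cbox_eq)
  next
    case False
    then have "cbox a b = {}" by (force simp: box_eq_empty)
    then show ?thesis by simp
  qed
  then show ?thesis
    by (intro AE_I [where N = "cbox a b - box a b"]) auto
qed

text \<open>
  Since \<open>f\<close> is annihilated by all Gaussians, it is annihilated by the mollification of the indicator
  function of any box.  These mollifications are bounded by \<open>1\<close> and converge to the indicator function
  off the boundary of the box, which is a null set.
\<close>
proposition fourier_injective:
  fixes f :: "'a::euclidean_space \<Rightarrow> real"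
  assumes f: "integrable lborel f"
    and zero: "AE \<xi> in lborel. (LINT x|lborel. cis (- (x \<bullet> \<xi>)) * complex_of_real (f x)) = 0"
  shows "AE x in lborel. f x = 0"
proof (rule AE_zero_if_box_integrals_zero [OF f])
  fix a b :: 'a
  have [measurable]: "f \<in> borel_measurable borel" using f by auto
  define e where "e = (\<lambda>z::'a. gauss 1 z)"
  have [measurable]: "e \<in> borel_measurable borel" unfolding e_def by measurable
  have e: "integrable lborel e" "\<And>z. 0 \<le> e z" "(LINT z|lborel. e z) = 1"
    using gauss_integrable [of 1, where 'a = 'a] gauss_nonneg [of 1]
      integral_eq_nn_integral [of "gauss 1 :: 'a \<Rightarrow> real" lborel] gauss_nn_integral [of 1, where 'a = 'a]
    by (auto simp: e_def [abs_def])
  define P where "P = (\<lambda>n x. LINT z|lborel. indicator (box a b) (x + z /\<^sub>R real (Suc n)) * e z)"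
  have mi: "integrable lborel (\<lambda>z. indicator (box a b) (x + z /\<^sub>R real (Suc n)) * e z)" for x n
    by (rule Bochner_Integration.integrable_bound [OF e(1)]) (auto split: split_indicator)
  have Pz: "(LINT x|lborel. f x * P n x) = 0" for n
  proof -
    define k where "k = real (Suc n)"
    have k: "k > 0" by (simp add: k_def)
    have "integrable (lborel \<Otimes>\<^sub>M lborel) (\<lambda>z. f (fst z) * indicator (box a b) (snd z :: 'a))"
    proof (rule lborel_pair.Fubini_integrable)
      show "integrable lborel (\<lambda>x. LINT y|lborel. norm (f (fst (x, y)) * indicator (box a b) (snd (x, y) :: 'a)))"
        using f by (auto simp: abs_mult)
    qed (auto intro!: integrable_mult_right integrable_real_indicator simp: emeasure_lborel_box_eq)
    then have int: "integrable (lborel \<Otimes>\<^sub>M lborel) (\<lambda>(x, y). f x * (indicator (box a b) y * exp (- (k\<^sup>2 / 4) * (norm (x - y))\<^sup>2)))"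
      by (rule Bochner_Integration.integrable_bound) (auto simp: abs_mult split_beta split: split_indicator intro!: mult_left_le)
    \<comment> \<open>In the variable \<open>y = x + z / k\<close> the mollified indicator is an average of Gaussians over the box.\<close>
    define C where "C = k ^ DIM('a) / sqrt (4 * pi) ^ DIM('a)"
    have Pn: "P n x = C * (LINT y|lborel. indicator (box a b) y * exp (- (k\<^sup>2 / 4) * (norm (x - y))\<^sup>2))" for x
    proof -
      have "P n x = (LINT z|density (distr lborel borel (\<lambda>y. - (k *\<^sub>R x) + k *\<^sub>R y)) (\<lambda>_. \<bar>k\<bar> ^ DIM('a)). indicator (box a b) (x + z /\<^sub>R k) * e z)"
        unfolding P_def k_def [symmetric] using k lborel_affine [of k "- (k *\<^sub>R x)"] by simp
      also have "\<dots> = (LINT y|lborel. k ^ DIM('a) * (indicator (box a b) (x + (- (k *\<^sub>R x) + k *\<^sub>R y) /\<^sub>R k) * e (- (k *\<^sub>R x) + k *\<^sub>R y)))"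
        using k by (subst integral_density) (auto simp: integral_distr)
      also have "\<dots> = (LINT y|lborel. C * (indicator (box a b) y * exp (- (k\<^sup>2 / 4) * (norm (x - y))\<^sup>2)))"
      proof (rule Bochner_Integration.integral_cong)
        fix y :: 'a
        have 1: "x + (- (k *\<^sub>R x) + k *\<^sub>R y) /\<^sub>R k = y"
          using k by (simp add: scaleR_add_right scaleR_diff_right)
        have "- (k *\<^sub>R x) + k *\<^sub>R y = k *\<^sub>R (y - x)" by (simp add: algebra_simps)
        then have "(norm (- (k *\<^sub>R x) + k *\<^sub>R y))\<^sup>2 = k\<^sup>2 * (norm (x - y))\<^sup>2"
          using k by (simp add: power_mult_distrib norm_minus_commute)
        then show "k ^ DIM('a) * (indicator (box a b) (x + (- (k *\<^sub>R x) + k *\<^sub>R y) /\<^sub>R k) * e (- (k *\<^sub>R x) + k *\<^sub>R y))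
           = C * (indicator (box a b) y * exp (- (k\<^sup>2 / 4) * (norm (x - y))\<^sup>2))"
          unfolding 1 by (simp add: e_def gauss_def C_def)
      qed simp
      finally show ?thesis by simp
    qed
    have "(LINT x|lborel. f x * P n x)
       = C * (LINT x|lborel. LINT y|lborel. f x * (indicator (box a b) y * exp (- (k\<^sup>2 / 4) * (norm (x - y))\<^sup>2)))"
      unfolding Pn by (simp add: mult.left_commute)
    also have "(LINT x|lborel. LINT y|lborel. f x * (indicator (box a b) y * exp (- (k\<^sup>2 / 4) * (norm (x - y))\<^sup>2)))
       = (LINT y|lborel. LINT x|lborel. f x * (indicator (box a b) y * exp (- (k\<^sup>2 / 4) * (norm (x - y))\<^sup>2)))"
      by (rule lborel_pair.Fubini_integral [OF int, symmetric])
    also have "\<dots> = (LINT y|lborel. indicator (box a b) y * (LINT x|lborel. f x * exp (- (k\<^sup>2 / 4) * (norm (x - y))\<^sup>2)))"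
      by (subst integral_mult_right_zero [symmetric]) (simp add: mult.left_commute)
    also have "\<dots> = 0"
      using gauss_convolution_eq_zero_of_fourier_zero [OF f zero, of "k\<^sup>2 / 4"] k by simp
    finally show ?thesis by simp
  qed
  have "(\<lambda>n. LINT x|lborel. f x * P n x) \<longlonglongrightarrow> (LINT x|lborel. f x * indicator (box a b) x)"
  proof (rule integral_dominated_convergence [where w = "\<lambda>x. \<bar>f x\<bar>"])
    have P1: "\<bar>P n x\<bar> \<le> 1" for n x
    proof -
      have "P n x \<ge> 0" unfolding P_def using e by (intro Bochner_Integration.integral_nonneg) auto
      moreover have "P n x \<le> (LINT z|lborel. e z)"
        unfolding P_def by (intro integral_mono mi e) (auto simp: e split: split_indicator)
      ultimately show ?thesis using e by auto
    qed
    show "AE x in lborel. norm (f x * P n x) \<le> \<bar>f x\<bar>" for n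
      using P1 by (auto simp: abs_mult intro!: mult_left_le)
    show "(\<lambda>x. f x * P n x) \<in> borel_measurable lborel" for n
      unfolding P_def by measurable
    have lim: "(\<lambda>n. P n x) \<longlonglongrightarrow> indicator (box a b) x" if x: "x \<in> box a b \<or> x \<notin> cbox a b" for x
    proof -
      have "(\<lambda>n. P n x) \<longlonglongrightarrow> (LINT z|lborel. indicator (box a b) x * e z)"
        unfolding P_def
      proof (rule integral_dominated_convergence [where w = e])
        show "AE z in lborel. (\<lambda>n. indicator (box a b) (x + z /\<^sub>R real (Suc n)) * e z) \<longlonglongrightarrow> indicator (box a b) x * e z"
        proof (rule AE_I2)
          fix z :: 'a
          have "(\<lambda>n. x + inverse (real (Suc n)) *\<^sub>R z) \<longlonglongrightarrow> x + 0 *\<^sub>R z"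
            by (intro tendsto_intros LIMSEQ_inverse_real_of_nat)
          then have l: "(\<lambda>n. x + z /\<^sub>R real (Suc n)) \<longlonglongrightarrow> x" by simp
          have "\<forall>\<^sub>F n in sequentially. indicator (box a b) (x + z /\<^sub>R real (Suc n)) = (indicator (box a b) x :: real)"
          proof (cases "x \<in> box a b")
            case True
            then show ?thesis
              using topological_tendstoD [OF l open_box True] by (auto elim!: eventually_mono)
          next
            case False
            then have "x \<in> - cbox a b" using x by auto
            then have "\<forall>\<^sub>F n in sequentially. x + z /\<^sub>R real (Suc n) \<in> - cbox a b"
              by (intro topological_tendstoD [OF l]) (auto simp: open_Compl closed_cbox)
            then show ?thesis
              using False box_subset_cbox [of a b] by (auto elim!: eventually_mono simp: indicator_def subset_iff)
          qed
          then show "(\<lambda>n. indicator (box a b) (x + z /\<^sub>R real (Suc n)) * e z) \<longlonglongrightarrow> indicator (box a b) x * e z"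
            by (intro tendsto_mult tendsto_const tendsto_eventually)
        qed
      qed (use e in \<open>auto split: split_indicator\<close>)
      then show ?thesis using e by simp
    qed
    show "AE x in lborel. (\<lambda>n. f x * P n x) \<longlonglongrightarrow> f x * indicator (box a b) x"
      using AE_not_in_box_frontier [of a b] by eventually_elim (intro tendsto_mult tendsto_const lim)
  qed (use f in auto)
  then have "(LINT x|lborel. f x * indicator (box a b) x) = 0"
    unfolding Pz by (simp add: LIMSEQ_const_iff)
  then show "(LINT x:box a b|lborel. f x) = 0"
    by (simp add: set_lebesgue_integral_def mult.commute)
qed

section \<open>Cauchy's formula for a sector in logarithmic coordinates\<close>

text \<open>
  Rotate by the direction that bisects the two arguments and take real parts.
\<close>
lemma norm_add_polar_ge:
  assumes "0 \<le> r" "0 \<le> \<rho>"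
  shows "cos ((a - b) / 2) * (r + \<rho>) \<le> norm (of_real r * cis a + of_real \<rho> * cis b)"
proof -
  have "norm (of_real r * cis a + of_real \<rho> * cis b)
      = norm (cis (- ((a + b) / 2)) * (of_real r * cis a + of_real \<rho> * cis b))"
    by (simp add: norm_mult)
  also have "\<dots> = norm (of_real r * cis ((a - b) / 2) + of_real \<rho> * cis ((b - a) / 2))"
    by (simp add: algebra_simps cis_mult mult.left_commute [of "cis _"] diff_divide_distrib add_divide_distrib)
  also have "\<dots> \<ge> Re (of_real r * cis ((a - b) / 2) + of_real \<rho> * cis ((b - a) / 2))"
    by (rule complex_Re_le_cmod)
  also have "Re (of_real r * cis ((a - b) / 2) + of_real \<rho> * cis ((b - a) / 2)) = cos ((a - b) / 2) * (r + \<rho>)"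
    using cos_minus [of "(a - b) / 2"] by (simp add: algebra_simps minus_divide_left)
  finally show ?thesis .
qed

lemma integrable_exp_neg_abs:
  assumes "0 < \<kappa>"
  shows "integrable lborel (\<lambda>x::real. exp (- \<kappa> * \<bar>x\<bar>))"
proof -
  interpret prob_space "density lborel (exponential_density \<kappa>)"
    by (rule prob_space_exponential_density [OF assms])
  have nn: "0 \<le> exponential_density \<kappa> x" for x using assms by (simp add: exponential_density_def)
  have "(\<integral>\<^sup>+x. ennreal (exponential_density \<kappa> x) \<partial>lborel) = 1"
    using emeasure_space_1 by (simp add: emeasure_density)
  then have i: "integrable lborel (exponential_density \<kappa>)"
    using nn by (intro integrableI_nonneg) auto
  then have "integrable lborel (\<lambda>x. exponential_density \<kappa> (0 + (-1) * x))"
    by (subst lborel_integrable_real_affine_iff) auto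
  with i have "integrable lborel (\<lambda>x. (exponential_density \<kappa> x + exponential_density \<kappa> (- x)) / \<kappa>)"
    by auto
  then show ?thesis
    by (rule Bochner_Integration.integrable_bound) (use assms in \<open>auto simp: exponential_density_def\<close>)
qed

text \<open>
  The integral \<open>1/(2\<pi>i) \<integral> g(z) dz\<close> along the two rays \<open>arg z = \<plusminus>\<theta>\<close>, running from \<open>\<infinity> e\<^sup>-\<^sup>i\<^sup>\<theta>\<close> through \<open>0\<close> to
  \<open>\<infinity> e\<^sup>i\<^sup>\<theta>\<close>, written in the coordinate \<open>z = e\<^sup>w\<close> with \<open>f(w) = g(e\<^sup>w) e\<^sup>w\<close>.  In this coordinate a power
  \<open>z\<^sup>\<alpha>\<close> is the entire function \<open>exp (\<alpha> w)\<close>, and no branch has to be chosen.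
\<close>
definition strip_integral :: "real \<Rightarrow> (complex \<Rightarrow> complex) \<Rightarrow> complex" where
  "strip_integral \<theta> f = (LINT x|lborel. f (Complex x \<theta>) - f (Complex x (- \<theta>))) / (2 * of_real pi * \<i>)"

lemma exp_Complex: "exp (Complex x y) = of_real (exp x) * cis y"
  by (simp add: exp_eq_polar)

text \<open>
  The numbers \<open>s\<close> and \<open>- exp (x + i y)\<close> have arguments \<open>0\<close> and \<open>y - \<pi>\<close>.
\<close>
lemma norm_diff_exp_ge:
  assumes "0 < s"
  shows "sin (\<bar>y\<bar> / 2) * (s + exp x) \<le> norm (of_real s - exp (Complex x y))"
proof -
  have 1: "sin (y / 2) * (s + exp x) \<le> norm (of_real s - exp (Complex x y))" for y
  proof -
    have "cos ((0 - (y - pi)) / 2) * (s + exp x) \<le> norm (of_real s * cis 0 + of_real (exp x) * cis (y - pi))"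
      using assms by (intro norm_add_polar_ge) auto
    moreover have "cos ((0 - (y - pi)) / 2) = sin (y / 2)"
      by (simp add: diff_divide_distrib cos_diff)
    moreover have "cis (y - pi) = - cis y"
      by (simp add: complex_eq_iff)
    ultimately show ?thesis by (simp add: exp_Complex)
  qed
  show ?thesis
  proof (cases "0 \<le> y")
    case False
    have "norm (of_real s - exp (Complex x y)) = norm (cnj (of_real s - exp (Complex x y)))" by (simp only: complex_mod_cnj)
    also have "cnj (of_real s - exp (Complex x y)) = of_real s - exp (Complex x (- y))"
      by (simp add: exp_Complex cis_cnj)
    finally show ?thesis using 1 [of "- y"] False by simp
  qed (use 1 in simp)
qed

lemma tendsto_integral_symmetric_interval:
  fixes g :: "real \<Rightarrow> complex"
  assumes g: "integrable lborel g"
  shows "(\<lambda>n. integral {- real n..real n} g) \<longlonglongrightarrow> (LINT x|lborel. g x)"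
proof -
  have [measurable]: "g \<in> borel_measurable borel" using g by auto
  have "(\<lambda>n. LINT x|lborel. indicator {- real n..real n} x *\<^sub>R g x) \<longlonglongrightarrow> (LINT x|lborel. g x)"
  proof (rule integral_dominated_convergence [where w = "\<lambda>x. norm (g x)"])
    show "AE x in lborel. (\<lambda>n. indicator {- real n..real n} x *\<^sub>R g x) \<longlonglongrightarrow> g x"
    proof (rule AE_I2)
      fix x :: real
      have "\<forall>\<^sub>F n in sequentially. indicator {- real n..real n} x *\<^sub>R g x = g x"
        using eventually_ge_at_top [of "nat \<lceil>\<bar>x\<bar>\<rceil>"]
        by eventually_elim (auto simp: indicator_def abs_le_iff nat_le_iff ceiling_le_iff)
      then show "(\<lambda>n. indicator {- real n..real n} x *\<^sub>R g x) \<longlonglongrightarrow> g x"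
        by (rule tendsto_eventually)
    qed
  qed (use g in \<open>auto split: split_indicator\<close>)
  moreover have "(LINT x|lborel. indicator {- real n..real n} x *\<^sub>R g x) = integral {- real n..real n} g" for n
    using set_borel_integral_eq_integral(2) [of "{- real n..real n}" g] integrable_mult_indicator [OF _ g, of "{- real n..real n}"]
    by (simp add: set_lebesgue_integral_def set_integrable_def)
  ultimately show ?thesis by simp
qed

lemma contour_integral_linepath_horizontal:
  assumes "a < b"
  shows "contour_integral (linepath (Complex a y) (Complex b y)) f = integral {a..b} (\<lambda>x. f (Complex x y))"
proof -
  have "contour_integral (linepath (Complex a y) (Complex b y)) f
      = contour_integral (linepath (of_real a) (of_real b)) (\<lambda>w. f (w + Complex 0 y))"
  proof -
    have "linepath (Complex a y) (Complex b y) t = linepath (of_real a) (of_real b) t + Complex 0 y" for t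
      by (simp add: linepath_def complex_eq_iff algebra_simps)
    moreover have "Complex b y - Complex a y = of_real b - of_real a" by (simp add: complex_eq_iff)
    ultimately show ?thesis by (simp add: contour_integral_integral)
  qed
  also have "\<dots> = integral {a..b} (\<lambda>x. f (Complex x y))"
    using assms by (subst contour_integral_linepath_Reals_eq) (simp_all add: Complex_eq)
  finally show ?thesis .
qed

text \<open>
  The kernel \<open>exp w / (s - exp w)\<close> has in the strip a single pole, at \<open>ln s\<close>, with residue \<open>-1\<close>.  The
  formula is Cauchy's theorem for the rectangle \<open>[-n, n] \<times> [-\<theta>, \<theta>]\<close>: the vertical sides vanish as
  \<open>n\<close> grows, and the horizontal sides converge to the two line integrals.
\<close>
proposition strip_cauchy_formula:
  fixes \<Phi> :: "complex \<Rightarrow> complex"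
  assumes \<theta>: "0 < \<theta>" "\<theta> < \<theta>'" "\<theta>' \<le> pi"
    and hol: "\<Phi> holomorphic_on {w. \<bar>Im w\<bar> < \<theta>'}"
    and bound: "\<And>w. \<bar>Im w\<bar> \<le> \<theta> \<Longrightarrow> norm (\<Phi> w * exp w) \<le> C * ((1 + exp (Re w)) * exp (- \<kappa> * \<bar>Re w\<bar>))"
    and \<kappa>: "0 < \<kappa>" and s: "0 < s"
  shows "strip_integral \<theta> (\<lambda>w. \<Phi> w * exp w / (of_real s - exp w)) = \<Phi> (of_real (ln s))"
    and "\<bar>y\<bar> = \<theta> \<Longrightarrow> integrable lborel (\<lambda>x. \<Phi> (Complex x y) * exp (Complex x y) / (of_real s - exp (Complex x y)))"
proof -
  define S where "S = {w. \<bar>Im w\<bar> < \<theta>'}"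
  define a where "a = complex_of_real (ln s)"
  define k where "k = (\<lambda>w. \<Phi> w * exp w / (of_real s - exp w))"
  have C: "C \<ge> 0"
  proof -
    have "0 \<le> norm (\<Phi> 0 * exp 0)" by simp
    also have "\<dots> \<le> C * 2" using bound [of 0] \<theta> by simp
    finally show ?thesis by simp
  qed
  have conv: "convex S" and op: "open S"
  proof -
    have "S = {w. Im w < \<theta>'} \<inter> {w. - \<theta>' < Im w}" by (auto simp: S_def)
    then show "convex S" "open S"
      by (auto intro!: convex_Int open_Int simp: convex_halfspace_Im_lt convex_halfspace_Im_gt open_halfspace_Im_lt open_halfspace_Im_gt)
  qed
  have exp_a: "exp a = of_real s" using s by (simp add: a_def exp_of_real)
  have zero: "exp w \<noteq> of_real s" if "w \<in> S" "w \<noteq> a" for w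
  proof
    assume "exp w = of_real s"
    then obtain n :: int where n: "w = a + (of_int (2 * n) * pi) * \<i>"
      using exp_eq [of w a] exp_a by auto
    have "\<bar>2 * of_int n * pi\<bar> < pi" using that(1) \<theta> unfolding S_def n by (simp add: a_def)
    then have "\<bar>2 * real_of_int n\<bar> < 1" by (simp add: abs_mult)
    then have "n = 0" by linarith
    with n that show False by simp
  qed
  \<comment> \<open>The difference quotient of \<open>exp\<close> has a removable singularity at \<open>ln s\<close> and no zero in the strip;
    dividing by it puts the integrand into the form of Cauchy's formula.\<close>
  define q where "q = (\<lambda>w. if w = a then deriv exp a else (exp w - exp a) / (w - a))"
  have holq: "q holomorphic_on S"
    unfolding q_def by (intro pole_lemma_open holomorphic_intros op)
  have q0: "q w \<noteq> 0" if "w \<in> S" for w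
    using zero [OF that] exp_a s DERIV_imp_deriv [OF DERIV_exp [of a]] by (auto simp: q_def)
  define f where "f = (\<lambda>w. - (\<Phi> w * exp w) / q w)"
  have holf: "f holomorphic_on S"
    unfolding f_def using hol holq q0 by (intro holomorphic_intros) (auto simp: S_def)
  have fk: "f w / (w - a) = k w" if "w \<in> S" "w \<noteq> a" for w
  proof -
    have "of_real s - exp w = - (exp w - of_real s)" by simp
    then show ?thesis using zero [OF that] that unfolding f_def k_def q_def
      by (simp add: exp_a) (metis minus_diff_eq minus_divide_right)
  qed
  have fa: "f a = - \<Phi> a"
    using exp_a s DERIV_imp_deriv [OF DERIV_exp [of a]] by (simp add: f_def q_def)
  have contk: "continuous_on (S - {a}) k"
  proof -
    have "\<forall>w\<in>S - {a}. of_real s - exp w \<noteq> 0" using zero by (metis DiffE insertCI right_minus_eq)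
    moreover have "continuous_on (S - {a}) \<Phi>"
      using hol by (intro holomorphic_on_imp_continuous_on) (auto simp: S_def intro: holomorphic_on_subset)
    ultimately show ?thesis unfolding k_def by (intro continuous_intros) auto
  qed
  define D where "D = C * (1 + 1 / s) / sin (\<theta> / 2)"
  have sin: "sin (\<theta> / 2) > 0" using \<theta> by (intro sin_gt_zero) auto
  have one_s: "1 + exp x \<le> (1 + 1 / s) * (s + exp x)" for x :: real
    using s by (simp add: field_simps)
  have kb: "norm (k (Complex x y)) \<le> D * exp (- \<kappa> * \<bar>x\<bar>)" if y: "\<bar>y\<bar> = \<theta>" for x y
  proof -
    have "norm (k (Complex x y)) \<le> C * ((1 + exp x) * exp (- \<kappa> * \<bar>x\<bar>)) / (sin (\<theta> / 2) * (s + exp x))"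
      unfolding k_def norm_divide
      using bound [of "Complex x y"] norm_diff_exp_ge [OF s, of y x] y sin s
      by (intro frac_le) (auto intro!: mult_pos_pos add_pos_pos mult_nonneg_nonneg C)
    also have "\<dots> \<le> C * ((1 + 1 / s) * (s + exp x) * exp (- \<kappa> * \<bar>x\<bar>)) / (sin (\<theta> / 2) * (s + exp x))"
      using C sin s one_s [of x]
      by (intro divide_right_mono mult_left_mono mult_right_mono) (auto intro!: mult_nonneg_nonneg add_nonneg_nonneg)
    also have "\<dots> = D * exp (- \<kappa> * \<bar>x\<bar>)"
    proof -
      have "C * (r * u * E) / (S * u) = C * r / S * E" if "u \<noteq> 0" for r u E S :: real
        using that by simp
      moreover have "s + exp x \<noteq> 0" using s exp_gt_zero [of x] by linarith
      ultimately show ?thesis by (simp add: D_def)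
    qed
    finally show ?thesis .
  qed
  have line: "Complex x y \<in> S - {a}" if "\<bar>y\<bar> = \<theta>" for x y
    using that \<theta> by (auto simp: S_def a_def complex_eq_iff)
  have contline: "continuous_on UNIV (\<lambda>x. k (Complex x y))" if y: "\<bar>y\<bar> = \<theta>" for y
    by (rule continuous_on_compose2 [OF contk, of UNIV "\<lambda>x. Complex x y"])
       (use line [OF y] in \<open>auto intro!: continuous_intros simp: Complex_eq\<close>)
  have kint: "integrable lborel (\<lambda>x. k (Complex x y))" if y: "\<bar>y\<bar> = \<theta>" for y
  proof (rule Bochner_Integration.integrable_bound)
    show "integrable lborel (\<lambda>x. D * exp (- \<kappa> * \<bar>x\<bar>))"
      using integrable_exp_neg_abs [OF \<kappa>] by auto
    show "(\<lambda>x. k (Complex x y)) \<in> borel_measurable lborel"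
      using borel_measurable_continuous_onI [OF contline [OF y]] by simp
    show "AE x in lborel. norm (k (Complex x y)) \<le> norm (D * exp (- \<kappa> * \<bar>x\<bar>))"
      using kb [OF y] by (intro AE_I2) (metis abs_ge_self order_trans real_norm_def)
  qed
  then show "\<bar>y\<bar> = \<theta> \<Longrightarrow> integrable lborel (\<lambda>x. \<Phi> (Complex x y) * exp (Complex x y) / (of_real s - exp (Complex x y)))"
    by (simp add: k_def)
  have lim1: "(\<lambda>n. integral {- real n..real n} (\<lambda>x. k (Complex x y))) \<longlonglongrightarrow> (LINT x|lborel. k (Complex x y))"
    if "\<bar>y\<bar> = \<theta>" for y
    by (rule tendsto_integral_symmetric_interval [OF kint [OF that]])
  define V where "V = (\<lambda>n. contour_integral (linepath (Complex (real n) (- \<theta>)) (Complex (real n) \<theta>)) k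
      - contour_integral (linepath (Complex (- real n) (- \<theta>)) (Complex (- real n) \<theta>)) k)"
  have rect: "integral {- real n..real n} (\<lambda>x. k (Complex x (- \<theta>))) + V n
      - integral {- real n..real n} (\<lambda>x. k (Complex x \<theta>)) = - (2 * of_real pi * \<i> * \<Phi> a)"
    if n: "real n > \<bar>ln s\<bar>" for n
  proof -
    let ?A = "Complex (- real n) (- \<theta>)" and ?B = "Complex (real n) (- \<theta>)"
    let ?C = "Complex (real n) \<theta>" and ?E = "Complex (- real n) \<theta>"
    have abox: "a \<in> box ?A ?C"
      using n \<theta> by (auto simp: in_box_complex_iff a_def)
    have le: "Re ?A < Re ?C" "Im ?A < Im ?C" using n \<theta> by auto
    have img: "path_image (rectpath ?A ?C) \<subseteq> S - {a}"
    proof -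
      have "path_image (rectpath ?A ?C) \<subseteq> cbox ?A ?C - box ?A ?C"
        using le by (subst path_image_rectpath_cbox_minus_box) auto
      moreover have "cbox ?A ?C \<subseteq> S" using \<theta> by (auto simp: in_cbox_complex_iff S_def)
      ultimately show ?thesis using abox by blast
    qed
    have "((\<lambda>w. f w / (w - a)) has_contour_integral (2 * pi * \<i> * winding_number (rectpath ?A ?C) a * f a)) (rectpath ?A ?C)"
      using conv holf img op \<theta>
      by (intro Cauchy_integral_formula_convex_simple) (auto simp: interior_open S_def a_def)
    then have "(k has_contour_integral (2 * pi * \<i> * winding_number (rectpath ?A ?C) a * f a)) (rectpath ?A ?C)"
      by (rule has_contour_integral_eq) (use img fk in auto)
    then have hk: "(k has_contour_integral (- (2 * of_real pi * \<i> * \<Phi> a))) (rectpath ?A ?C)"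
      using winding_number_rectpath [OF abox] by (simp add: fa)
    have img': "closed_segment ?A ?B \<subseteq> S - {a}" "closed_segment ?B ?C \<subseteq> S - {a}"
        "closed_segment ?C ?E \<subseteq> S - {a}" "closed_segment ?E ?A \<subseteq> S - {a}"
      using img le by (auto simp: path_image_rectpath rectpath_def Let_def path_image_join)
    have ci: "k contour_integrable_on linepath ?A ?B" "k contour_integrable_on linepath ?B ?C"
        "k contour_integrable_on linepath ?C ?E" "k contour_integrable_on linepath ?E ?A"
      by (intro contour_integrable_continuous_linepath continuous_on_subset [OF contk] img')+
    have "contour_integral (rectpath ?A ?C) k
        = contour_integral (linepath ?A ?B) k + (contour_integral (linepath ?B ?C) k
        + (contour_integral (linepath ?C ?E) k + contour_integral (linepath ?E ?A) k))"
      unfolding rectpath_def Let_def using ci by simp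
    then have "- (2 * of_real pi * \<i> * \<Phi> a)
        = contour_integral (linepath ?A ?B) k + contour_integral (linepath ?B ?C) k
        + contour_integral (linepath ?C ?E) k + contour_integral (linepath ?E ?A) k"
      using contour_integral_unique [OF hk] by simp
    moreover have "contour_integral (linepath ?C ?E) k = - contour_integral (linepath ?E ?C) k"
      "contour_integral (linepath ?E ?A) k = - contour_integral (linepath ?A ?E) k"
      by (rule contour_integral_reverse_linepath, intro continuous_on_subset [OF contk], use img' in \<open>simp add: closed_segment_commute\<close>)+
    moreover have "contour_integral (linepath ?A ?B) k = integral {- real n..real n} (\<lambda>x. k (Complex x (- \<theta>)))"
      "contour_integral (linepath ?E ?C) k = integral {- real n..real n} (\<lambda>x. k (Complex x \<theta>))"
      using le by (intro contour_integral_linepath_horizontal; simp)+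
    ultimately show ?thesis by (simp add: V_def algebra_simps)
  qed
  have vert: "norm (k w) \<le> 2 * C * exp (- \<kappa> * real n) * (1 + 1 / s) * 2"
    if w: "\<bar>Re w\<bar> = real n" "\<bar>Im w\<bar> \<le> \<theta>" and n: "real n \<ge> \<bar>ln s\<bar> + ln 3" for n w
  proof -
    have dist: "norm (of_real s - exp w) \<ge> (s + exp (Re w)) / 2"
    proof -
      have "norm (of_real s - exp w) \<ge> \<bar>s - exp (Re w)\<bar>"
        using norm_triangle_ineq3 [of "of_real s" "exp w"] s by simp
      moreover have "exp (Re w) \<ge> 3 * s \<or> s \<ge> 3 * exp (Re w)"
      proof (cases "Re w \<ge> 0")
        case True
        then have "Re w \<ge> ln s + ln 3" using w n by linarith
        then have "exp (Re w) \<ge> exp (ln s + ln 3)" by simp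
        then show ?thesis using s by (simp add: exp_add)
      next
        case False
        then have "Re w + ln 3 \<le> ln s" using w n by linarith
        then have "exp (Re w + ln 3) \<le> exp (ln s)" by simp
        then show ?thesis using s by (simp add: exp_add)
      qed
      \<comment> \<open>Far out on the real axis one of \<open>s\<close> and \<open>exp (Re w)\<close> dominates the other by a factor of \<open>3\<close>.\<close>
      moreover have "(s + e) / 2 \<le> \<bar>s - e\<bar>" if "e \<ge> 3 * s \<or> s \<ge> 3 * e" for e :: real
        using that by (cases "s \<le> e") (auto simp: field_simps)
      ultimately show ?thesis using order_trans by blast
    qed
    have "norm (k w) \<le> C * ((1 + exp (Re w)) * exp (- \<kappa> * real n)) / ((s + exp (Re w)) / 2)"
      unfolding k_def norm_divide using bound [OF w(2)] w(1) dist s by (intro frac_le) (auto intro: add_pos_pos mult_nonneg_nonneg C)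
    also have "\<dots> \<le> C * ((1 + 1 / s) * (s + exp (Re w)) * exp (- \<kappa> * real n)) / ((s + exp (Re w)) / 2)"
      using C s one_s [of "Re w"]
      by (intro divide_right_mono mult_left_mono mult_right_mono) (auto intro!: add_nonneg_nonneg)
    also have "\<dots> = 2 * C * exp (- \<kappa> * real n) * (1 + 1 / s)"
    proof -
      have "s + exp (Re w) > 0" using s by (auto intro: add_pos_pos)
      then show ?thesis by (simp add: field_simps)
    qed
    also have "\<dots> \<le> 2 * C * exp (- \<kappa> * real n) * (1 + 1 / s) * 2"
      using C s by simp
    finally show ?thesis .
  qed
  have V0: "V \<longlonglongrightarrow> 0"
  proof (rule Lim_null_comparison)
    define M where "M = (\<lambda>n. 2 * C * exp (- \<kappa> * real n) * (1 + 1 / s) * 2)"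
    show "\<forall>\<^sub>F n in sequentially. norm (V n) \<le> M n * (2 * \<theta>) + M n * (2 * \<theta>)"
      using eventually_ge_at_top [of "nat \<lceil>\<bar>ln s\<bar> + ln 3\<rceil>"]
    proof eventually_elim
      case (elim n)
      then have n: "real n \<ge> \<bar>ln s\<bar> + ln 3" by linarith
      have n': "real n > \<bar>ln s\<bar>" using n ln_gt_zero [of "3::real"] by linarith
      have *: "norm (contour_integral (linepath (Complex r (- \<theta>)) (Complex r \<theta>)) k) \<le> M n * (2 * \<theta>)"
        if r: "\<bar>r\<bar> = real n" for r
      proof -
        have seg: "Re w = r \<and> \<bar>Im w\<bar> \<le> \<theta>" if "w \<in> closed_segment (Complex r (- \<theta>)) (Complex r \<theta>)" for w
          using that \<theta> by (auto simp: closed_segment_same_Re closed_segment_eq_real_ivl)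
        have "norm (contour_integral (linepath (Complex r (- \<theta>)) (Complex r \<theta>)) k) \<le> M n * norm (Complex r \<theta> - Complex r (- \<theta>))"
        proof (rule contour_integral_bound_linepath)
          show "k contour_integrable_on linepath (Complex r (- \<theta>)) (Complex r \<theta>)"
          proof (intro contour_integrable_continuous_linepath continuous_on_subset [OF contk] subsetI)
            fix w assume "w \<in> closed_segment (Complex r (- \<theta>)) (Complex r \<theta>)"
            from seg [OF this] show "w \<in> S - {a}" using \<theta> n' r by (auto simp: S_def a_def)
          qed
          show "0 \<le> M n" using C s by (simp add: M_def)
          show "norm (k w) \<le> M n" if "w \<in> closed_segment (Complex r (- \<theta>)) (Complex r \<theta>)" for w
            unfolding M_def using seg [OF that] r n by (intro vert) auto
        qed
        also have "norm (Complex r \<theta> - Complex r (- \<theta>)) = 2 * \<theta>"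
          using \<theta> by (simp add: cmod_def real_sqrt_mult)
        finally show ?thesis .
      qed
      show ?case unfolding V_def
        by (rule order_trans [OF norm_triangle_ineq4]) (intro add_mono *; simp)
    qed
    have "(\<lambda>n. exp (- \<kappa> * real n)) \<longlonglongrightarrow> 0"
      using \<kappa> by real_asymp
    then have "M \<longlonglongrightarrow> 2 * C * 0 * (1 + 1 / s) * 2"
      unfolding M_def by (intro tendsto_intros)
    then have "M \<longlonglongrightarrow> 0" by simp
    then have "(\<lambda>n. M n * (2 * \<theta>) + M n * (2 * \<theta>)) \<longlonglongrightarrow> 0 * (2 * \<theta>) + 0 * (2 * \<theta>)"
      by (intro tendsto_add tendsto_mult tendsto_const)
    then show "(\<lambda>n. M n * (2 * \<theta>) + M n * (2 * \<theta>)) \<longlonglongrightarrow> 0" by simp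
  qed
  have "(\<lambda>n. integral {- real n..real n} (\<lambda>x. k (Complex x (- \<theta>))) + V n
      - integral {- real n..real n} (\<lambda>x. k (Complex x \<theta>)))
     \<longlonglongrightarrow> (LINT x|lborel. k (Complex x (- \<theta>))) + 0 - (LINT x|lborel. k (Complex x \<theta>))"
    using \<theta> by (intro tendsto_intros lim1 V0) auto
  moreover have "(\<lambda>n. integral {- real n..real n} (\<lambda>x. k (Complex x (- \<theta>))) + V n
      - integral {- real n..real n} (\<lambda>x. k (Complex x \<theta>))) \<longlonglongrightarrow> - (2 * of_real pi * \<i> * \<Phi> a)"
  proof (rule tendsto_eventually)
    show "\<forall>\<^sub>F n in sequentially. integral {- real n..real n} (\<lambda>x. k (Complex x (- \<theta>))) + V n
      - integral {- real n..real n} (\<lambda>x. k (Complex x \<theta>)) = - (2 * of_real pi * \<i> * \<Phi> a)"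
      using eventually_gt_at_top [of "nat \<lceil>\<bar>ln s\<bar>\<rceil>"]
      by eventually_elim (rule rect, linarith)
  qed
  ultimately have "(LINT x|lborel. k (Complex x (- \<theta>))) - (LINT x|lborel. k (Complex x \<theta>)) = - (2 * of_real pi * \<i> * \<Phi> a)"
    using LIMSEQ_unique by fastforce
  moreover have "(LINT x|lborel. k (Complex x \<theta>) - k (Complex x (- \<theta>)))
      = (LINT x|lborel. k (Complex x \<theta>)) - (LINT x|lborel. k (Complex x (- \<theta>)))"
    using \<theta> by (intro Bochner_Integration.integral_diff kint) auto
  ultimately have "(LINT x|lborel. k (Complex x \<theta>) - k (Complex x (- \<theta>))) = 2 * of_real pi * \<i> * \<Phi> a"
    by (metis minus_diff_eq minus_minus)
  then show "strip_integral \<theta> (\<lambda>w. \<Phi> w * exp w / (of_real s - exp w)) = \<Phi> (of_real (ln s))"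
    by (simp add: strip_integral_def k_def a_def)
qed

text \<open>
  In the variable \<open>z = e\<^sup>w\<close>: a function that is bounded near \<open>0\<close> and decays like \<open>|z|\<^sup>-\<^sup>\<kappa>\<close> at infinity.
\<close>
corollary strip_cauchy_formula_decay:
  fixes \<Phi> :: "complex \<Rightarrow> complex"
  assumes \<theta>: "0 < \<theta>" "\<theta> < \<theta>'" "\<theta>' \<le> pi"
    and hol: "\<Phi> holomorphic_on {w. \<bar>Im w\<bar> < \<theta>'}"
    and bounded: "\<And>w. \<bar>Im w\<bar> \<le> \<theta> \<Longrightarrow> norm (\<Phi> w) \<le> C"
    and decay: "\<And>w. \<bar>Im w\<bar> \<le> \<theta> \<Longrightarrow> norm (\<Phi> w) \<le> C * exp (- \<kappa> * Re w)"
    and \<kappa>: "0 < \<kappa>" "\<kappa> \<le> 1" and s: "0 < s"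
  shows "strip_integral \<theta> (\<lambda>w. \<Phi> w * exp w / (of_real s - exp w)) = \<Phi> (of_real (ln s))"
    and "\<bar>y\<bar> = \<theta> \<Longrightarrow> integrable lborel (\<lambda>x. \<Phi> (Complex x y) * exp (Complex x y) / (of_real s - exp (Complex x y)))"
proof -
  have "norm (\<Phi> 0) \<le> C" using bounded [of 0] \<theta> by simp
  then have C: "0 \<le> C" using norm_ge_zero order_trans by blast
  have bound: "norm (\<Phi> w * exp w) \<le> C * ((1 + exp (Re w)) * exp (- \<kappa> * \<bar>Re w\<bar>))" if w: "\<bar>Im w\<bar> \<le> \<theta>" for w
  proof (cases "Re w \<ge> 0")
    case True
    have "norm (\<Phi> w) * exp (Re w) \<le> (C * exp (- \<kappa> * \<bar>Re w\<bar>)) * (1 + exp (Re w))"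
      using decay [OF w] True C by (intro mult_mono) auto
    then show ?thesis by (simp add: norm_mult mult_ac)
  next
    case False
    have "Re w \<le> \<kappa> * Re w" using False \<kappa> mult_right_mono_neg [of \<kappa> 1 "Re w"] by simp
    then have "exp (Re w) \<le> exp (- \<kappa> * \<bar>Re w\<bar>)" using False by simp
    also have "\<dots> \<le> (1 + exp (Re w)) * exp (- \<kappa> * \<bar>Re w\<bar>)"
      using mult_right_mono [of 1 "1 + exp (Re w)" "exp (- \<kappa> * \<bar>Re w\<bar>)"] by simp
    finally show ?thesis
      unfolding norm_mult using bounded [OF w] C by (intro mult_mono) auto
  qed
  show "strip_integral \<theta> (\<lambda>w. \<Phi> w * exp w / (of_real s - exp w)) = \<Phi> (of_real (ln s))"
    by (rule strip_cauchy_formula(1) [OF \<theta> hol bound \<kappa>(1) s])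
  show "\<bar>y\<bar> = \<theta> \<Longrightarrow> integrable lborel (\<lambda>x. \<Phi> (Complex x y) * exp (Complex x y) / (of_real s - exp (Complex x y)))"
    by (rule strip_cauchy_formula(2) [OF \<theta> hol bound \<kappa>(1) s])
qed

section \<open>Laplace transforms\<close>

text \<open>
  With \<open>x = e\<^sup>-\<^sup>t\<close> the hypothesis says that all moments vanish, so by Weierstrass' theorem \<open>f\<close> is
  annihilated by \<open>\<phi>(e\<^sup>-\<^sup>t)\<close> for every continuous \<open>\<phi>\<close> on \<open>[0,1]\<close>.  The functions \<open>x cos(\<omega> ln x)\<close> and
  \<open>x sin(\<omega> ln x)\<close> are continuous also at \<open>0\<close>; they show that a Fourier transform vanishes.
\<close>
proposition laplace_injective:
  fixes f :: "real \<Rightarrow> real"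
  assumes f: "integrable lborel (\<lambda>t. indicator {0<..} t * (exp (- c * t) * f t))"
    and zero: "\<And>n::nat. (LINT t|lborel. indicator {0<..} t * (exp (- (c + real n) * t) * f t)) = 0"
  shows "AE t in lborel. 0 < t \<longrightarrow> f t = 0"
proof -
  define g where "g = (\<lambda>t. indicator {0<..} t * (exp (- c * t) * f t))"
  have g: "integrable lborel g" using f by (simp add: g_def)
  have [measurable]: "g \<in> borel_measurable borel" using g by auto
  have g0: "g t = 0" if "t \<le> 0" for t using that by (simp add: g_def)
  have pow: "(LINT t|lborel. exp (- t) ^ n * g t) = 0" for n
  proof -
    have "exp (- t) ^ n * g t = indicator {0<..} t * (exp (- (c + real n) * t) * f t)" for t
      by (simp add: g_def exp_of_nat_mult [symmetric] exp_add [symmetric] algebra_simps mult_exp_exp)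
    then show ?thesis using zero by simp
  qed
  have powi: "integrable lborel (\<lambda>t. exp (- t) ^ n * g t)" for n
  proof (rule Bochner_Integration.integrable_bound [OF g])
    show "AE t in lborel. norm (exp (- t) ^ n * g t) \<le> norm (g t)"
    proof (rule AE_I2)
      fix t :: real
      show "norm (exp (- t) ^ n * g t) \<le> norm (g t)"
      proof (cases "t > 0")
        case True
        then have "exp (- t) ^ n \<le> 1" by (intro power_le_one) auto
        then show ?thesis by (simp add: abs_mult mult_left_le_one_le)
      qed (simp add: g0)
    qed
  qed auto
  have cont: "(LINT t|lborel. \<phi> (exp (- t)) * g t) = 0"
    if \<phi>: "continuous_on {0..1} \<phi>" and [measurable]: "\<phi> \<in> borel_measurable borel" for \<phi> :: "real \<Rightarrow> real"
  proof -
    have "bounded (\<phi> ` {0..1})"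
      by (intro compact_imp_bounded compact_continuous_image [OF \<phi>]) simp
    then obtain K where K: "\<And>x. x \<in> {0..1} \<Longrightarrow> norm (\<phi> x) \<le> K"
      unfolding bounded_iff by blast
    have \<phi>i: "integrable lborel (\<lambda>t. \<phi> (exp (- t)) * g t)"
    proof (rule Bochner_Integration.integrable_bound)
      show "integrable lborel (\<lambda>t. K * g t)" using g by auto
      show "AE t in lborel. norm (\<phi> (exp (- t)) * g t) \<le> norm (K * g t)"
      proof (rule AE_I2)
        fix t :: real
        show "norm (\<phi> (exp (- t)) * g t) \<le> norm (K * g t)"
          using K [of "exp (- t)"] g0 [of t]
          by (cases "t > 0") (auto simp: abs_mult intro!: mult_right_mono)
      qed
    qed auto
    have "\<bar>LINT t|lborel. \<phi> (exp (- t)) * g t\<bar> \<le> e * (LINT t|lborel. \<bar>g t\<bar>)" if e: "e > 0" for e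
    proof -
      obtain p where p: "real_polynomial_function p" "\<And>x. x \<in> {0..1} \<Longrightarrow> \<bar>\<phi> x - p x\<bar> < e"
        using Stone_Weierstrass_real_polynomial_function [OF _ \<phi> e] by auto
      obtain a n where an: "p = (\<lambda>x. \<Sum>i\<le>n. a i * x ^ i)"
        using p(1) by (auto simp: real_polynomial_function_iff_sum)
      have pint: "integrable lborel (\<lambda>t. p (exp (- t)) * g t)"
        unfolding an sum_distrib_right mult.assoc using powi by auto
      have "(LINT t|lborel. p (exp (- t)) * g t) = 0"
        unfolding an sum_distrib_right mult.assoc
        using powi pow by (subst Bochner_Integration.integral_sum) auto
      then have "\<bar>LINT t|lborel. \<phi> (exp (- t)) * g t\<bar> = \<bar>LINT t|lborel. \<phi> (exp (- t)) * g t - p (exp (- t)) * g t\<bar>"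
        using \<phi>i pint by simp
      also have "\<dots> \<le> (LINT t|lborel. \<bar>\<phi> (exp (- t)) * g t - p (exp (- t)) * g t\<bar>)"
        by (rule integral_abs_bound)
      also have "\<dots> \<le> (LINT t|lborel. e * \<bar>g t\<bar>)"
      proof (rule integral_mono)
        fix t :: real
        have "\<bar>\<phi> (exp (- t)) * g t - p (exp (- t)) * g t\<bar> = \<bar>\<phi> (exp (- t)) - p (exp (- t))\<bar> * \<bar>g t\<bar>"
          by (simp add: abs_mult [symmetric] algebra_simps)
        also have "\<dots> \<le> e * \<bar>g t\<bar>"
          using p(2) [of "exp (- t)"] g0 [of t] by (cases "t > 0") (auto intro!: mult_right_mono)
        finally show "\<bar>\<phi> (exp (- t)) * g t - p (exp (- t)) * g t\<bar> \<le> e * \<bar>g t\<bar>" .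
      qed (use \<phi>i pint g in auto)
      finally show ?thesis by simp
    qed
    note * = this
    have "\<bar>LINT t|lborel. \<phi> (exp (- t)) * g t\<bar> \<le> 0"
    proof (rule field_le_epsilon)
      fix e :: real assume e: "e > 0"
      define I where "I = (LINT t|lborel. \<bar>g t\<bar>)"
      have I: "I \<ge> 0" by (simp add: I_def)
      have "\<bar>LINT t|lborel. \<phi> (exp (- t)) * g t\<bar> \<le> e / (I + 1) * I"
        unfolding I_def [symmetric] using e I by (intro * [folded I_def]) auto
      also have "\<dots> \<le> e" using e I by (simp add: field_simps)
      finally show "\<bar>LINT t|lborel. \<phi> (exp (- t)) * g t\<bar> \<le> 0 + e" by simp
    qed
    then show ?thesis by simp
  qed
  have trig: "(LINT t|lborel. exp (- t) * F (\<omega> * t) * g t) = 0"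
    if F: "continuous_on UNIV F" "\<And>x. \<bar>F x\<bar> \<le> 1" for F :: "real \<Rightarrow> real" and \<omega>
  proof -
    define \<phi> where "\<phi> = (\<lambda>x::real. x * F (- \<omega> * ln x))"
    have [measurable]: "F \<in> borel_measurable borel" by (rule borel_measurable_continuous_onI [OF F(1)])
    have "continuous (at x within {0..1}) \<phi>" if x: "x \<in> {0..1}" for x
    proof (cases "x = 0")
      case False
      then have "x \<in> {0<..}" using x by auto
      moreover have "continuous_on {0<..} \<phi>"
      proof -
        have "continuous_on {0<..} (\<lambda>x. F (- \<omega> * ln x))"
          by (rule continuous_on_compose2 [OF F(1)]) (auto intro!: continuous_intros)
        then show ?thesis unfolding \<phi>_def by (intro continuous_intros)
      qed
      ultimately have "continuous (at x) \<phi>"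
        by (simp add: continuous_on_eq_continuous_at)
      then show ?thesis by (rule continuous_at_imp_continuous_at_within)
    next
      case True
      have "(\<phi> \<longlongrightarrow> 0) (at 0 within {0..1})"
      proof (rule Lim_null_comparison)
        show "\<forall>\<^sub>F x in at 0 within {0..1}. norm (\<phi> x) \<le> \<bar>x\<bar>"
          using F(2) by (intro always_eventually) (auto simp: \<phi>_def abs_mult mult_left_le)
        show "((\<lambda>x. \<bar>x::real\<bar>) \<longlongrightarrow> 0) (at 0 within {0..1})"
          by (auto intro!: tendsto_eq_intros)
      qed
      then show ?thesis using True by (simp add: continuous_within \<phi>_def)
    qed
    then have "continuous_on {0..1} \<phi>" by (simp add: continuous_on_eq_continuous_within)
    moreover have "\<phi> \<in> borel_measurable borel" unfolding \<phi>_def by measurable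
    ultimately show ?thesis using cont [of \<phi>] by (simp add: \<phi>_def)
  qed
  define G where "G = (\<lambda>t. exp (- t) * g t)"
  have G: "integrable lborel G" using powi [of 1] by (simp add: G_def)
  have "AE t in lborel. G t = 0"
  proof (rule fourier_injective [OF G], rule AE_I2)
    fix \<omega> :: real
    have "cis (- (t \<bullet> \<omega>)) * complex_of_real (G t)
       = complex_of_real (exp (- t) * cos (\<omega> * t) * g t) - \<i> * complex_of_real (exp (- t) * sin (\<omega> * t) * g t)" for t
      by (simp add: complex_eq_iff G_def algebra_simps)
    moreover have "integrable lborel (\<lambda>t. exp (- t) * F (\<omega> * t) * g t)"
      if F: "continuous_on UNIV F" "\<And>x. \<bar>F x\<bar> \<le> 1" for F :: "real \<Rightarrow> real"
    proof -
      have [measurable]: "F \<in> borel_measurable borel" by (rule borel_measurable_continuous_onI [OF F(1)])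
      show ?thesis
        by (rule Bochner_Integration.integrable_bound [OF G])
           (use F(2) in \<open>auto simp: G_def abs_mult intro!: mult_left_le_one_le\<close>)
    qed
    ultimately show "(LINT t|lborel. cis (- (t \<bullet> \<omega>)) * complex_of_real (G t)) = 0"
      using trig [of cos \<omega>] trig [of sin \<omega>]
      by (simp add: continuous_on_cos continuous_on_sin continuous_on_id del: of_real_mult)
  qed
  then show ?thesis by eventually_elim (auto simp: G_def g_def)
qed

lemma has_bochner_integral_powr_exp:
  fixes b s :: real
  assumes b: "0 < b" and s: "0 < s"
  shows "has_bochner_integral lborel (\<lambda>t. indicator {0<..} t * (t powr (b - 1) * exp (- s * t))) (Gamma b / s powr b)"
proof -
  have "(\<integral>\<^sup>+t. ennreal (indicator {0<..} (t::real) * (t powr (b - 1) * exp (- 1 * t))) \<partial>lborel) = ennreal (Gamma b)"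
  proof -
    have "(\<integral>\<^sup>+(t::real). ennreal (indicator {0<..} t * (t powr (b - 1) * exp (- 1 * t))) \<partial>lborel)
       = (\<integral>\<^sup>+t. ennreal (indicator {0..} t * t powr (b - 1) / exp t) \<partial>lborel)"
      by (intro nn_integral_cong) (auto simp: indicator_def exp_minus field_simps)
    then show ?thesis using Gamma_conv_nn_integral_real [OF b] by simp
  qed
  then have "has_bochner_integral lborel (\<lambda>t. indicator {0<..} t * (t powr (b - 1) * exp (- 1 * t))) (Gamma b)"
    using Gamma_real_pos [OF b] by (intro has_bochner_integral_nn_integral) (auto simp: less_imp_le)
  then have "has_bochner_integral lborel (\<lambda>t. indicator {0<..} (0 + s * t) * ((0 + s * t) powr (b - 1) * exp (- 1 * (0 + s * t)))) (Gamma b /\<^sub>R \<bar>s\<bar>)"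
    using s by (subst (asm) lborel_has_bochner_integral_real_affine_iff [of s _ _ 0]) auto
  then have *: "has_bochner_integral lborel (\<lambda>t. inverse (s powr (b - 1)) * (indicator {0<..} (0 + s * t) * ((0 + s * t) powr (b - 1) * exp (- 1 * (0 + s * t)))))
     (inverse (s powr (b - 1)) * (Gamma b /\<^sub>R \<bar>s\<bar>))"
    by (rule has_bochner_integral_mult_right)
  have "inverse (s powr (b - 1)) * (indicator {0<..} (0 + s * t) * ((0 + s * t) powr (b - 1) * exp (- 1 * (0 + s * t))))
     = indicator {0<..} t * (t powr (b - 1) * exp (- s * t))" for t
    using s by (auto simp: indicator_def powr_mult zero_less_mult_iff)
  moreover have "inverse (s powr (b - 1)) * (Gamma b /\<^sub>R \<bar>s\<bar>) = Gamma b / s powr b"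
    using s by (simp add: powr_diff field_simps)
  ultimately show ?thesis using * by (simp only:)
qed

lemma has_bochner_integral_exp_complex:
  fixes a :: complex
  assumes a: "0 < Re a"
  shows "has_bochner_integral lborel (\<lambda>t. indicator {0<..} t *\<^sub>R exp (- a * of_real t)) (1 / a)"
proof -
  have n: "norm (exp (- a * of_real t)) = exp (- Re a * t)" for t by simp
  have i: "integrable lborel (\<lambda>t. indicator {0<..} t *\<^sub>R exp (- a * of_real t))"
  proof (rule Bochner_Integration.integrable_bound)
    show "integrable lborel (\<lambda>t. indicator {0<..} t * (t powr (1 - 1) * exp (- Re a * t)))"
      using has_bochner_integral_powr_exp [of 1 "Re a"] a by (auto simp: has_bochner_integral_iff)
  qed (auto simp: indicator_def)
  have "(LBINT t=0..\<infinity>. exp (- a * of_real t)) = 0 - (- 1 / a)"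
  proof (rule interval_integral_FTC_integrable)
    show "((\<lambda>t. - exp (- a * of_real t) / a) has_vector_derivative exp (- a * of_real t)) (at t)" for t
    proof -
      have "((\<lambda>z. - exp (- a * z) / a) has_field_derivative exp (- a * of_real t)) (at (of_real t))"
        using a by (auto intro!: derivative_eq_intros)
      from has_vector_derivative_real_field [OF this] show ?thesis .
    qed
    show "set_integrable lborel (einterval 0 \<infinity>) (\<lambda>t. exp (- a * of_real t))"
      using i by (simp add: set_integrable_def zero_ereal_def)
    show "(((\<lambda>t. - exp (- a * of_real t) / a) \<circ> real_of_ereal) \<longlongrightarrow> - 1 / a) (at_right 0)"
    proof -
      have "((\<lambda>t. - exp (- a * of_real t) / a) \<longlongrightarrow> - exp (- a * of_real 0) / a) (at_right 0)"
        using a by (intro tendsto_intros) auto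
      then show ?thesis unfolding zero_ereal_def ereal_tendsto_simps by simp
    qed
    show "(((\<lambda>t. - exp (- a * of_real t) / a) \<circ> real_of_ereal) \<longlongrightarrow> 0) (at_left \<infinity>)"
      unfolding ereal_tendsto_simps
    proof (rule tendsto_norm_zero_cancel)
      have "((\<lambda>t. exp (- r * t)) \<longlongrightarrow> 0) at_top" if "r > 0" for r :: real
        using that by real_asymp
      from tendsto_divide_zero [OF this [OF a], of "norm a"]
      have "((\<lambda>t. exp (- Re a * t) / norm a) \<longlongrightarrow> 0) at_top" .
      then show "((\<lambda>t. norm (- exp (- a * of_real t) / a)) \<longlongrightarrow> 0) at_top" by (simp add: norm_divide)
    qed
  qed (auto intro!: continuous_intros)
  then show ?thesis
    using i by (simp add: has_bochner_integral_iff interval_lebesgue_integral_def set_lebesgue_integral_def zero_ereal_def)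
qed

lemma integrable_exp_exp:
  assumes b: "0 < b"
  shows "integrable lborel (\<lambda>u::real. exp (- exp u) * exp (b * u))"
proof -
  have "\<exists>K. \<forall>u\<ge>0. exp (- exp u) * exp (b * u) \<le> K * exp (- u)"
  proof -
    have "((\<lambda>u. exp (- exp u) * exp (b * u) * exp u) \<longlongrightarrow> 0) at_top"
      using b by real_asymp
    then have "\<forall>\<^sub>F u in at_top. exp (- exp u) * exp (b * u) * exp u < 1"
      by (rule order_tendstoD) simp
    then obtain U where U: "\<And>u. u \<ge> U \<Longrightarrow> exp (- exp u) * exp (b * u) * exp u < 1"
      by (auto simp: eventually_at_top_linorder)
    have "exp (- exp u) * exp (b * u) \<le> max 1 (exp (b * U + U)) * exp (- u)" if "u \<ge> 0" for u
    proof (cases "u \<ge> U")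
      case True
      have "exp (- exp u) * exp (b * u) = exp (- exp u) * exp (b * u) * exp u * exp (- u)"
        by (simp add: exp_minus)
      also have "\<dots> \<le> 1 * exp (- u)" using U [OF True] by (intro mult_right_mono) auto
      finally show ?thesis by (rule order_trans) (intro mult_right_mono, auto)
    next
      case False
      have "exp (- exp u) * exp (b * u) \<le> 1 * exp (b * u)" by (intro mult_right_mono) auto
      also have "\<dots> = exp (b * u + u) * exp (- u)" by (simp add: exp_add [symmetric])
      also have "\<dots> \<le> max 1 (exp (b * U + U)) * exp (- u)"
      proof (rule mult_right_mono)
        have "b * u + u \<le> b * U + U" using False b by (intro add_mono mult_left_mono) auto
        then show "exp (b * u + u) \<le> max 1 (exp (b * U + U))" by (simp add: le_max_iff_disj)
      qed simp
      finally show ?thesis .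
    qed
    then show ?thesis by blast
  qed
  then obtain K where K: "\<And>u. u \<ge> 0 \<Longrightarrow> exp (- exp u) * exp (b * u) \<le> K * exp (- u)" by blast
  show ?thesis
  proof (rule Bochner_Integration.integrable_bound)
    show "integrable lborel (\<lambda>u::real. K * exp (- 1 * \<bar>u\<bar>) + exp (- b * \<bar>u\<bar>))"
      using integrable_exp_neg_abs [of 1] integrable_exp_neg_abs [OF b] by auto
    have K0: "K \<ge> 0"
    proof -
      have "0 \<le> exp (- exp 0) * exp (b * 0)" by simp
      also have "\<dots> \<le> K * exp (- 0)" by (rule K) simp
      finally show ?thesis by simp
    qed
    show "AE u in lborel. norm (exp (- exp u) * exp (b * u)) \<le> norm (K * exp (- 1 * \<bar>u\<bar>) + exp (- b * \<bar>u\<bar>))"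
    proof (rule AE_I2)
      fix u :: real
      have "exp (- exp u) * exp (b * u) \<le> K * exp (- 1 * \<bar>u\<bar>) + exp (- b * \<bar>u\<bar>)"
      proof (cases "u \<ge> 0")
        case True
        then show ?thesis using K [of u] by (simp add: add_increasing2)
      next
        case False
        then have "exp (- exp u) * exp (b * u) \<le> 1 * exp (- b * \<bar>u\<bar>)"
          by (intro mult_mono) auto
        then show ?thesis using K0 by (simp add: add_increasing)
      qed
      then show "norm (exp (- exp u) * exp (b * u)) \<le> norm (K * exp (- 1 * \<bar>u\<bar>) + exp (- b * \<bar>u\<bar>))"
        using K0 by simp
    qed
  qed auto
qed

text \<open>
  The value is \<open>\<Gamma>(b)\<close>, by the substitution \<open>r = e\<^sup>u\<close>.
\<close>
definition exp_exp_moment :: "real \<Rightarrow> real" where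
  "exp_exp_moment b = (LINT (u::real)|lborel. exp (- exp u) * exp (b * u))"

lemma has_bochner_integral_exp_exp:
  assumes b: "0 < b" and A: "0 < A"
  shows "has_bochner_integral lborel (\<lambda>x::real. exp (- A * exp x) * exp (b * x)) (exp_exp_moment b * A powr (- b))"
proof -
  have "has_bochner_integral lborel (\<lambda>u::real. exp (- exp u) * exp (b * u)) (exp_exp_moment b)"
    using integrable_exp_exp [OF b] by (simp add: has_bochner_integral_iff exp_exp_moment_def)
  then have "has_bochner_integral lborel (\<lambda>u::real. exp (- exp (ln A + 1 * u)) * exp (b * (ln A + 1 * u))) (exp_exp_moment b /\<^sub>R \<bar>1\<bar>)"
    by (subst (asm) lborel_has_bochner_integral_real_affine_iff [of 1 _ _ "ln A"]) auto
  then have *: "has_bochner_integral lborel (\<lambda>u::real. A powr (- b) * (exp (- exp (ln A + 1 * u)) * exp (b * (ln A + 1 * u)))) (A powr (- b) * (exp_exp_moment b /\<^sub>R \<bar>1\<bar>))"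
    by (rule has_bochner_integral_mult_right)
  have "A powr (- b) * (exp (- exp (ln A + 1 * u)) * exp (b * (ln A + 1 * u))) = exp (- A * exp u) * exp (b * u)" for u
    using A by (simp add: exp_add powr_def distrib_left exp_minus field_simps)
  then show ?thesis using * by (simp add: mult.commute)
qed

lemma exp_exp_moment_nonneg: "exp_exp_moment b \<ge> 0"
  unfolding exp_exp_moment_def by (intro Bochner_Integration.integral_nonneg) auto

lemma lborel_prod_mult:
  fixes f :: "'a::euclidean_space \<Rightarrow> 'c::{real_normed_field,banach,second_countable_topology}"
    and g :: "'b::euclidean_space \<Rightarrow> 'c"
  assumes f: "integrable lborel f" and g: "integrable lborel g"
  shows "has_bochner_integral lborel (\<lambda>p. f (fst p) * g (snd p)) (integral\<^sup>L lborel f * integral\<^sup>L lborel g)"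
proof -
  have [measurable]: "f \<in> borel_measurable borel" "g \<in> borel_measurable borel" using f g by auto
  have i: "integrable (lborel \<Otimes>\<^sub>M lborel) (\<lambda>p. f (fst p) * g (snd p))"
  proof (rule lborel_pair.Fubini_integrable)
    show "integrable lborel (\<lambda>x. LINT y|lborel. norm (f (fst (x, y)) * g (snd (x, y))))"
      using f by (auto simp: norm_mult)
  qed (use g in auto)
  have "(LINT p|(lborel \<Otimes>\<^sub>M lborel). f (fst p) * g (snd p)) = (LINT x|lborel. LINT y|lborel. f x * g y)"
    using lborel_pair.integral_fst' [OF i] by simp
  also have "\<dots> = integral\<^sup>L lborel f * integral\<^sup>L lborel g" by simp
  finally show ?thesis using i by (simp add: has_bochner_integral_iff lborel_prod)
qed

lemma Complex_measurable [measurable (raw)]: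
  assumes [measurable]: "f \<in> borel_measurable M" "g \<in> borel_measurable M"
  shows "(\<lambda>x. Complex (f x) (g x)) \<in> borel_measurable M"
  unfolding Complex_eq by measurable

section \<open>The inverse Laplace transform of the symbol\<close>

text \<open>
  The rays \<open>arg z = \<plusminus>\<theta>\<close> lie in the left half-plane, which makes \<open>e\<^sup>t\<^sup>z\<close> decay along them, while
  \<open>(\<alpha> + \<beta>) \<theta> < \<pi>\<close> prevents \<open>z\<^sup>\<alpha>\<close> and \<open>-\<nu>\<^sup>\<beta>\<close> from having the same argument for \<open>z\<close> and \<open>\<nu>\<close> in the
  sector.
\<close>
locale subdiffusion_kernel =
  fixes \<alpha> \<beta> \<theta> :: real
  assumes \<alpha>: "0 < \<alpha>" "\<alpha> < 1" and \<beta>: "0 < \<beta>" "\<beta> \<le> 1"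
    and \<theta>: "pi / 2 < \<theta>" "\<theta> < pi" "(\<alpha> + \<beta>) * \<theta> < pi"
begin

text \<open>
  On the contour \<open>|e\<^sup>t\<^sup>z| = exp (- decay t |z|)\<close>.
\<close>
definition decay where "decay = - cos \<theta>"

lemma decay_pos: "0 < decay"
proof -
  have "cos \<theta> < cos (pi / 2)" using \<theta> by (intro cos_monotone_0_pi) auto
  then show ?thesis by (simp add: decay_def)
qed

text \<open>
  The cosine of the largest angle that \<open>z\<^sup>\<alpha>\<close> and \<open>\<nu>\<^sup>\<beta>\<close> can make with their bisector for \<open>z\<close> and \<open>\<nu>\<close> in
  the sector.
\<close>
definition aperture where "aperture = cos ((\<alpha> + \<beta>) * \<theta> / 2)"

lemma \<theta>_pos: "0 < \<theta>" using \<theta> pi_gt_zero by linarith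

lemma aperture_pos: "0 < aperture"
proof -
  have "0 < (\<alpha> + \<beta>) * \<theta>" using \<alpha> \<beta> \<theta>_pos by (intro mult_pos_pos) auto
  then show ?thesis unfolding aperture_def using \<theta> pi_gt_zero by (intro cos_gt_zero_pi) linarith+
qed

text \<open>
  The integrand of \<open>strip_integral\<close> as one function on the real line, which lets Fubini's theorem act
  on both rays at once.
\<close>
definition jump :: "(complex \<Rightarrow> complex) \<Rightarrow> real \<Rightarrow> complex" where
  "jump f x = (f (Complex x \<theta>) - f (Complex x (- \<theta>))) / (2 * of_real pi * \<i>)"

lemma strip_integral_jump: "strip_integral \<theta> f = (LINT x|lborel. jump f x)"
  by (simp add: strip_integral_def jump_def)

lemma norm_jump_le:
  assumes "\<And>y. \<bar>y\<bar> = \<theta> \<Longrightarrow> norm (f (Complex x y)) \<le> B"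
  shows "norm (jump f x) \<le> B"
proof -
  have "norm (jump f x) \<le> (norm (f (Complex x \<theta>)) + norm (f (Complex x (- \<theta>)))) / (2 * pi)"
    unfolding jump_def norm_divide by (simp add: norm_mult norm_triangle_ineq4 divide_right_mono)
  also have "\<dots> \<le> (B + B) / (2 * pi)"
    using \<theta>_pos by (intro divide_right_mono add_mono assms) auto
  also have "\<dots> = B / pi" by simp
  also have "\<dots> \<le> B"
  proof -
    have "0 \<le> norm (f (Complex x \<theta>))" by simp
    also have "\<dots> \<le> B" using \<theta>_pos by (intro assms) auto
    finally have "B * 1 \<le> B * pi" using pi_ge_two by (intro mult_left_mono) auto
    then show ?thesis by (simp add: field_simps)
  qed
  finally show ?thesis .
qed

lemma jump_mult_left: "jump (\<lambda>w. a * f w) x = a * jump f x"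
  by (simp add: jump_def algebra_simps)

lemma has_bochner_integral_jump:
  assumes "\<And>y. \<bar>y\<bar> = \<theta> \<Longrightarrow> has_bochner_integral M (\<lambda>p. f p (Complex x y)) (symbol_kernel (Complex x y))"
  shows "has_bochner_integral M (\<lambda>p. jump (f p) x) (jump symbol_kernel x)"
  unfolding jump_def using \<theta>_pos
  by (intro has_bochner_integral_divide_zero has_bochner_integral_diff assms) auto

lemma jump_measurable [measurable (raw)]:
  assumes "(\<lambda>z. f z (Complex (inv_laplace z) \<theta>)) \<in> borel_measurable M" "(\<lambda>z. f z (Complex (inv_laplace z) (- \<theta>))) \<in> borel_measurable M"
  shows "(\<lambda>z. jump (f z) (inv_laplace z)) \<in> borel_measurable M"
  unfolding jump_def using assms by measurable

lemma denominator_nonzero: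
  assumes "\<bar>\<alpha> * Im w - \<beta> * Im v\<bar> < pi"
  shows "exp (of_real \<alpha> * w) + exp (of_real \<beta> * v) \<noteq> 0"
proof -
  have "0 < cos ((\<alpha> * Im w - \<beta> * Im v) / 2)" using assms by (intro cos_gt_zero_pi) (auto simp: abs_less_iff)
  then have "0 < cos ((\<alpha> * Im w - \<beta> * Im v) / 2) * (exp (\<alpha> * Re w) + exp (\<beta> * Re v))"
    by (intro mult_pos_pos add_pos_pos) auto
  also have "\<dots> \<le> norm (of_real (exp (\<alpha> * Re w)) * cis (\<alpha> * Im w) + of_real (exp (\<beta> * Re v)) * cis (\<beta> * Im v))"
    by (rule norm_add_polar_ge) auto
  also have "\<dots> = norm (exp (of_real \<alpha> * w) + exp (of_real \<beta> * v))"
    by (simp add: exp_eq_polar)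
  finally show ?thesis by auto
qed

lemma abs_argument_difference_le:
  assumes "\<bar>Im w\<bar> \<le> a" "\<bar>Im v\<bar> \<le> b"
  shows "\<bar>\<alpha> * Im w - \<beta> * Im v\<bar> \<le> \<alpha> * a + \<beta> * b"
proof -
  have "\<bar>\<alpha> * Im w - \<beta> * Im v\<bar> \<le> \<alpha> * \<bar>Im w\<bar> + \<beta> * \<bar>Im v\<bar>"
    using abs_triangle_ineq4 [of "\<alpha> * Im w" "\<beta> * Im v"] \<alpha> \<beta> by (simp add: abs_mult)
  also have "\<dots> \<le> \<alpha> * a + \<beta> * b"
    using assms \<alpha> \<beta> by (intro add_mono mult_left_mono) auto
  finally show ?thesis .
qed

lemma denominator_ge:
  assumes "\<bar>Im w\<bar> \<le> \<theta>" "\<bar>Im v\<bar> \<le> \<theta>"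
  shows "aperture * (exp (\<alpha> * Re w) + exp (\<beta> * Re v)) \<le> norm (exp (of_real \<alpha> * w) + exp (of_real \<beta> * v))"
proof -
  have le: "\<bar>(\<alpha> * Im w - \<beta> * Im v) / 2\<bar> \<le> (\<alpha> + \<beta>) * \<theta> / 2"
    using abs_argument_difference_le [OF assms] by (simp add: algebra_simps)
  have "aperture \<le> cos \<bar>(\<alpha> * Im w - \<beta> * Im v) / 2\<bar>"
    unfolding aperture_def using le \<theta> pi_gt_zero by (intro cos_monotone_0_pi_le) linarith+
  then have "aperture \<le> cos ((\<alpha> * Im w - \<beta> * Im v) / 2)" by (simp only: cos_abs_real)
  then have "aperture * (exp (\<alpha> * Re w) + exp (\<beta> * Re v))
     \<le> cos ((\<alpha> * Im w - \<beta> * Im v) / 2) * (exp (\<alpha> * Re w) + exp (\<beta> * Re v))"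
    by (intro mult_right_mono) (auto intro: add_nonneg_nonneg)
  also have "\<dots> \<le> norm (of_real (exp (\<alpha> * Re w)) * cis (\<alpha> * Im w) + of_real (exp (\<beta> * Re v)) * cis (\<beta> * Im v))"
    by (rule norm_add_polar_ge) auto
  also have "\<dots> = norm (exp (of_real \<alpha> * w) + exp (of_real \<beta> * v))"
    by (simp add: exp_eq_polar)
  finally show ?thesis .
qed

lemma exp_interpolate_le:
  fixes a b \<kappa> :: real
  assumes "0 \<le> \<kappa>" "\<kappa> \<le> 1"
  shows "exp (a * (1 - \<kappa>) + b * \<kappa>) \<le> exp a + exp b"
proof (cases "a \<le> b")
  case True
  then have "a * (1 - \<kappa>) \<le> b * (1 - \<kappa>)" using assms by (intro mult_right_mono) auto
  then have "a * (1 - \<kappa>) + b * \<kappa> \<le> b" by (simp add: algebra_simps)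
  then have "exp (a * (1 - \<kappa>) + b * \<kappa>) \<le> exp b" by simp
  then show ?thesis by (simp add: add_increasing)
next
  case False
  then have "b * \<kappa> \<le> a * \<kappa>" using assms by (intro mult_right_mono) auto
  then have "a * (1 - \<kappa>) + b * \<kappa> \<le> a" by (simp add: algebra_simps)
  then have "exp (a * (1 - \<kappa>) + b * \<kappa>) \<le> exp a" by simp
  then show ?thesis by (simp add: add_increasing2)
qed

text \<open>
  The parameter \<open>\<kappa>\<close> distributes the decay of \<open>1 / (z\<^sup>\<alpha> + \<nu>\<^sup>\<beta>)\<close> between the two variables; every later
  bound is obtained by a choice of \<open>\<kappa>\<close>.
\<close>
lemma norm_inverse_denominator_le:
  assumes "\<bar>Im w\<bar> \<le> \<theta>" "\<bar>Im v\<bar> \<le> \<theta>" "0 \<le> \<kappa>" "\<kappa> \<le> 1"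
  shows "norm (1 / (exp (of_real \<alpha> * w) + exp (of_real \<beta> * v))) \<le> exp (- (\<alpha> * Re w) * (1 - \<kappa>) - \<beta> * Re v * \<kappa>) / aperture"
proof -
  have "aperture * exp (\<alpha> * Re w * (1 - \<kappa>) + \<beta> * Re v * \<kappa>) \<le> norm (exp (of_real \<alpha> * w) + exp (of_real \<beta> * v))"
    using denominator_ge [OF assms(1,2)] aperture_pos exp_interpolate_le [OF assms(3,4), of "\<alpha> * Re w" "\<beta> * Re v"]
    by (meson dual_order.trans less_imp_le mult_left_mono)
  then have "1 / norm (exp (of_real \<alpha> * w) + exp (of_real \<beta> * v)) \<le> 1 / (aperture * exp (\<alpha> * Re w * (1 - \<kappa>) + \<beta> * Re v * \<kappa>))"
  proof (intro divide_left_mono mult_pos_pos)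
    have "0 < aperture * (exp (\<alpha> * Re w) + exp (\<beta> * Re v))"
      using aperture_pos by (intro mult_pos_pos add_pos_pos) auto
    then show "0 < norm (exp (of_real \<alpha> * w) + exp (of_real \<beta> * v))"
      using denominator_ge [OF assms(1,2)] by linarith
  qed (use aperture_pos in auto)
  also have "\<dots> = exp (- (\<alpha> * Re w) * (1 - \<kappa>) - \<beta> * Re v * \<kappa>) / aperture"
    by (simp add: exp_diff exp_minus exp_add field_simps)
  finally show ?thesis by (simp add: norm_divide)
qed

text \<open>
  The factor \<open>e\<^sup>t\<^sup>z dz\<close> of an inverse Laplace transform in the coordinate \<open>z = e\<^sup>w\<close>.
\<close>
definition laplace_factor :: "real \<Rightarrow> complex \<Rightarrow> complex" where
  "laplace_factor t w = exp (of_real t * exp w) * exp w"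

lemma laplace_factor_measurable [measurable (raw)]:
  assumes [measurable]: "f \<in> borel_measurable M" "inv_laplace \<in> borel_measurable M"
  shows "(\<lambda>x. laplace_factor (f x) (inv_laplace x)) \<in> borel_measurable M"
  unfolding laplace_factor_def by measurable

lemma norm_laplace_factor: "\<bar>y\<bar> = \<theta> \<Longrightarrow> norm (laplace_factor t (Complex x y)) = exp (- (decay * t) * exp x) * exp x"
proof -
  assume "\<bar>y\<bar> = \<theta>"
  then have "cos y = - decay" by (metis decay_def cos_abs_real minus_minus)
  then show ?thesis by (simp add: laplace_factor_def norm_mult exp_Complex)
qed

definition symbol_kernel :: "real \<Rightarrow> real \<Rightarrow> complex \<Rightarrow> complex \<Rightarrow> complex" where
  "symbol_kernel t \<tau> w v = laplace_factor t w * laplace_factor \<tau> v / (exp (of_real \<alpha> * w) + exp (of_real \<beta> * v))"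

text \<open>
  Here \<open>1 / (z\<^sup>\<alpha> + \<nu>\<^sup>\<beta>)\<close> is replaced by its value \<open>1 / z\<^sup>\<alpha>\<close> at \<open>\<nu> = 0\<close>.  The difference gains a factor
  \<open>\<nu>\<^sup>\<beta> / z\<^sup>\<alpha>\<close>, which is what decay for large \<open>\<tau>\<close> needs.
\<close>
definition leading_kernel :: "real \<Rightarrow> real \<Rightarrow> complex \<Rightarrow> complex \<Rightarrow> complex" where
  "leading_kernel t \<tau> w v = laplace_factor t w / exp (of_real \<alpha> * w) * laplace_factor \<tau> v"

definition contour_kernel where "contour_kernel t \<tau> x y = jump (\<lambda>w. jump (\<lambda>v. symbol_kernel t \<tau> w v) y) x"

definition leading_contour_kernel where "leading_contour_kernel t \<tau> x y = jump (\<lambda>w. jump (\<lambda>v. leading_kernel t \<tau> w v) y) x"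

text \<open>
  For \<open>\<kappa> \<ge> 0\<close> this dominates the kernel itself, for \<open>\<kappa> \<le> 0\<close> the kernel minus its leading part, so
  that both regimes share one formula.
\<close>
definition majorant where "majorant \<kappa> t \<tau> x y = (exp (- (decay * t) * exp x) * exp ((1 - \<alpha> * (1 - \<kappa>)) * x)) *
  (exp (- (decay * \<tau>) * exp y) * exp ((1 - \<beta> * \<kappa>) * y)) / aperture"

lemma norm_symbol_kernel_le:
  assumes "\<bar>y1\<bar> = \<theta>" "\<bar>y2\<bar> = \<theta>" "0 \<le> \<kappa>" "\<kappa> \<le> 1"
  shows "norm (symbol_kernel t \<tau> (Complex x y1) (Complex y y2)) \<le> majorant \<kappa> t \<tau> x y"
proof -
  have "norm (symbol_kernel t \<tau> (Complex x y1) (Complex y y2))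
     = norm (laplace_factor t (Complex x y1)) * norm (laplace_factor \<tau> (Complex y y2)) * norm (1 / (exp (of_real \<alpha> * Complex x y1) + exp (of_real \<beta> * Complex y y2)))"
    by (simp add: symbol_kernel_def norm_mult norm_divide)
  also have "\<dots> \<le> norm (laplace_factor t (Complex x y1)) * norm (laplace_factor \<tau> (Complex y y2)) * (exp (- (\<alpha> * x) * (1 - \<kappa>) - \<beta> * y * \<kappa>) / aperture)"
    using norm_inverse_denominator_le [of "Complex x y1" "Complex y y2" \<kappa>] assms by (intro mult_left_mono) auto
  also have "\<dots> = majorant \<kappa> t \<tau> x y"
  proof -
    have "exp x * exp y * exp (- (\<alpha> * x) * (1 - \<kappa>) - \<beta> * y * \<kappa>) = exp ((1 - \<alpha> * (1 - \<kappa>)) * x) * exp ((1 - \<beta> * \<kappa>) * y)"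
      by (simp only: mult_exp_exp, rule arg_cong [where f = exp]) (simp add: algebra_simps)
    then show ?thesis
      unfolding norm_laplace_factor [OF assms(1)] norm_laplace_factor [OF assms(2)] majorant_def by (simp add: mult_ac)
  qed
  finally show ?thesis .
qed

lemma norm_symbol_kernel_diff_le:
  assumes "\<bar>y1\<bar> = \<theta>" "\<bar>y2\<bar> = \<theta>" "-1 \<le> \<kappa>" "\<kappa> \<le> 0"
  shows "norm (symbol_kernel t \<tau> (Complex x y1) (Complex y y2) - leading_kernel t \<tau> (Complex x y1) (Complex y y2)) \<le> majorant \<kappa> t \<tau> x y"
proof -
  let ?w = "Complex x y1" and ?v = "Complex y y2"
  let ?D = "exp (of_real \<alpha> * ?w) + exp (of_real \<beta> * ?v)"
  have "\<bar>\<alpha> * Im ?w - \<beta> * Im ?v\<bar> \<le> \<alpha> * \<theta> + \<beta> * \<theta>"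
    using assms by (intro abs_argument_difference_le) auto
  then have D: "?D \<noteq> 0" using \<theta>(3) by (intro denominator_nonzero) (simp add: algebra_simps)
  have "symbol_kernel t \<tau> ?w ?v - leading_kernel t \<tau> ?w ?v = - (laplace_factor t ?w * laplace_factor \<tau> ?v * exp (of_real \<beta> * ?v) / exp (of_real \<alpha> * ?w) * (1 / ?D))"
    using D by (simp add: symbol_kernel_def leading_kernel_def field_simps)
  then have "norm (symbol_kernel t \<tau> ?w ?v - leading_kernel t \<tau> ?w ?v)
      = norm (laplace_factor t ?w) * norm (laplace_factor \<tau> ?v) * exp (\<beta> * y) / exp (\<alpha> * x) * norm (1 / ?D)"
    by (simp add: norm_mult norm_divide)
  also have "\<dots> \<le> norm (laplace_factor t ?w) * norm (laplace_factor \<tau> ?v) * exp (\<beta> * y) / exp (\<alpha> * x) * (exp (- (\<alpha> * x) * (1 - (\<kappa> + 1)) - \<beta> * y * (\<kappa> + 1)) / aperture)"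
    using norm_inverse_denominator_le [of ?w ?v "\<kappa> + 1"] assms by (intro mult_left_mono) auto
  also have "\<dots> = majorant \<kappa> t \<tau> x y"
  proof -
    have "exp x * exp y * exp (\<beta> * y) * exp (- (\<alpha> * x)) * exp (- (\<alpha> * x) * (1 - (\<kappa> + 1)) - \<beta> * y * (\<kappa> + 1))
        = exp ((1 - \<alpha> * (1 - \<kappa>)) * x) * exp ((1 - \<beta> * \<kappa>) * y)"
      by (simp only: mult_exp_exp, rule arg_cong [where f = exp]) (simp add: algebra_simps)
    then show ?thesis
      unfolding norm_laplace_factor [OF assms(1)] norm_laplace_factor [OF assms(2)] majorant_def by (simp add: divide_inverse exp_minus mult_ac)
  qed
  finally show ?thesis .
qed

lemma norm_contour_kernel_le: "0 \<le> \<kappa> \<Longrightarrow> \<kappa> \<le> 1 \<Longrightarrow> norm (contour_kernel t \<tau> x y) \<le> majorant \<kappa> t \<tau> x y"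
  unfolding contour_kernel_def by (intro norm_jump_le norm_symbol_kernel_le)

lemma norm_contour_kernel_diff_le:
  assumes "-1 \<le> \<kappa>" "\<kappa> \<le> 0"
  shows "norm (contour_kernel t \<tau> x y - leading_contour_kernel t \<tau> x y) \<le> majorant \<kappa> t \<tau> x y"
proof -
  have "contour_kernel t \<tau> x y - leading_contour_kernel t \<tau> x y = jump (\<lambda>w. jump (\<lambda>v. symbol_kernel t \<tau> w v - leading_kernel t \<tau> w v) y) x"
    by (simp add: contour_kernel_def leading_contour_kernel_def jump_def diff_divide_distrib)
  then show ?thesis using assms by (simp add: norm_jump_le norm_symbol_kernel_diff_le)
qed

lemma contour_kernel_measurable [measurable (raw)]:
  assumes [measurable]: "f1 \<in> borel_measurable M" "f2 \<in> borel_measurable M" "f3 \<in> borel_measurable M" "f4 \<in> borel_measurable M"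
  shows "(\<lambda>z. contour_kernel (f1 z) (f2 z) (f3 z) (f4 z)) \<in> borel_measurable M"
  unfolding contour_kernel_def symbol_kernel_def jump_def by measurable

definition majorant_const where "majorant_const \<kappa> = exp_exp_moment (1 - \<alpha> * (1 - \<kappa>)) * exp_exp_moment (1 - \<beta> * \<kappa>) * decay powr (\<alpha> * (1 - \<kappa>) - 1) * decay powr (\<beta> * \<kappa> - 1) / aperture"

lemma majorant_const_nonneg: "0 \<le> majorant_const \<kappa>"
  using aperture_pos exp_exp_moment_nonneg by (simp add: majorant_const_def)

lemma majorant_integral:
  assumes "0 < t" "0 < \<tau>" "\<alpha> * (1 - \<kappa>) < 1" "\<kappa> < 1"
  shows "has_bochner_integral lborel (\<lambda>p. majorant \<kappa> t \<tau> (fst p) (snd p))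
    (majorant_const \<kappa> * t powr (\<alpha> * (1 - \<kappa>) - 1) * \<tau> powr (\<beta> * \<kappa> - 1))"
proof -
  have bk: "\<beta> * \<kappa> < 1"
  proof (cases "\<kappa> \<le> 0")
    case True
    then show ?thesis using \<beta> by (simp add: mult_le_0_iff order_le_less_trans [of _ 0])
  next
    case False
    then have "\<beta> * \<kappa> \<le> 1 * \<kappa>" using \<beta> by (intro mult_right_mono) auto
    then show ?thesis using assms by simp
  qed
  have 1: "has_bochner_integral lborel (\<lambda>x::real. exp (- (decay * t) * exp x) * exp ((1 - \<alpha> * (1 - \<kappa>)) * x)) (exp_exp_moment (1 - \<alpha> * (1 - \<kappa>)) * (decay * t) powr - (1 - \<alpha> * (1 - \<kappa>)))"
    using assms decay_pos by (intro has_bochner_integral_exp_exp) auto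
  have 2: "has_bochner_integral lborel (\<lambda>x::real. exp (- (decay * \<tau>) * exp x) * exp ((1 - \<beta> * \<kappa>) * x)) (exp_exp_moment (1 - \<beta> * \<kappa>) * (decay * \<tau>) powr - (1 - \<beta> * \<kappa>))"
    using assms decay_pos bk by (intro has_bochner_integral_exp_exp) auto
  have "has_bochner_integral lborel (\<lambda>p. majorant \<kappa> t \<tau> (fst p) (snd p))
    (exp_exp_moment (1 - \<alpha> * (1 - \<kappa>)) * (decay * t) powr - (1 - \<alpha> * (1 - \<kappa>)) * (exp_exp_moment (1 - \<beta> * \<kappa>) * (decay * \<tau>) powr - (1 - \<beta> * \<kappa>)) / aperture)"
    unfolding majorant_def using 1 2 lborel_prod_mult [OF integrable.intros [OF 1] integrable.intros [OF 2]]
    by (intro has_bochner_integral_divide_zero) (simp add: has_bochner_integral_iff)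
  then show ?thesis
    using assms decay_pos by (simp add: majorant_const_def powr_mult algebra_simps)
qed

end

lemma fst_borel_measurable [measurable (raw)]:
  fixes f :: "'a \<Rightarrow> 'b::second_countable_topology \<times> 'c::second_countable_topology"
  shows "f \<in> borel_measurable M \<Longrightarrow> (\<lambda>z. fst (f z)) \<in> borel_measurable M"
  by (rule borel_measurable_continuous_on [of fst]) (auto intro!: continuous_intros)

lemma snd_borel_measurable [measurable (raw)]:
  fixes f :: "'a \<Rightarrow> 'b::second_countable_topology \<times> 'c::second_countable_topology"
  shows "f \<in> borel_measurable M \<Longrightarrow> (\<lambda>z. snd (f z)) \<in> borel_measurable M"
  by (rule borel_measurable_continuous_on [of snd]) (auto intro!: continuous_intros)

context subdiffusion_kernel
begin

text \<open>
  The inverse Laplace transform \<open>m(t,\<tau>)\<close> of \<open>1 / (z\<^sup>\<alpha> + \<nu>\<^sup>\<beta>)\<close> with respect to both variables.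
\<close>
definition subordinator :: "real \<Rightarrow> real \<Rightarrow> complex" where
  "subordinator t \<tau> = (LINT p|lborel. contour_kernel t \<tau> (fst p) (snd p))"

lemma subordinator_measurable [measurable (raw)]:
  assumes [measurable]: "f \<in> borel_measurable M" "inv_laplace \<in> borel_measurable M"
  shows "(\<lambda>z. subordinator (f z) (inv_laplace z)) \<in> borel_measurable M"
  unfolding subordinator_def by measurable

lemma contour_kernel_integrable:
  assumes "0 < t" "0 < \<tau>"
  shows "integrable lborel (\<lambda>p. contour_kernel t \<tau> (fst p) (snd p))"
proof (rule Bochner_Integration.integrable_bound)
  show "integrable lborel (\<lambda>p. majorant 0 t \<tau> (fst p) (snd p))"
    using majorant_integral [OF assms, of 0] \<alpha> by (auto simp: has_bochner_integral_iff)
  show "AE p in lborel. norm (contour_kernel t \<tau> (fst p) (snd p)) \<le> norm (majorant 0 t \<tau> (fst p) (snd p))"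
    using norm_contour_kernel_le [of 0] by (intro AE_I2) (metis abs_ge_self order_trans real_norm_def zero_less_one less_imp_le order_refl)
qed measurable

lemma laplace_factor_line_integrable:
  assumes "0 < \<tau>" "\<bar>y\<bar> = \<theta>"
  shows "integrable lborel (\<lambda>x. laplace_factor \<tau> (Complex x y))"
proof (rule Bochner_Integration.integrable_bound)
  show "integrable lborel (\<lambda>x. exp (- (decay * \<tau>) * exp x) * exp (1 * x))"
    using has_bochner_integral_exp_exp [of 1 "decay * \<tau>"] assms decay_pos by (auto simp: has_bochner_integral_iff)
qed (use assms in \<open>auto simp: norm_laplace_factor\<close>)

text \<open>
  An antiderivative is \<open>exp (\<tau> e\<^sup>w) / \<tau>\<close>, with limits \<open>1/\<tau>\<close> and \<open>0\<close>.  The value is the same on both rays,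
  and therefore the leading part integrates to \<open>0\<close>.
\<close>
lemma laplace_factor_line_integral:
  assumes "0 < \<tau>" "\<bar>y\<bar> = \<theta>"
  shows "(LINT x|lborel. laplace_factor \<tau> (Complex x y)) = - 1 / \<tau>"
proof -
  have "(LBINT x=-\<infinity>..\<infinity>. laplace_factor \<tau> (Complex x y)) = 0 - 1 / of_real \<tau>"
  proof (rule interval_integral_FTC_integrable)
    fix x :: real
    have "((\<lambda>z. exp (of_real \<tau> * exp (z + \<i> * of_real y)) / of_real \<tau>) has_field_derivative laplace_factor \<tau> (Complex x y)) (at (of_real x))"
      using assms by (auto intro!: derivative_eq_intros simp: laplace_factor_def Complex_eq)
    from has_vector_derivative_real_field [OF this]
    show "((\<lambda>x. exp (of_real \<tau> * exp (Complex x y)) / of_real \<tau>) has_vector_derivative laplace_factor \<tau> (Complex x y)) (at x)"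
      by (simp add: Complex_eq)
    show "isCont (\<lambda>x. laplace_factor \<tau> (Complex x y)) x"
      unfolding laplace_factor_def Complex_eq by (intro continuous_intros)
  next
    show "set_integrable lborel (einterval (-\<infinity>) \<infinity>) (\<lambda>x. laplace_factor \<tau> (Complex x y))"
      using laplace_factor_line_integrable [OF assms] by (simp add: set_integrable_def)
    show "(((\<lambda>x. exp (of_real \<tau> * exp (Complex x y)) / of_real \<tau>) \<circ> real_of_ereal) \<longlongrightarrow> 1 / of_real \<tau>) (at_right (-\<infinity>))"
      unfolding ereal_tendsto_simps exp_Complex
    proof -
      have "((\<lambda>x::real. exp x) \<longlongrightarrow> 0) at_bot" by (rule exp_at_bot)
      then have "((\<lambda>x. complex_of_real (exp x)) \<longlongrightarrow> of_real 0) at_bot" by (rule tendsto_of_real)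
      note lim = this
      have "((\<lambda>x. exp (of_real \<tau> * (of_real (exp x) * cis y)) / of_real \<tau>) \<longlongrightarrow> exp (of_real \<tau> * (of_real 0 * cis y)) / of_real \<tau>) at_bot"
        using assms by (intro tendsto_divide tendsto_exp tendsto_mult tendsto_const lim) auto
      then show "((\<lambda>x. exp (of_real \<tau> * (of_real (exp x) * cis y)) / of_real \<tau>) \<longlongrightarrow> 1 / of_real \<tau>) at_bot" by simp
    qed
    show "(((\<lambda>x. exp (of_real \<tau> * exp (Complex x y)) / of_real \<tau>) \<circ> real_of_ereal) \<longlongrightarrow> 0) (at_left \<infinity>)"
      unfolding ereal_tendsto_simps
    proof (rule tendsto_norm_zero_cancel)
      have "cos y = - decay" using assms by (metis decay_def cos_abs_real minus_minus)
      then have "norm (exp (of_real \<tau> * exp (Complex x y)) / complex_of_real \<tau>) = exp (- (decay * \<tau>) * exp x) / \<tau>" for x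
        using assms by (simp add: norm_divide exp_Complex mult_ac)
      moreover have "((\<lambda>x. exp (- A * exp x)) \<longlongrightarrow> 0) at_top" if "A > 0" for A :: real
        using that by real_asymp
      from tendsto_divide_zero [OF this, of "decay * \<tau>" \<tau>]
      have "((\<lambda>x. exp (- (decay * \<tau>) * exp x) / \<tau>) \<longlongrightarrow> 0) at_top" using decay_pos assms by simp
      ultimately show "((\<lambda>x. norm (exp (of_real \<tau> * exp (Complex x y)) / complex_of_real \<tau>)) \<longlongrightarrow> 0) at_top" by simp
    qed
  qed auto
  then show ?thesis
    by (simp add: interval_lebesgue_integral_def set_lebesgue_integral_def)
qed

lemma leading_contour_kernel_integral:
  assumes "0 < t" "0 < \<tau>"
  shows "has_bochner_integral lborel (\<lambda>p. leading_contour_kernel t \<tau> (fst p) (snd p)) 0"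
proof -
  have *: "leading_contour_kernel t \<tau> x y = jump (\<lambda>w. laplace_factor t w / exp (of_real \<alpha> * w)) x * jump (laplace_factor \<tau>) y" for x y
    unfolding leading_contour_kernel_def leading_kernel_def jump_mult_left by (simp add: jump_def algebra_simps diff_divide_distrib add_divide_distrib)
  have i1: "integrable lborel (\<lambda>x. jump (\<lambda>w. laplace_factor t w / exp (of_real \<alpha> * w)) x)"
  proof (rule Bochner_Integration.integrable_bound)
    show "integrable lborel (\<lambda>x. exp (- (decay * t) * exp x) * exp ((1 - \<alpha>) * x))"
      using has_bochner_integral_exp_exp [of "1 - \<alpha>" "decay * t"] assms decay_pos \<alpha> by (auto simp: has_bochner_integral_iff)
    show "AE x in lborel. norm (jump (\<lambda>w. laplace_factor t w / exp (of_real \<alpha> * w)) x) \<le> norm (exp (- (decay * t) * exp x) * exp ((1 - \<alpha>) * x))"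
      by (intro AE_I2, rule norm_jump_le) (simp add: norm_divide norm_laplace_factor algebra_simps exp_diff)
  qed measurable
  have i2: "integrable lborel (jump (laplace_factor \<tau>))"
    unfolding jump_def [abs_def] using laplace_factor_line_integrable [OF assms(2)] \<theta>_pos by auto
  have "(LINT x|lborel. jump (laplace_factor \<tau>) x) = 0"
    unfolding jump_def using laplace_factor_line_integrable [OF assms(2)] laplace_factor_line_integral [OF assms(2)] \<theta>_pos by simp
  then show ?thesis
    unfolding * using lborel_prod_mult [OF i1 i2] by simp
qed

text \<open>
  For \<open>\<kappa> \<ge> 0\<close> the kernel is estimated directly.  For \<open>\<kappa> < 0\<close> its leading part is subtracted first,
  which does not change the integral.
\<close>
proposition norm_subordinator_le:
  assumes t: "0 < t" "0 < \<tau>" and \<kappa>: "-1 \<le> \<kappa>" "\<kappa> < 1" "\<alpha> * (1 - \<kappa>) < 1"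
  shows "norm (subordinator t \<tau>) \<le> majorant_const \<kappa> * t powr (\<alpha> * (1 - \<kappa>) - 1) * \<tau> powr (\<beta> * \<kappa> - 1)"
proof -
  note bi = majorant_integral [OF t \<kappa>(3,2)]
  show ?thesis
  proof (cases "0 \<le> \<kappa>")
    case True
    have "norm (subordinator t \<tau>) \<le> (LINT p|lborel. norm (contour_kernel t \<tau> (fst p) (snd p)))"
      unfolding subordinator_def by (rule integral_norm_bound)
    also have "\<dots> \<le> (LINT p|lborel. majorant \<kappa> t \<tau> (fst p) (snd p))"
      by (rule integral_mono [OF integrable_norm [OF contour_kernel_integrable [OF t]] integrable.intros [OF bi]])
         (use norm_contour_kernel_le [of \<kappa>] True \<kappa> in auto)
    finally show ?thesis using bi by (simp add: has_bochner_integral_iff)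
  next
    case False
    have iK0: "integrable lborel (\<lambda>p. leading_contour_kernel t \<tau> (fst p) (snd p))"
      using leading_contour_kernel_integral [OF t] by (rule integrable.intros)
    have "subordinator t \<tau> = (LINT p|lborel. contour_kernel t \<tau> (fst p) (snd p) - leading_contour_kernel t \<tau> (fst p) (snd p))"
      unfolding subordinator_def using contour_kernel_integrable [OF t] iK0 leading_contour_kernel_integral [OF t] by (simp add: has_bochner_integral_iff)
    then have "norm (subordinator t \<tau>) \<le> (LINT p|lborel. norm (contour_kernel t \<tau> (fst p) (snd p) - leading_contour_kernel t \<tau> (fst p) (snd p)))"
      by (simp only: integral_norm_bound)
    also have "\<dots> \<le> (LINT p|lborel. majorant \<kappa> t \<tau> (fst p) (snd p))"
      by (rule integral_mono [OF integrable_norm [OF Bochner_Integration.integrable_diff [OF contour_kernel_integrable [OF t] iK0]] integrable.intros [OF bi]])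
         (use norm_contour_kernel_diff_le [of \<kappa>] False \<kappa> in auto)
    finally show ?thesis using bi by (simp add: has_bochner_integral_iff)
  qed
qed

lemma laplace_factor_laplace:
  assumes y: "\<bar>y\<bar> = \<theta>" and s: "0 < s"
  shows "has_bochner_integral lborel (\<lambda>t. indicator {0<..} t *\<^sub>R (exp (- s * t) *\<^sub>R laplace_factor t (Complex x y)))
    (exp (Complex x y) / (of_real s - exp (Complex x y)))"
proof -
  let ?w = "Complex x y"
  have "cos y = - decay" using y by (metis decay_def cos_abs_real minus_minus)
  then have "0 < Re (of_real s - exp ?w)" using s decay_pos by (simp add: exp_Complex add_pos_pos)
  from has_bochner_integral_mult_right [OF has_bochner_integral_exp_complex [OF this], of "exp ?w"]
  have "has_bochner_integral lborel (\<lambda>t. exp ?w * (indicator {0<..} t *\<^sub>R exp (- (of_real s - exp ?w) * of_real t)))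
    (exp ?w / (of_real s - exp ?w))" by simp
  moreover have "exp ?w * (indicator {0<..} t *\<^sub>R exp (- (of_real s - exp ?w) * of_real t))
      = indicator {0<..} t *\<^sub>R (exp (- s * t) *\<^sub>R laplace_factor t ?w)" for t
  proof -
    have "- (of_real s - exp ?w) * of_real t = of_real t * exp ?w + of_real (- s * t)"
      by (simp add: algebra_simps)
    then have e: "exp (- (of_real s - exp ?w) * of_real t) = exp (of_real t * exp ?w) * of_real (exp (- s * t))"
      by (simp only: exp_add exp_of_real)
    show ?thesis
      unfolding e by (simp add: laplace_factor_def scaleR_conv_of_real of_real_indicator mult_ac)
  qed
  ultimately show ?thesis by (simp only:)
qed

text \<open>
  Integrating in \<open>\<tau>\<close> first turns the factor \<open>e\<^sup>\<nu>\<^sup>\<tau>\<close> into \<open>1 / (\<mu> - \<nu>)\<close>; Cauchy's formula in \<open>\<nu>\<close> then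
  evaluates \<open>1 / (z\<^sup>\<alpha> + \<nu>\<^sup>\<beta>)\<close> at \<open>\<nu> = \<mu>\<close>.
\<close>
lemma laplace_subordinator:
  assumes t: "0 < t" and \<mu>: "0 < \<mu>"
  shows "has_bochner_integral lborel (\<lambda>\<tau>. indicator {0<..} \<tau> *\<^sub>R (exp (- \<mu> * \<tau>) *\<^sub>R subordinator t \<tau>))
    (strip_integral \<theta> (\<lambda>w. laplace_factor t w / (exp (of_real \<alpha> * w) + of_real (\<mu> powr \<beta>))))"
proof -
  define \<kappa> :: real where "\<kappa> = 1 / 2"
  have \<kappa>: "0 \<le> \<kappa>" "\<kappa> < 1" "\<alpha> * (1 - \<kappa>) < 1" "0 < \<beta> * \<kappa>" using \<alpha> \<beta> by (auto simp: \<kappa>_def)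
  define H where "H = (\<lambda>\<tau> p. indicator {0<..} \<tau> *\<^sub>R (exp (- \<mu> * \<tau>) *\<^sub>R contour_kernel t \<tau> (fst p) (snd p)))"
  define \<Phi> :: "complex \<Rightarrow> complex \<Rightarrow> complex" where "\<Phi> = (\<lambda>w v. 1 / (exp (of_real \<alpha> * w) + exp (of_real \<beta> * v)))"
  have [measurable]: "(\<lambda>z. H (fst z) (snd z)) \<in> borel_measurable (lborel \<Otimes>\<^sub>M lborel)"
    unfolding H_def by measurable
  have Hint: "integrable (lborel \<Otimes>\<^sub>M lborel) (\<lambda>(\<tau>, p). H \<tau> p)"
  proof (rule lborel_pair.Fubini_integrable)
    show "integrable lborel (\<lambda>\<tau>. LINT p|lborel. norm ((\<lambda>(\<tau>, p). H \<tau> p) (\<tau>, p)))"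
    proof (rule Bochner_Integration.integrable_bound)
      show "integrable lborel (\<lambda>\<tau>. majorant_const \<kappa> * t powr (\<alpha> * (1 - \<kappa>) - 1) * (indicator {0<..} \<tau> * (\<tau> powr (\<beta> * \<kappa> - 1) * exp (- \<mu> * \<tau>))))"
        using has_bochner_integral_powr_exp [OF \<kappa>(4) \<mu>] by (auto simp: has_bochner_integral_iff)
      show "AE \<tau> in lborel. norm (LINT p|lborel. norm ((\<lambda>(\<tau>, p). H \<tau> p) (\<tau>, p)))
         \<le> norm (majorant_const \<kappa> * t powr (\<alpha> * (1 - \<kappa>) - 1) * (indicator {0<..} \<tau> * (\<tau> powr (\<beta> * \<kappa> - 1) * exp (- \<mu> * \<tau>))))"
      proof (rule AE_I2)
        fix \<tau> :: real
        show "norm (LINT p|lborel. norm ((\<lambda>(\<tau>, p). H \<tau> p) (\<tau>, p)))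
         \<le> norm (majorant_const \<kappa> * t powr (\<alpha> * (1 - \<kappa>) - 1) * (indicator {0<..} \<tau> * (\<tau> powr (\<beta> * \<kappa> - 1) * exp (- \<mu> * \<tau>))))"
        proof (cases "\<tau> > 0")
          case True
          have "(LINT p|lborel. norm (H \<tau> p)) = exp (- \<mu> * \<tau>) * (LINT p|lborel. norm (contour_kernel t \<tau> (fst p) (snd p)))"
            using True by (simp add: H_def)
          also have "\<dots> \<le> exp (- \<mu> * \<tau>) * (LINT p|lborel. majorant \<kappa> t \<tau> (fst p) (snd p))"
            by (intro mult_left_mono integral_mono [OF integrable_norm [OF contour_kernel_integrable [OF t True]] integrable.intros [OF majorant_integral [OF t True \<kappa>(3,2)]]])
               (use norm_contour_kernel_le [of \<kappa>] \<kappa> in auto)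
          also have "\<dots> = majorant_const \<kappa> * t powr (\<alpha> * (1 - \<kappa>) - 1) * (indicator {0<..} \<tau> * (\<tau> powr (\<beta> * \<kappa> - 1) * exp (- \<mu> * \<tau>)))"
            using majorant_integral [OF t True \<kappa>(3,2)] True by (simp add: has_bochner_integral_iff)
          finally show ?thesis using True majorant_const_nonneg [of \<kappa>] by (simp add: abs_of_nonneg)
        qed (simp add: H_def)
      qed
    qed measurable
    show "AE \<tau> in lborel. integrable lborel (\<lambda>p. (\<lambda>(\<tau>, p). H \<tau> p) (\<tau>, p))"
      by (rule AE_I2) (use contour_kernel_integrable [OF t] in \<open>auto simp: H_def indicator_def\<close>)
  qed measurable
  have inner: "(LINT \<tau>|lborel. H \<tau> p) = jump (\<lambda>w. jump (\<lambda>v. laplace_factor t w * (\<Phi> w v * exp v / (of_real \<mu> - exp v))) (snd p)) (fst p)" for p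
  proof -
    have "has_bochner_integral lborel (\<lambda>\<tau>. jump (\<lambda>w. jump (\<lambda>v. (laplace_factor t w * \<Phi> w v) * (indicator {0<..} \<tau> *\<^sub>R (exp (- \<mu> * \<tau>) *\<^sub>R laplace_factor \<tau> v))) (snd p)) (fst p))
      (jump (\<lambda>w. jump (\<lambda>v. (laplace_factor t w * \<Phi> w v) * (exp v / (of_real \<mu> - exp v))) (snd p)) (fst p))"
      by (intro has_bochner_integral_jump has_bochner_integral_mult_right laplace_factor_laplace \<mu>)
    moreover have "jump (\<lambda>w. jump (\<lambda>v. (laplace_factor t w * \<Phi> w v) * (indicator {0<..} \<tau> *\<^sub>R (exp (- \<mu> * \<tau>) *\<^sub>R laplace_factor \<tau> v))) (snd p)) (fst p) = H \<tau> p" for \<tau>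
    proof -
      have *: "(laplace_factor t w * \<Phi> w v) * (indicator {0<..} \<tau> *\<^sub>R (exp (- \<mu> * \<tau>) *\<^sub>R laplace_factor \<tau> v))
          = (indicator {0<..} \<tau> * of_real (exp (- \<mu> * \<tau>))) * symbol_kernel t \<tau> w v" for w v
        by (simp add: symbol_kernel_def \<Phi>_def scaleR_conv_of_real of_real_indicator)
      show ?thesis
        unfolding H_def contour_kernel_def * jump_mult_left by (simp add: scaleR_conv_of_real of_real_indicator)
    qed
    ultimately show ?thesis by (simp add: has_bochner_integral_iff mult.assoc)
  qed
  have cauchy: "strip_integral \<theta> (\<lambda>v. \<Phi> w v * exp v / (of_real \<mu> - exp v)) = 1 / (exp (of_real \<alpha> * w) + of_real (\<mu> powr \<beta>))"
    and cauchyi: "\<And>y. \<bar>y\<bar> = \<theta> \<Longrightarrow> integrable lborel (\<lambda>x. \<Phi> w (Complex x y) * exp (Complex x y) / (of_real \<mu> - exp (Complex x y)))"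
    if w: "\<bar>Im w\<bar> = \<theta>" for w
  proof -
    \<comment> \<open>The sector can be widened a little without creating zeros of the denominator.\<close>
    obtain \<theta>' where \<theta>': "\<theta> < \<theta>'" "\<theta>' < pi" "\<alpha> * \<theta> + \<beta> * \<theta>' < pi"
    proof
      define e where "e = min ((pi - \<theta>) / 2) ((pi - (\<alpha> + \<beta>) * \<theta>) / 2)"
      have e: "e > 0" "\<theta> + e < pi" "(\<alpha> + \<beta>) * \<theta> + e < pi" using \<theta> by (auto simp: e_def min_def field_simps)
      show "\<theta> < \<theta> + e" "\<theta> + e < pi" using e by auto
      have "\<beta> * e \<le> 1 * e" using \<beta> e by (intro mult_right_mono) auto
      moreover have "\<alpha> * \<theta> + \<beta> * (\<theta> + e) = (\<alpha> + \<beta>) * \<theta> + \<beta> * e" by (simp add: algebra_simps)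
      ultimately show "\<alpha> * \<theta> + \<beta> * (\<theta> + e) < pi" using e by linarith
    qed
    have hol: "\<Phi> w holomorphic_on {v. \<bar>Im v\<bar> < \<theta>'}"
    proof -
      have "exp (of_real \<alpha> * w) + exp (of_real \<beta> * v) \<noteq> 0" if "\<bar>Im v\<bar> < \<theta>'" for v
        using abs_argument_difference_le [of w \<theta> v \<theta>'] w that \<theta>' by (intro denominator_nonzero) auto
      then show ?thesis unfolding \<Phi>_def by (intro holomorphic_intros) auto
    qed
    define C where "C = max (1 / aperture) (exp (- (\<alpha> * Re w)) / aperture)"
    have bounded: "norm (\<Phi> w v) \<le> C" if v: "\<bar>Im v\<bar> \<le> \<theta>" for v
      using norm_inverse_denominator_le [of w v 0] w v by (simp add: \<Phi>_def C_def le_max_iff_disj)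
    have decay: "norm (\<Phi> w v) \<le> C * exp (- \<beta> * Re v)" if v: "\<bar>Im v\<bar> \<le> \<theta>" for v
    proof -
      have "norm (\<Phi> w v) \<le> 1 / aperture * exp (- \<beta> * Re v)"
        using norm_inverse_denominator_le [of w v 1] w v by (simp add: \<Phi>_def)
      also have "\<dots> \<le> C * exp (- \<beta> * Re v)" by (intro mult_right_mono) (auto simp: C_def)
      finally show ?thesis .
    qed
    note sc = strip_cauchy_formula_decay [OF \<theta>_pos \<theta>'(1) less_imp_le [OF \<theta>'(2)] hol bounded decay \<beta> \<mu>]
    have "exp (of_real \<beta> * of_real (ln \<mu>)) = complex_of_real (\<mu> powr \<beta>)"
      using \<mu> by (simp add: powr_def exp_of_real [symmetric] flip: of_real_mult)
    then show "strip_integral \<theta> (\<lambda>v. \<Phi> w v * exp v / (of_real \<mu> - exp v)) = 1 / (exp (of_real \<alpha> * w) + of_real (\<mu> powr \<beta>))"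
      using sc(1) by (simp add: \<Phi>_def)
    show "integrable lborel (\<lambda>x. \<Phi> w (Complex x y) * exp (Complex x y) / (of_real \<mu> - exp (Complex x y)))" if "\<bar>y\<bar> = \<theta>" for y
      using sc(2) [OF _ _ that] by blast
  qed
  define J where "J = (\<lambda>p. jump (\<lambda>w. jump (\<lambda>v. laplace_factor t w * (\<Phi> w v * exp v / (of_real \<mu> - exp v))) (snd p)) (fst p))"
  have "integrable (lborel \<Otimes>\<^sub>M lborel) J"
  proof -
    have "integrable lborel (\<lambda>p. LINT \<tau>|lborel. H \<tau> p)"
      using lborel_pair.integrable_snd [OF Hint] .
    then show ?thesis by (simp add: inner J_def lborel_prod)
  qed
  have iH: "integrable lborel (\<lambda>\<tau>. LINT p|lborel. H \<tau> p)"
    using lborel_pair.integrable_fst [OF Hint] .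
  have "(LINT \<tau>|lborel. LINT p|lborel. H \<tau> p) = (LINT p|lborel. LINT \<tau>|lborel. H \<tau> p)"
    by (rule lborel_pair.Fubini_integral [OF Hint, symmetric])
  also have "\<dots> = (LINT p|(lborel \<Otimes>\<^sub>M lborel). J p)"
    unfolding inner J_def [symmetric] lborel_prod ..
  also have "\<dots> = (LINT x|lborel. LINT y|lborel. J (x, y))"
    using lborel_pair.integral_fst' [OF \<open>integrable (lborel \<Otimes>\<^sub>M lborel) J\<close>] by simp
  also have "\<dots> = (LINT x|lborel. jump (\<lambda>w. laplace_factor t w / (exp (of_real \<alpha> * w) + of_real (\<mu> powr \<beta>))) x)"
  proof (rule Bochner_Integration.integral_cong)
    fix x :: real
    have "has_bochner_integral lborel (\<lambda>y. jump (\<lambda>w. laplace_factor t w * jump (\<lambda>v. \<Phi> w v * exp v / (of_real \<mu> - exp v)) y) x)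
      (jump (\<lambda>w. laplace_factor t w * strip_integral \<theta> (\<lambda>v. \<Phi> w v * exp v / (of_real \<mu> - exp v))) x)"
    proof (intro has_bochner_integral_jump has_bochner_integral_mult_right)
      fix y assume "\<bar>y\<bar> = \<theta>"
      then show "has_bochner_integral lborel (\<lambda>ya. jump (\<lambda>v. \<Phi> (Complex x y) v * exp v / (of_real \<mu> - exp v)) ya)
         (strip_integral \<theta> (\<lambda>v. \<Phi> (Complex x y) v * exp v / (of_real \<mu> - exp v)))"
        unfolding has_bochner_integral_iff strip_integral_jump
        unfolding jump_def using cauchyi [of "Complex x y"] \<theta>_pos by auto
    qed
    moreover have "jump (\<lambda>w. laplace_factor t w * strip_integral \<theta> (\<lambda>v. \<Phi> w v * exp v / (of_real \<mu> - exp v))) x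
       = jump (\<lambda>w. laplace_factor t w / (exp (of_real \<alpha> * w) + of_real (\<mu> powr \<beta>))) x"
      using \<theta>_pos by (simp add: jump_def [of _ x] cauchy)
    ultimately show "(LINT y|lborel. J (x, y)) = jump (\<lambda>w. laplace_factor t w / (exp (of_real \<alpha> * w) + of_real (\<mu> powr \<beta>))) x"
      by (simp only: J_def jump_mult_left fst_conv snd_conv has_bochner_integral_iff)
  qed simp
  finally have eq: "(LINT \<tau>|lborel. LINT p|lborel. H \<tau> p) = strip_integral \<theta> (\<lambda>w. laplace_factor t w / (exp (of_real \<alpha> * w) + of_real (\<mu> powr \<beta>)))"
    by (simp add: strip_integral_jump)
  have "(LINT p|lborel. H \<tau> p) = indicator {0<..} \<tau> *\<^sub>R (exp (- \<mu> * \<tau>) *\<^sub>R subordinator t \<tau>)" for \<tau>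
    by (simp add: H_def subordinator_def)
  then show ?thesis using eq iH by (simp add: has_bochner_integral_iff)
qed

end

section \<open>Mittag-Leffler functions\<close>

text \<open>
  Restrict the integral for \<open>\<Gamma>(b)\<close> to \<open>[A, A + 1]\<close>.  As \<open>A\<close> is arbitrary, \<open>\<Gamma>\<close> grows faster than any
  exponential.
\<close>
lemma Gamma_real_ge:
  assumes b: "1 \<le> b" and A: "0 < A"
  shows "A powr (b - 1) * exp (- (A + 1)) \<le> Gamma (b::real)"
proof -
  have G: "has_bochner_integral lborel (\<lambda>t. indicator {0<..} t * (t powr (b - 1) * exp (- 1 * t))) (Gamma b / 1 powr b)"
    using b by (intro has_bochner_integral_powr_exp) auto
  have "A powr (b - 1) * exp (- (A + 1)) = (LINT t|lborel. indicator {A..A + 1} t * (A powr (b - 1) * exp (- (A + 1))))"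
    by simp
  also have "\<dots> \<le> (LINT t|lborel. indicator {0<..} t * (t powr (b - 1) * exp (- 1 * t)))"
  proof (rule integral_mono)
    show "integrable lborel (\<lambda>t. indicator {A..A + 1} t * (A powr (b - 1) * exp (- (A + 1))))"
      by (intro integrable_mult_left integrable_real_indicator) auto
    show "integrable lborel (\<lambda>t. indicator {0<..} t * (t powr (b - 1) * exp (- 1 * t)))"
      using G by (rule integrable.intros)
    show "indicator {A..A + 1} t * (A powr (b - 1) * exp (- (A + 1))) \<le> indicator {0<..} t * (t powr (b - 1) * exp (- 1 * t))" for t
      using A b by (auto simp: indicator_def intro!: mult_mono powr_mono2)
  qed
  also have "\<dots> = Gamma b" using G by (simp add: has_bochner_integral_iff)
  finally show ?thesis .
qed

lemma mittag_leffler_summable: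
  assumes \<alpha>: "0 < \<alpha>" and \<gamma>: "0 < \<gamma>"
  shows "summable (\<lambda>k. norm (z ^ k / Gamma (\<alpha> * real k + \<gamma>)))"
proof (rule summable_comparison_test_ev)
  \<comment> \<open>With \<open>A\<^sup>\<alpha> = 2 (|z| + 1)\<close> the lower bound on \<open>\<Gamma>\<close> beats the powers of \<open>z\<close> by \<open>2\<^sup>k\<close>.\<close>
  define R where "R = 2 * (\<bar>z\<bar> + 1)"
  define A where "A = R powr (1 / \<alpha>)"
  have R: "R > 0" by (simp add: R_def)
  have A: "A > 0" "A powr \<alpha> = R" using R \<alpha> by (auto simp: A_def powr_powr)
  show "summable (\<lambda>k. (1 / 2) ^ k * (exp (A + 1) * A powr (1 - \<gamma>)))"
    by (intro summable_mult2 summable_geometric) auto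
  show "\<forall>\<^sub>F k in sequentially. norm (norm (z ^ k / Gamma (\<alpha> * real k + \<gamma>))) \<le> (1 / 2) ^ k * (exp (A + 1) * A powr (1 - \<gamma>))"
    using eventually_ge_at_top [of "nat \<lceil>1 / \<alpha>\<rceil>"]
  proof eventually_elim
    case (elim k)
    then have "1 / \<alpha> \<le> real k" by linarith
    then have "1 \<le> \<alpha> * real k" using \<alpha> by (simp add: field_simps)
    then have b: "1 \<le> \<alpha> * real k + \<gamma>" using \<gamma> by linarith
    have "A powr (\<alpha> * real k + \<gamma> - 1) = R ^ k / A powr (1 - \<gamma>)"
      using A R by (simp add: powr_powr [symmetric] powr_add powr_diff powr_realpow algebra_simps)
    moreover have "R ^ k / (exp (A + 1) * A powr (1 - \<gamma>)) = R ^ k / A powr (1 - \<gamma>) * exp (- (A + 1))"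
      unfolding exp_minus by (simp add: divide_inverse)
    ultimately have G: "R ^ k / (exp (A + 1) * A powr (1 - \<gamma>)) \<le> Gamma (\<alpha> * real k + \<gamma>)"
      using Gamma_real_ge [OF b A(1)] by (simp only:)
    have pos: "0 < R ^ k / (exp (A + 1) * A powr (1 - \<gamma>))" using R A by simp
    have "norm (z ^ k / Gamma (\<alpha> * real k + \<gamma>)) = \<bar>z\<bar> ^ k / Gamma (\<alpha> * real k + \<gamma>)"
      using G pos by (simp add: power_abs)
    also have "\<dots> \<le> (R / 2) ^ k / (R ^ k / (exp (A + 1) * A powr (1 - \<gamma>)))"
      using G pos by (intro frac_le power_mono) (auto simp: R_def)
    also have "\<dots> = (1 / 2) ^ k * (exp (A + 1) * A powr (1 - \<gamma>))"
      using R by (simp add: power_divide)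
    finally show ?case by simp
  qed
qed

text \<open>
  Integrating term by term gives a geometric series in \<open>- L / s\<^sup>\<alpha>\<close>.
\<close>
lemma mittag_leffler_laplace:
  assumes \<alpha>: "0 < \<alpha>" and L: "0 \<le> L" and s: "0 < s" "L < s powr \<alpha>"
  shows "has_bochner_integral lborel
    (\<lambda>t. indicator {0<..} t * (exp (- s * t) * (t powr (\<alpha> - 1) * mittag_leffler \<alpha> \<alpha> (- L * t powr \<alpha>)))) (1 / (s powr \<alpha> + L))"
proof -
  define f where "f = (\<lambda>k t. (- L) ^ k / Gamma (\<alpha> * real k + \<alpha>) * (indicator {0<..} t * (t powr (\<alpha> * real k + \<alpha> - 1) * exp (- s * t))))"
  have sp: "0 < s powr \<alpha>" using s by simp
  have f: "has_bochner_integral lborel (f k) ((- L) ^ k / Gamma (\<alpha> * real k + \<alpha>) * (Gamma (\<alpha> * real k + \<alpha>) / s powr (\<alpha> * real k + \<alpha>)))" for k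
    unfolding f_def using \<alpha> s by (intro has_bochner_integral_mult_right has_bochner_integral_powr_exp) (auto intro: add_nonneg_pos)
  have G: "Gamma (\<alpha> * real k + \<alpha>) > 0" for k
    using \<alpha> by (intro Gamma_real_pos) (auto intro: add_nonneg_pos)
  have pw: "s powr (\<alpha> * real k + \<alpha>) = s powr \<alpha> * (s powr \<alpha>) ^ k" for k
    using s by (simp add: powr_add powr_powr [symmetric] powr_realpow)
  have val: "(LINT t|lborel. f k t) = (- L / s powr \<alpha>) ^ k * (1 / s powr \<alpha>)" for k
    using f [of k] G [of k] unfolding power_divide by (simp add: has_bochner_integral_iff pw)
  have valn: "(LINT t|lborel. norm (f k t)) = (L / s powr \<alpha>) ^ k * (1 / s powr \<alpha>)" for k
  proof -
    have "norm (f k t) = L ^ k / Gamma (\<alpha> * real k + \<alpha>) * (indicator {0<..} t * (t powr (\<alpha> * real k + \<alpha> - 1) * exp (- s * t)))" for t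
      using L G [of k] by (simp add: f_def abs_mult power_abs)
    moreover have "has_bochner_integral lborel (\<lambda>t. L ^ k / Gamma (\<alpha> * real k + \<alpha>) * (indicator {0<..} t * (t powr (\<alpha> * real k + \<alpha> - 1) * exp (- s * t)))) (L ^ k / Gamma (\<alpha> * real k + \<alpha>) * (Gamma (\<alpha> * real k + \<alpha>) / s powr (\<alpha> * real k + \<alpha>)))"
      using \<alpha> s by (intro has_bochner_integral_mult_right has_bochner_integral_powr_exp) (auto intro: add_nonneg_pos)
    ultimately show ?thesis using G [of k] by (simp add: has_bochner_integral_iff pw power_divide)
  qed
  have r: "norm (L / s powr \<alpha>) < 1" using L s by simp
  have sumn: "summable (\<lambda>k. LINT t|lborel. norm (f k t))"
    unfolding valn using r by (intro summable_mult2 summable_geometric)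
  have fML: "f k t = indicator {0<..} t * (exp (- s * t) * t powr (\<alpha> - 1)) * ((- L * t powr \<alpha>) ^ k / Gamma (\<alpha> * real k + \<alpha>))" for k t
  proof (cases "t > 0")
    case True
    then have "t powr (\<alpha> * real k + \<alpha> - 1) = t powr (\<alpha> - 1) * (t powr \<alpha>) ^ k"
      by (simp add: powr_add [symmetric] powr_powr powr_realpow [symmetric] algebra_simps)
    then show ?thesis unfolding power_mult_distrib by (simp add: f_def)
  qed (simp add: f_def)
  have sump: "AE t in lborel. summable (\<lambda>k. norm (f k t))"
  proof (rule AE_I2)
    fix t :: real
    show "summable (\<lambda>k. norm (f k t))"
      unfolding fML norm_mult [of "indicator {0<..} t * (exp (- s * t) * t powr (\<alpha> - 1))"]
      by (intro summable_mult mittag_leffler_summable \<alpha>)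
  qed
  have fi: "integrable lborel (f k)" for k using f by (rule integrable.intros)
  have eq: "(\<Sum>k. f k t) = indicator {0<..} t * (exp (- s * t) * (t powr (\<alpha> - 1) * mittag_leffler \<alpha> \<alpha> (- L * t powr \<alpha>)))" for t
    unfolding fML mittag_leffler_def
    using summable_norm_cancel [OF mittag_leffler_summable [OF \<alpha> \<alpha>, of "- L * t powr \<alpha>"]]
    by (subst suminf_mult) (auto simp: mult.assoc)
  have "integrable lborel (\<lambda>t. \<Sum>k. f k t)"
    by (rule integrable_suminf [OF fi sump sumn])
  moreover have "(LINT t|lborel. (\<Sum>k. f k t)) = (\<Sum>k. LINT t|lborel. f k t)"
    by (rule integral_suminf [OF fi sump sumn])
  moreover have "(\<Sum>k. LINT t|lborel. f k t) = 1 / (s powr \<alpha> + L)"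
  proof -
    have "(\<lambda>k. (- L / s powr \<alpha>) ^ k) sums (1 / (1 - (- L / s powr \<alpha>)))"
      using r by (intro geometric_sums) simp
    then have "(\<lambda>k. (- L / s powr \<alpha>) ^ k * (1 / s powr \<alpha>)) sums (1 / (1 - (- L / s powr \<alpha>)) * (1 / s powr \<alpha>))"
      by (rule sums_mult2)
    moreover have "1 / (1 - (- L / s powr \<alpha>)) * (1 / s powr \<alpha>) = 1 / (s powr \<alpha> + L)"
      using sp L by (simp add: field_simps add_pos_nonneg)
    ultimately show ?thesis unfolding val by (metis sums_unique)
  qed
  ultimately show ?thesis by (simp only: has_bochner_integral_iff eq)
qed

lemma has_bochner_integral_beta:
  assumes a: "0 < a" and b: "0 < b" and t: "0 < (t::real)"
  shows "has_bochner_integral lborel (\<lambda>s. indicator {0<..<t} s * ((t - s) powr (a - 1) * s powr (b - 1)))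
    (t powr (a + b - 1) * Beta a b)"
proof -
  have i: "set_integrable lborel {0..1} (\<lambda>u. u powr (b - 1) * (1 - u) powr (a - 1))"
    using integrable_Beta [OF b a] .
  have v: "(LINT u:{0..1}|lborel. u powr (b - 1) * (1 - u) powr (a - 1)) = Beta b a"
    using set_borel_integral_eq_integral(2) [OF i] has_integral_Beta_real [OF b a] by (simp add: integral_unique)
  have 1: "has_bochner_integral lborel (\<lambda>u. indicator {0..1} u *\<^sub>R (u powr (b - 1) * (1 - u) powr (a - 1))) (Beta b a)"
    using i v by (simp add: has_bochner_integral_iff set_integrable_def set_lebesgue_integral_def)
  have 2: "has_bochner_integral lborel (\<lambda>u. indicator {0<..<1} u * (u powr (b - 1) * (1 - u) powr (a - 1))) (Beta b a)"
  proof (rule has_bochner_integral_cong_AE [THEN iffD1, OF _ _ _ 1])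
    have "AE u in lborel. u \<noteq> 0 \<and> u \<noteq> (1::real)"
      using AE_lborel_singleton [of 0] AE_lborel_singleton [of 1] by eventually_elim auto
    then show "AE u in lborel. indicator {0..1} u *\<^sub>R (u powr (b - 1) * (1 - u) powr (a - 1)) = indicator {0<..<1} u * (u powr (b - 1) * (1 - u) powr (a - 1))"
      by eventually_elim (auto simp: indicator_def)
  qed auto
  have 3: "has_bochner_integral lborel (\<lambda>s. indicator {0<..<1} (0 + (1 / t) * s) * ((0 + (1 / t) * s) powr (b - 1) * (1 - (0 + (1 / t) * s)) powr (a - 1))) (Beta b a /\<^sub>R \<bar>1 / t\<bar>)"
    using t 2 by (subst (asm) lborel_has_bochner_integral_real_affine_iff [of "1 / t" _ _ 0]) auto
  have 4: "has_bochner_integral lborel (\<lambda>s. t powr (a + b - 2) * (indicator {0<..<1} (0 + (1 / t) * s) * ((0 + (1 / t) * s) powr (b - 1) * (1 - (0 + (1 / t) * s)) powr (a - 1)))) (t powr (a + b - 2) * (Beta b a /\<^sub>R \<bar>1 / t\<bar>))"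
    by (rule has_bochner_integral_mult_right [OF 3])
  have "t powr (a + b - 2) * (indicator {0<..<1} (0 + (1 / t) * s) * ((0 + (1 / t) * s) powr (b - 1) * (1 - (0 + (1 / t) * s)) powr (a - 1)))
     = indicator {0<..<t} s * ((t - s) powr (a - 1) * s powr (b - 1))" for s
  proof (cases "s \<in> {0<..<t}")
    case True
    then have "1 - s / t = (t - s) / t" using t by (simp add: field_simps)
    moreover have "t powr (a + b - 2) = t powr (a - 1) * t powr (b - 1)"
      by (simp add: powr_add [symmetric])
    ultimately show ?thesis using True t by (simp add: powr_divide)
  next
    case False
    then have "s / t \<notin> {0<..<1}" using t by (auto simp: field_simps)
    then show ?thesis using False by simp
  qed
  moreover have "t powr (a + b - 2) * (Beta b a /\<^sub>R \<bar>1 / t\<bar>) = t powr (a + b - 1) * Beta a b"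
  proof -
    have "t powr (a + b - 1) = t powr (a + b - 2) * t powr 1" by (simp only: powr_add [symmetric]) simp
    then show ?thesis using t by (simp add: Beta_commute)
  qed
  ultimately show ?thesis using 4 by (simp only:)
qed

text \<open>
  Term by term this is a Beta integral, and the numerator of the Beta function cancels the
  denominator of the series.
\<close>
lemma mittag_leffler_fractional_integral:
  assumes \<alpha>: "0 < \<alpha>" "\<alpha> < 1" and L: "0 \<le> L" and t: "0 < t"
  shows "has_bochner_integral lborel
    (\<lambda>s. indicator {0<..<t} s * ((t - s) powr (- \<alpha>) * (s powr (\<alpha> - 1) * mittag_leffler \<alpha> \<alpha> (- L * s powr \<alpha>))))
    (Gamma (1 - \<alpha>) * mittag_leffler \<alpha> 1 (- L * t powr \<alpha>))"
proof -
  define f where "f = (\<lambda>k s. (- L) ^ k / Gamma (\<alpha> * real k + \<alpha>) * (indicator {0<..<t} s * ((t - s) powr ((1 - \<alpha>) - 1) * s powr ((\<alpha> * real k + \<alpha>) - 1))))"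
  have pos: "0 < \<alpha> * real k + \<alpha>" for k using \<alpha> by (intro add_nonneg_pos) auto
  have G: "Gamma (\<alpha> * real k + \<alpha>) > 0" for k using pos by (rule Gamma_real_pos)
  have B: "has_bochner_integral lborel (\<lambda>s. (indicator {0<..<t} s * ((t - s) powr ((1 - \<alpha>) - 1) * s powr ((\<alpha> * real k + \<alpha>) - 1))))
     (t powr ((1 - \<alpha>) + (\<alpha> * real k + \<alpha>) - 1) * Beta (1 - \<alpha>) (\<alpha> * real k + \<alpha>))" for k
    using \<alpha> by (intro has_bochner_integral_beta pos t) auto
  have Bv: "t powr ((1 - \<alpha>) + (\<alpha> * real k + \<alpha>) - 1) * Beta (1 - \<alpha>) (\<alpha> * real k + \<alpha>)
    = (t powr \<alpha>) ^ k * (Gamma (1 - \<alpha>) * Gamma (\<alpha> * real k + \<alpha>) / Gamma (\<alpha> * real k + 1))" for k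
    using t by (simp add: powr_powr [symmetric] powr_realpow Beta_def add.commute)
  have f: "has_bochner_integral lborel (f k) (Gamma (1 - \<alpha>) * ((- L * t powr \<alpha>) ^ k / Gamma (\<alpha> * real k + 1)))" for k
    using has_bochner_integral_mult_right [OF B [of k], of "(- L) ^ k / Gamma (\<alpha> * real k + \<alpha>)"] G [of k]
    unfolding f_def Bv power_mult_distrib by (simp add: mult_ac)
  have valn: "(LINT s|lborel. norm (f k s)) = Gamma (1 - \<alpha>) * ((L * t powr \<alpha>) ^ k / Gamma (\<alpha> * real k + 1))" for k
  proof -
    have "norm (f k s) = L ^ k / Gamma (\<alpha> * real k + \<alpha>) * (indicator {0<..<t} s * ((t - s) powr ((1 - \<alpha>) - 1) * s powr ((\<alpha> * real k + \<alpha>) - 1)))" for s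
      using L G [of k] by (simp add: f_def abs_mult power_abs)
    moreover have "has_bochner_integral lborel (\<lambda>s. L ^ k / Gamma (\<alpha> * real k + \<alpha>) * (indicator {0<..<t} s * ((t - s) powr ((1 - \<alpha>) - 1) * s powr ((\<alpha> * real k + \<alpha>) - 1)))) (Gamma (1 - \<alpha>) * ((L * t powr \<alpha>) ^ k / Gamma (\<alpha> * real k + 1)))"
      using has_bochner_integral_mult_right [OF B [of k], of "L ^ k / Gamma (\<alpha> * real k + \<alpha>)"] G [of k]
      unfolding Bv by (simp add: power_mult_distrib mult_ac)
    ultimately show ?thesis by (simp add: has_bochner_integral_iff)
  qed
  have sumn: "summable (\<lambda>k. LINT s|lborel. norm (f k s))"
    unfolding valn using summable_norm_cancel [OF mittag_leffler_summable [OF \<alpha>(1), of 1]]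
    by (intro summable_mult) auto
  have fML: "f k s = indicator {0<..<t} s * ((t - s) powr (- \<alpha>) * s powr (\<alpha> - 1)) * ((- L * s powr \<alpha>) ^ k / Gamma (\<alpha> * real k + \<alpha>))" for k s
  proof (cases "s > 0")
    case True
    then have "s powr (\<alpha> * real k + \<alpha> - 1) = s powr (\<alpha> - 1) * (s powr \<alpha>) ^ k"
      by (simp add: powr_add [symmetric] powr_powr powr_realpow [symmetric] algebra_simps)
    then show ?thesis unfolding power_mult_distrib by (simp add: f_def)
  qed (simp add: f_def)
  have sump: "AE s in lborel. summable (\<lambda>k. norm (f k s))"
  proof (rule AE_I2)
    fix s :: real
    show "summable (\<lambda>k. norm (f k s))"
      unfolding fML norm_mult [of "indicator {0<..<t} s * ((t - s) powr (- \<alpha>) * s powr (\<alpha> - 1))"]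
      by (intro summable_mult mittag_leffler_summable \<alpha>)
  qed
  have fi: "integrable lborel (f k)" for k using f by (rule integrable.intros)
  have eq: "(\<Sum>k. f k s) = indicator {0<..<t} s * ((t - s) powr (- \<alpha>) * (s powr (\<alpha> - 1) * mittag_leffler \<alpha> \<alpha> (- L * s powr \<alpha>)))" for s
    unfolding fML mittag_leffler_def
    using summable_norm_cancel [OF mittag_leffler_summable [OF \<alpha>(1) \<alpha>(1), of "- L * s powr \<alpha>"]]
    by (subst suminf_mult) (auto simp: mult.assoc)
  have "integrable lborel (\<lambda>s. \<Sum>k. f k s)"
    by (rule integrable_suminf [OF fi sump sumn])
  moreover have "(LINT s|lborel. (\<Sum>k. f k s)) = (\<Sum>k. LINT s|lborel. f k s)"
    by (rule integral_suminf [OF fi sump sumn])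
  moreover have "(\<Sum>k. LINT s|lborel. f k s) = Gamma (1 - \<alpha>) * mittag_leffler \<alpha> 1 (- L * t powr \<alpha>)"
  proof -
    have "(LINT s|lborel. f k s) = Gamma (1 - \<alpha>) * ((- L * t powr \<alpha>) ^ k / Gamma (\<alpha> * real k + 1))" for k
      using f [of k] by (simp add: has_bochner_integral_iff)
    moreover have "(\<Sum>k. Gamma (1 - \<alpha>) * ((- L * t powr \<alpha>) ^ k / Gamma (\<alpha> * real k + 1)))
        = Gamma (1 - \<alpha>) * (\<Sum>k. (- L * t powr \<alpha>) ^ k / Gamma (\<alpha> * real k + 1))"
      by (rule suminf_mult [OF summable_norm_cancel [OF mittag_leffler_summable [OF \<alpha>(1)]]]) simp
    ultimately show ?thesis by (simp only: mittag_leffler_def)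
  qed
  ultimately show ?thesis by (simp only: has_bochner_integral_iff eq)
qed

section \<open>The kernels as superpositions of heat kernels\<close>

text \<open>
  With \<open>u = |x|\<^sup>2 / (4\<tau>)\<close> the heat kernel is a constant times \<open>|x|\<^sup>-\<^sup>N u\<^sup>N\<^sup>/\<^sup>2 e\<^sup>-\<^sup>u\<close>, and
  \<open>u\<^sup>N\<^sup>/\<^sup>2 \<le> (1 + u)\<^sup>N \<le> N\<^sup>N e\<^sup>1\<^sup>+\<^sup>u\<close>.  For \<open>x \<noteq> 0\<close> it is thus bounded in \<open>\<tau>\<close>.
\<close>
lemma gauss_le:
  fixes x :: "'a::euclidean_space"
  assumes \<tau>: "0 < \<tau>" and x: "x \<noteq> 0"
  shows "gauss \<tau> x \<le> real DIM('a) ^ DIM('a) * exp 1 / (sqrt pi * norm x) ^ DIM('a)"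
proof -
  define N where "N = DIM('a)"
  define u where "u = (norm x)\<^sup>2 / (4 * \<tau>)"
  have N: "0 < N" by (simp add: N_def)
  have u: "u > 0" using \<tau> x by (simp add: u_def)
  have "(norm x)\<^sup>2 = u * (4 * \<tau>)" using \<tau> by (simp add: u_def)
  then have "norm x = sqrt u * sqrt (4 * \<tau>)"
    by (metis norm_ge_zero real_sqrt_abs abs_of_nonneg real_sqrt_mult)
  then have "sqrt u / (sqrt pi * norm x) = 1 / sqrt (4 * pi * \<tau>)"
    using u \<tau> by (simp add: real_sqrt_mult)
  then have eq: "gauss \<tau> x = exp (- u) * (sqrt u / (sqrt pi * norm x)) ^ N"
    by (simp add: gauss_def u_def N_def power_divide)
  have "sqrt u \<le> sqrt ((1 + u)\<^sup>2)"
    using u by (intro real_sqrt_le_mono) (simp add: power2_eq_square algebra_simps)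
  then have 1: "sqrt u \<le> 1 + u" using u by simp
  have "(1 + u) / real N \<le> exp ((1 + u) / real N)"
    using exp_ge_add_one_self [of "(1 + u) / real N"] by linarith
  then have "((1 + u) / real N) ^ N \<le> exp ((1 + u) / real N) ^ N"
    using u by (intro power_mono) auto
  also have "\<dots> = exp (1 + u)" using N by (simp add: exp_of_nat_mult [symmetric])
  finally have 2: "(1 + u) ^ N \<le> real N ^ N * exp (1 + u)"
    using N by (simp add: power_divide field_simps)
  have "exp (- u) * sqrt u ^ N \<le> exp (- u) * (real N ^ N * exp (1 + u))"
    using 1 2 u power_mono [OF 1, of N] by (intro mult_left_mono) auto
  also have "\<dots> = real N ^ N * exp 1" by (simp add: exp_add exp_minus)
  finally have "exp (- u) * sqrt u ^ N / (sqrt pi * norm x) ^ N \<le> real N ^ N * exp 1 / (sqrt pi * norm x) ^ N"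
    by (intro divide_right_mono) auto
  then show ?thesis by (simp add: eq power_divide N_def)
qed

lemma integrable_powr_near_zero:
  assumes "0 < (p::real)"
  shows "integrable lborel (\<lambda>\<tau>. indicator {0<..1} \<tau> * \<tau> powr (p - 1))"
proof -
  have "integrable lborel (\<lambda>\<tau>. indicator {0<..<1} \<tau> * ((1 - \<tau>) powr (1 - 1) * \<tau> powr (p - 1)))"
    by (rule integrable.intros [OF has_bochner_integral_beta]) (use assms in auto)
  then show ?thesis
  proof (rule integrable_cong_AE_imp)
    show "AE \<tau> in lborel. indicator {0<..<1} \<tau> * ((1 - \<tau>) powr (1 - 1) * \<tau> powr (p - 1)) = indicator {0<..1} \<tau> * \<tau> powr (p - 1)"
      using AE_lborel_singleton [of 1] by eventually_elim (auto simp: indicator_def)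
  qed auto
qed

lemma integrable_powr_near_infinity:
  assumes "0 < (p::real)"
  shows "integrable lborel (\<lambda>\<tau>. indicator {1<..} \<tau> * \<tau> powr (- p - 1))"
proof -
  have "((\<lambda>\<tau>. \<tau> powr (- p - 1)) has_integral - (1 powr (- p - 1 + 1)) / (- p - 1 + 1)) {1..}"
    using assms by (intro has_integral_powr_to_inf) auto
  then have "((\<lambda>\<tau>. indicator {1..} \<tau> * \<tau> powr (- p - 1)) has_integral (1 / p)) UNIV"
  proof -
    have "(\<lambda>\<tau>. indicator {1..} \<tau> * \<tau> powr (- p - 1)) = (\<lambda>\<tau>. if \<tau> \<in> {1..} then \<tau> powr (- p - 1) else 0)"
      by (auto simp: fun_eq_iff indicator_def)
    moreover have "- (1 powr (- p - 1 + 1)) / (- p - 1 + 1) = 1 / p" by simp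
    ultimately show ?thesis
      using \<open>(_ has_integral _) {1..}\<close> by (simp only: has_integral_restrict_UNIV)
  qed
  then have "(\<integral>\<^sup>+\<tau>. ennreal (indicator {1..} \<tau> * \<tau> powr (- p - 1)) \<partial>lborel) = ennreal (1 / p)"
    by (intro nn_integral_has_integral_lborel) auto
  then have "integrable lborel (\<lambda>\<tau>. indicator {1..} \<tau> * \<tau> powr (- p - 1))"
    by (intro integrableI_nonneg) auto
  then show ?thesis
    by (rule Bochner_Integration.integrable_bound) (auto simp: indicator_def)
qed

context subdiffusion_kernel
begin

text \<open>
  The inverse Laplace transform of \<open>1 / (z\<^sup>\<alpha> + L)\<close>.
\<close>
definition inv_laplace where "inv_laplace L t = strip_integral \<theta> (\<lambda>w. laplace_factor t w / (exp (of_real \<alpha> * w) + of_real L))"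

lemma inv_laplace_measurable [measurable]: "inv_laplace L \<in> borel_measurable borel"
  unfolding inv_laplace_def strip_integral_jump by measurable

text \<open>
  As for the other variable, now with Cauchy's formula in \<open>z\<close>.
\<close>
lemma laplace_inv_laplace:
  assumes L: "0 < L" and s: "0 < s"
  shows "has_bochner_integral lborel (\<lambda>t. indicator {0<..} t *\<^sub>R (exp (- s * t) *\<^sub>R inv_laplace L t)) (1 / of_real (s powr \<alpha> + L))"
proof -
  \<comment> \<open>Writing \<open>L = \<nu>\<^sup>\<beta>\<close> with \<open>\<nu> > 0\<close> makes the bounds on \<open>1 / (z\<^sup>\<alpha> + \<nu>\<^sup>\<beta>)\<close> available.\<close>
  define v where "v = complex_of_real (ln L / \<beta>)"
  have v: "Im v = 0" "exp (of_real \<beta> * v) = of_real L" "exp (\<beta> * Re v) = L"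
  proof -
    have "of_real \<beta> * v = of_real (ln L)" using \<beta> by (simp add: v_def)
    then show "exp (of_real \<beta> * v) = of_real L" using L by (simp only: exp_of_real exp_ln)
  qed (use L \<beta> in \<open>auto simp: v_def\<close>)
  define \<Phi> :: "complex \<Rightarrow> complex" where "\<Phi> = (\<lambda>w. 1 / (exp (of_real \<alpha> * w) + of_real L))"
  have \<Phi>le: "norm (\<Phi> w) \<le> exp (- (\<alpha> * Re w)) / aperture" "norm (\<Phi> w) \<le> 1 / (L * aperture)" if "\<bar>Im w\<bar> \<le> \<theta>" for w
    using norm_inverse_denominator_le [OF that, of v 0] norm_inverse_denominator_le [OF that, of v 1] v \<theta>_pos
    by (auto simp: \<Phi>_def exp_minus divide_simps)
  define H where "H = (\<lambda>t x. indicator {0<..} t *\<^sub>R (exp (- s * t) *\<^sub>R jump (\<lambda>w. laplace_factor t w * \<Phi> w) x))"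
  have [measurable]: "(\<lambda>z. H (fst z) (snd z)) \<in> borel_measurable (lborel \<Otimes>\<^sub>M lborel)"
    unfolding H_def \<Phi>_def by measurable
  have jle: "norm (jump (\<lambda>w. laplace_factor t w * \<Phi> w) x) \<le> exp (- (decay * t) * exp x) * exp ((1 - \<alpha>) * x) / aperture" for t x
  proof (rule norm_jump_le)
    fix y assume y: "\<bar>y\<bar> = \<theta>"
    have "norm (laplace_factor t (Complex x y) * \<Phi> (Complex x y)) \<le> (exp (- (decay * t) * exp x) * exp x) * (exp (- (\<alpha> * x)) / aperture)"
      unfolding norm_mult norm_laplace_factor [OF y] using \<Phi>le(1) [of "Complex x y"] y by (intro mult_left_mono) auto
    then show "norm (laplace_factor t (Complex x y) * \<Phi> (Complex x y)) \<le> exp (- (decay * t) * exp x) * exp ((1 - \<alpha>) * x) / aperture"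
      by (simp add: algebra_simps exp_diff exp_minus divide_inverse)
  qed
  have bi: "has_bochner_integral lborel (\<lambda>x. exp (- (decay * t) * exp x) * exp ((1 - \<alpha>) * x) / aperture) (exp_exp_moment (1 - \<alpha>) * (decay * t) powr (- (1 - \<alpha>)) / aperture)" if "t > 0" for t
    using that decay_pos \<alpha> by (intro has_bochner_integral_divide_zero has_bochner_integral_exp_exp) auto
  have ji: "integrable lborel (\<lambda>x. jump (\<lambda>w. laplace_factor t w * \<Phi> w) x)" if t: "t > 0" for t
  proof (rule Bochner_Integration.integrable_bound [OF integrable.intros [OF bi [OF t]]])
    show "(\<lambda>x. jump (\<lambda>w. laplace_factor t w * \<Phi> w) x) \<in> borel_measurable lborel" unfolding \<Phi>_def by measurable
    show "AE x in lborel. norm (jump (\<lambda>w. laplace_factor t w * \<Phi> w) x) \<le> norm (exp (- (decay * t) * exp x) * exp ((1 - \<alpha>) * x) / aperture)"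
      using jle by (intro AE_I2) (metis abs_ge_self order_trans real_norm_def)
  qed
  have Hint: "integrable (lborel \<Otimes>\<^sub>M lborel) (\<lambda>(t, x). H t x)"
  proof (rule lborel_pair.Fubini_integrable)
    show "integrable lborel (\<lambda>t. LINT x|lborel. norm ((\<lambda>(t, x). H t x) (t, x)))"
    proof (rule Bochner_Integration.integrable_bound)
      show "integrable lborel (\<lambda>t. exp_exp_moment (1 - \<alpha>) * decay powr (\<alpha> - 1) / aperture * (indicator {0<..} t * (t powr (\<alpha> - 1) * exp (- s * t))))"
        using has_bochner_integral_powr_exp [OF \<alpha>(1) s] by (auto simp: has_bochner_integral_iff)
      show "AE t in lborel. norm (LINT x|lborel. norm ((\<lambda>(t, x). H t x) (t, x)))
         \<le> norm (exp_exp_moment (1 - \<alpha>) * decay powr (\<alpha> - 1) / aperture * (indicator {0<..} t * (t powr (\<alpha> - 1) * exp (- s * t))))"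
      proof (rule AE_I2)
        fix t :: real
        show "norm (LINT x|lborel. norm ((\<lambda>(t, x). H t x) (t, x)))
         \<le> norm (exp_exp_moment (1 - \<alpha>) * decay powr (\<alpha> - 1) / aperture * (indicator {0<..} t * (t powr (\<alpha> - 1) * exp (- s * t))))"
        proof (cases "t > 0")
          case True
          have "(LINT x|lborel. norm (H t x)) = exp (- s * t) * (LINT x|lborel. norm (jump (\<lambda>w. laplace_factor t w * \<Phi> w) x))"
            using True by (simp add: H_def)
          also have "\<dots> \<le> exp (- s * t) * (LINT x|lborel. exp (- (decay * t) * exp x) * exp ((1 - \<alpha>) * x) / aperture)"
            by (intro mult_left_mono integral_mono [OF integrable_norm [OF ji [OF True]] integrable.intros [OF bi [OF True]]])
               (use jle in auto)
          also have "\<dots> = exp_exp_moment (1 - \<alpha>) * decay powr (\<alpha> - 1) / aperture * (indicator {0<..} t * (t powr (\<alpha> - 1) * exp (- s * t)))"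
            using bi [OF True] True decay_pos by (simp add: has_bochner_integral_iff powr_mult)
          finally show ?thesis using True exp_exp_moment_nonneg [of "1 - \<alpha>"] aperture_pos by (simp add: abs_of_nonneg)
        qed (simp add: H_def)
      qed
    qed measurable
    show "AE t in lborel. integrable lborel (\<lambda>x. (\<lambda>(t, x). H t x) (t, x))"
      by (rule AE_I2) (use ji in \<open>auto simp: H_def indicator_def\<close>)
  qed measurable
  have inner: "(LINT t|lborel. H t x) = jump (\<lambda>w. \<Phi> w * exp w / (of_real s - exp w)) x" for x
  proof -
    have "has_bochner_integral lborel (\<lambda>t. jump (\<lambda>w. \<Phi> w * (indicator {0<..} t *\<^sub>R (exp (- s * t) *\<^sub>R laplace_factor t w))) x)
      (jump (\<lambda>w. \<Phi> w * (exp w / (of_real s - exp w))) x)"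
      by (intro has_bochner_integral_jump has_bochner_integral_mult_right laplace_factor_laplace s)
    moreover have "jump (\<lambda>w. \<Phi> w * (indicator {0<..} t *\<^sub>R (exp (- s * t) *\<^sub>R laplace_factor t w))) x = H t x" for t
    proof -
      have *: "\<Phi> w * (indicator {0<..} t *\<^sub>R (exp (- s * t) *\<^sub>R laplace_factor t w))
          = (indicator {0<..} t * of_real (exp (- s * t))) * (laplace_factor t w * \<Phi> w)" for w
        by (simp add: scaleR_conv_of_real of_real_indicator)
      show ?thesis
        unfolding H_def * jump_mult_left by (simp add: scaleR_conv_of_real of_real_indicator)
    qed
    ultimately show ?thesis by (simp add: has_bochner_integral_iff)
  qed
  have cauchy: "strip_integral \<theta> (\<lambda>w. \<Phi> w * exp w / (of_real s - exp w)) = 1 / of_real (s powr \<alpha> + L)"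
  proof -
    obtain \<theta>' where \<theta>': "\<theta> < \<theta>'" "\<theta>' < pi" using \<theta>(2) dense by blast
    have hol: "\<Phi> holomorphic_on {w. \<bar>Im w\<bar> < \<theta>'}"
    proof -
      have "exp (of_real \<alpha> * w) + exp (of_real \<beta> * v) \<noteq> 0" if w: "\<bar>Im w\<bar> < \<theta>'" for w
      proof (rule denominator_nonzero)
        have "\<alpha> * \<theta>' \<le> 1 * \<theta>'" using \<alpha> \<theta>_pos \<theta>' by (intro mult_right_mono) auto
        then show "\<bar>\<alpha> * Im w - \<beta> * Im v\<bar> < pi"
          using abs_argument_difference_le [of w \<theta>' v 0] w v(1) \<theta>' by simp
      qed
      then show ?thesis unfolding \<Phi>_def v(2) by (intro holomorphic_intros) auto
    qed
    define C where "C = max (1 / aperture) (1 / (L * aperture))"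
    have bounded: "norm (\<Phi> w) \<le> C" if w: "\<bar>Im w\<bar> \<le> \<theta>" for w
      using \<Phi>le(2) [OF w] by (simp add: C_def le_max_iff_disj)
    have decay: "norm (\<Phi> w) \<le> C * exp (- \<alpha> * Re w)" if w: "\<bar>Im w\<bar> \<le> \<theta>" for w
    proof -
      have "norm (\<Phi> w) \<le> 1 / aperture * exp (- \<alpha> * Re w)" using \<Phi>le(1) [OF w] by simp
      also have "\<dots> \<le> C * exp (- \<alpha> * Re w)" by (intro mult_right_mono) (auto simp: C_def)
      finally show ?thesis .
    qed
    have "exp (of_real \<alpha> * of_real (ln s)) = complex_of_real (s powr \<alpha>)"
      using s by (simp add: powr_def exp_of_real [symmetric] flip: of_real_mult)
    then show ?thesis
      using strip_cauchy_formula_decay(1) [OF \<theta>_pos \<theta>'(1) less_imp_le [OF \<theta>'(2)] hol bounded decay \<alpha>(1) less_imp_le [OF \<alpha>(2)] s]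
      by (simp add: \<Phi>_def)
  qed
  have iH: "integrable lborel (\<lambda>t. LINT x|lborel. H t x)"
    using lborel_pair.integrable_fst [OF Hint] .
  have "(LINT t|lborel. LINT x|lborel. H t x) = (LINT x|lborel. LINT t|lborel. H t x)"
    by (rule lborel_pair.Fubini_integral [OF Hint, symmetric])
  also have "\<dots> = 1 / of_real (s powr \<alpha> + L)"
    unfolding inner strip_integral_jump [symmetric] by (rule cauchy)
  finally have eq: "(LINT t|lborel. LINT x|lborel. H t x) = 1 / of_real (s powr \<alpha> + L)" .
  have "(LINT x|lborel. H t x) = indicator {0<..} t *\<^sub>R (exp (- s * t) *\<^sub>R inv_laplace L t)" for t
    by (simp add: H_def inv_laplace_def strip_integral_jump \<Phi>_def)
  then show ?thesis using eq iH by (simp add: has_bochner_integral_iff)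
qed

definition subordinator_re :: "real \<Rightarrow> real \<Rightarrow> real" where "subordinator_re t \<tau> = Re (subordinator t \<tau>)"

lemma subordinator_re_measurable [measurable (raw)]:
  assumes [measurable]: "f1 \<in> borel_measurable M" "f2 \<in> borel_measurable M"
  shows "(\<lambda>z. subordinator_re (f1 z) (f2 z)) \<in> borel_measurable M"
  unfolding subordinator_re_def by measurable

lemma abs_subordinator_re_le: "\<bar>subordinator_re t \<tau>\<bar> \<le> norm (subordinator t \<tau>)"
  unfolding subordinator_re_def by (rule abs_Re_le_cmod)

lemma laplace_subordinator_re:
  assumes "0 < t" "0 < \<mu>"
  shows "has_bochner_integral lborel (\<lambda>\<tau>. indicator {0<..} \<tau> * (exp (- \<mu> * \<tau>) * subordinator_re t \<tau>)) (Re (inv_laplace (\<mu> powr \<beta>) t))"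
  using has_bochner_integral_bounded_linear [OF bounded_linear_Re laplace_subordinator [OF assms]]
  by (simp add: inv_laplace_def subordinator_re_def mult.assoc)

text \<open>
  Both sides have the Laplace transform \<open>1 / (s\<^sup>\<alpha> + L)\<close> as soon as \<open>s\<^sup>\<alpha> > L\<close>.
\<close>
proposition inv_laplace_eq_mittag_leffler:
  assumes L: "0 < L"
  shows "AE t in lborel. 0 < t \<longrightarrow> Re (inv_laplace L t) = t powr (\<alpha> - 1) * mittag_leffler \<alpha> \<alpha> (- L * t powr \<alpha>)"
proof -
  \<comment> \<open>The transforms are compared at the points \<open>s + n\<close>, all of which satisfy \<open>(s + n)\<^sup>\<alpha> > L\<close>.\<close>
  define s where "s = (L + 1) powr (1 / \<alpha>)"
  have s: "0 < s" "s powr \<alpha> = L + 1" using L \<alpha> by (auto simp: s_def powr_powr)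
  define f where "f = (\<lambda>t. Re (inv_laplace L t) - t powr (\<alpha> - 1) * mittag_leffler \<alpha> \<alpha> (- L * t powr \<alpha>))"
  have *: "has_bochner_integral lborel (\<lambda>t. indicator {0<..} t * (exp (- (s + real n) * t) * f t)) 0" for n :: nat
  proof -
    have sn: "0 < s + real n" "L < (s + real n) powr \<alpha>"
    proof -
      show "0 < s + real n" using s by simp
      have "s powr \<alpha> \<le> (s + real n) powr \<alpha>" using s \<alpha> by (intro powr_mono2) auto
      then show "L < (s + real n) powr \<alpha>" using s by simp
    qed
    have 1: "has_bochner_integral lborel (\<lambda>t. indicator {0<..} t * (exp (- (s + real n) * t) * Re (inv_laplace L t))) (1 / ((s + real n) powr \<alpha> + L))"
      using has_bochner_integral_bounded_linear [OF bounded_linear_Re laplace_inv_laplace [OF L sn(1)]]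
      by (simp add: Re_divide_of_real mult.assoc flip: of_real_add)
    have 2: "has_bochner_integral lborel (\<lambda>t. indicator {0<..} t * (exp (- (s + real n) * t) * (t powr (\<alpha> - 1) * mittag_leffler \<alpha> \<alpha> (- L * t powr \<alpha>)))) (1 / ((s + real n) powr \<alpha> + L))"
      using \<alpha> L sn by (intro mittag_leffler_laplace) auto
    show ?thesis
      using has_bochner_integral_diff [OF 1 2] by (simp add: f_def right_diff_distrib)
  qed
  have "AE t in lborel. 0 < t \<longrightarrow> f t = 0"
    using * [of 0] * by (intro laplace_injective [of s]) (auto simp: has_bochner_integral_iff)
  then show ?thesis by (simp add: f_def)
qed

text \<open>
  Small and large \<open>\<tau>\<close> are estimated with different values of \<open>\<kappa>\<close>, which leads to two different powers
  of \<open>t\<close>.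
\<close>
definition two_powers :: "real \<Rightarrow> real \<Rightarrow> real \<Rightarrow> real" where "two_powers a1 a2 t = t powr (a1 - 1) + t powr (a2 - 1)"

text \<open>
  For \<open>\<tau> \<le> 1\<close> take \<open>\<kappa>\<close> with \<open>\<beta>\<kappa> > \<delta>\<close>, so that \<open>\<tau>\<close> raised to \<open>\<beta>\<kappa> - 1 - \<delta>\<close> is integrable at \<open>0\<close>; for
  \<open>\<tau> > 1\<close> take \<open>\<kappa> < 0\<close> so close to \<open>0\<close> that \<open>\<alpha>(1 - \<kappa>) < 1\<close>.  In both cases the exponent
  \<open>\<alpha>(1 - \<kappa>) - 1\<close> of \<open>t\<close> is larger than \<open>-1\<close>, which needs \<open>\<kappa> < 1\<close> and hence \<open>\<delta> < \<beta>\<close>.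
\<close>
proposition subordinator_weighted_bound:
  assumes \<delta>: "0 \<le> \<delta>" "\<delta> < \<beta>"
  obtains W a1 a2 where "integrable lborel W" "\<And>\<tau>. 0 \<le> W \<tau>" "0 < a1" "a1 < 1" "0 < a2" "a2 < 1"
    "\<And>t \<tau>. 0 < t \<Longrightarrow> 0 < \<tau> \<Longrightarrow> norm (subordinator t \<tau>) * \<tau> powr (- \<delta>) \<le> W \<tau> * two_powers a1 a2 t"
proof -
  obtain \<kappa>1 where \<kappa>1: "\<delta> / \<beta> < \<kappa>1" "\<kappa>1 < 1" using dense [of "\<delta> / \<beta>" 1] \<delta> \<beta> by auto
  have \<kappa>1': "0 \<le> \<kappa>1" "\<delta> < \<beta> * \<kappa>1"
  proof -
    have "0 \<le> \<delta> / \<beta>" using \<delta> \<beta> by simp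
    then show "0 \<le> \<kappa>1" using \<kappa>1 by linarith
    show "\<delta> < \<beta> * \<kappa>1" using \<kappa>1(1) \<beta> by (simp add: field_simps)
  qed
  obtain \<kappa>2 where \<kappa>2: "max (-1) (1 - 1 / \<alpha>) < \<kappa>2" "\<kappa>2 < 0"
  proof -
    have "max (-1) (1 - 1 / \<alpha>) < 0" using \<alpha> by simp
    then show ?thesis using that dense by blast
  qed
  have \<kappa>2': "\<alpha> * (1 - \<kappa>2) < 1" "-1 \<le> \<kappa>2"
  proof -
    have "1 - \<kappa>2 < 1 / \<alpha>" using \<kappa>2 by auto
    then show "\<alpha> * (1 - \<kappa>2) < 1" using \<alpha> by (simp add: field_simps)
  qed (use \<kappa>2 in auto)
  have \<alpha>\<kappa>1: "\<alpha> * (1 - \<kappa>1) < 1"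
  proof -
    have "\<alpha> * (1 - \<kappa>1) \<le> \<alpha> * 1" using \<kappa>1' \<alpha> by (intro mult_left_mono) auto
    then show ?thesis using \<alpha> by linarith
  qed
  define W where "W = (\<lambda>\<tau>. majorant_const \<kappa>1 * (indicator {0<..1} \<tau> * \<tau> powr ((\<beta> * \<kappa>1 - \<delta>) - 1))
     + majorant_const \<kappa>2 * (indicator {1<..} \<tau> * \<tau> powr (- (\<delta> - \<beta> * \<kappa>2) - 1)))"
  have "\<beta> * \<kappa>2 < 0" using \<beta> \<kappa>2 by (simp add: mult_pos_neg)
  show ?thesis
  proof (rule that [of W "\<alpha> * (1 - \<kappa>1)" "\<alpha> * (1 - \<kappa>2)"])
    show "integrable lborel W"
      unfolding W_def using \<kappa>1' \<delta> \<open>\<beta> * \<kappa>2 < 0\<close>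
      by (intro Bochner_Integration.integrable_add integrable_mult_right integrable_powr_near_zero integrable_powr_near_infinity) auto
    show "0 \<le> W \<tau>" for \<tau> unfolding W_def using majorant_const_nonneg by auto
    show "0 < \<alpha> * (1 - \<kappa>1)" "\<alpha> * (1 - \<kappa>1) < 1" "0 < \<alpha> * (1 - \<kappa>2)" "\<alpha> * (1 - \<kappa>2) < 1"
      using \<alpha> \<kappa>1 \<kappa>2 \<kappa>2' \<alpha>\<kappa>1 by auto
    fix t \<tau> :: real assume t: "0 < t" "0 < \<tau>"
    show "norm (subordinator t \<tau>) * \<tau> powr (- \<delta>) \<le> W \<tau> * two_powers (\<alpha> * (1 - \<kappa>1)) (\<alpha> * (1 - \<kappa>2)) t"
    proof (cases "\<tau> \<le> 1")
      case True
      have "norm (subordinator t \<tau>) * \<tau> powr (- \<delta>) \<le> majorant_const \<kappa>1 * t powr (\<alpha> * (1 - \<kappa>1) - 1) * \<tau> powr (\<beta> * \<kappa>1 - 1) * \<tau> powr (- \<delta>)"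
        using \<kappa>1 \<kappa>1' \<alpha>\<kappa>1 by (intro mult_right_mono norm_subordinator_le t) auto
      also have "\<dots> = W \<tau> * t powr (\<alpha> * (1 - \<kappa>1) - 1)"
        using True t by (simp add: W_def mult.assoc powr_add [symmetric]) (simp add: algebra_simps)
      also have "\<dots> \<le> W \<tau> * two_powers (\<alpha> * (1 - \<kappa>1)) (\<alpha> * (1 - \<kappa>2)) t"
        using \<open>0 \<le> W \<tau>\<close> by (intro mult_left_mono) (auto simp: two_powers_def)
      finally show ?thesis .
    next
      case False
      have "norm (subordinator t \<tau>) * \<tau> powr (- \<delta>) \<le> majorant_const \<kappa>2 * t powr (\<alpha> * (1 - \<kappa>2) - 1) * \<tau> powr (\<beta> * \<kappa>2 - 1) * \<tau> powr (- \<delta>)"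
        using \<kappa>2 \<kappa>2' by (intro mult_right_mono norm_subordinator_le t) auto
      also have "\<dots> = W \<tau> * t powr (\<alpha> * (1 - \<kappa>2) - 1)"
        using False t by (simp add: W_def mult.assoc powr_add [symmetric]) (simp add: algebra_simps)
      also have "\<dots> \<le> W \<tau> * two_powers (\<alpha> * (1 - \<kappa>1)) (\<alpha> * (1 - \<kappa>2)) t"
        using \<open>0 \<le> W \<tau>\<close> by (intro mult_left_mono) (auto simp: two_powers_def)
      finally show ?thesis .
    qed
  qed
qed

lemma two_powers_antimono:
  assumes "0 < s" "s \<le> t" "a1 < 1" "a2 < 1"
  shows "two_powers a1 a2 t \<le> two_powers a1 a2 s"
  unfolding two_powers_def using assms by (intro add_mono powr_mono2') auto

lemma subordinator_tendsto:
  assumes t: "0 < t" and \<tau>: "0 < \<tau>" and T: "T \<longlonglongrightarrow> t" and T2: "\<And>n. t / 2 \<le> T n"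
  shows "(\<lambda>n. subordinator (T n) \<tau>) \<longlonglongrightarrow> subordinator t \<tau>"
  unfolding subordinator_def
proof (rule integral_dominated_convergence)
  show "integrable lborel (\<lambda>p. majorant 0 (t / 2) \<tau> (fst p) (snd p))"
    using majorant_integral [of "t / 2" \<tau> 0] t \<tau> \<alpha> by (auto simp: has_bochner_integral_iff)
  show "AE p in lborel. (\<lambda>n. contour_kernel (T n) \<tau> (fst p) (snd p)) \<longlonglongrightarrow> contour_kernel t \<tau> (fst p) (snd p)"
  proof (rule AE_I2)
    fix p :: "real \<times> real"
    have ET: "(\<lambda>n. laplace_factor (T n) w) \<longlonglongrightarrow> laplace_factor t w" for w
      unfolding laplace_factor_def by (intro tendsto_mult tendsto_exp tendsto_of_real tendsto_const T)
    show "(\<lambda>n. contour_kernel (T n) \<tau> (fst p) (snd p)) \<longlonglongrightarrow> contour_kernel t \<tau> (fst p) (snd p)"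
      unfolding contour_kernel_def jump_def symbol_kernel_def divide_inverse
      by (intro tendsto_mult tendsto_diff tendsto_const ET)
  qed
  show "AE p in lborel. norm (contour_kernel (T n) \<tau> (fst p) (snd p)) \<le> majorant 0 (t / 2) \<tau> (fst p) (snd p)" for n
  proof (rule AE_I2)
    fix p :: "real \<times> real"
    have "exp (- (decay * T n) * exp (fst p)) \<le> exp (- (decay * (t / 2)) * exp (fst p))"
      using T2 [of n] decay_pos by simp
    then have "majorant 0 (T n) \<tau> (fst p) (snd p) \<le> majorant 0 (t / 2) \<tau> (fst p) (snd p)"
      unfolding majorant_def using aperture_pos by (intro divide_right_mono mult_right_mono) auto
    then show "norm (contour_kernel (T n) \<tau> (fst p) (snd p)) \<le> majorant 0 (t / 2) \<tau> (fst p) (snd p)"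
      using norm_contour_kernel_le [of 0 "T n" \<tau> "fst p" "snd p"] by simp
  qed
qed measurable

text \<open>
  The explicit candidate for \<open>Y\<close>.  Its Fourier transform in \<open>x\<close> is the Laplace transform of the
  density in \<open>\<tau>\<close> at \<open>|\<xi>|\<^sup>2\<close>.
\<close>
definition y_kernel :: "real \<Rightarrow> 'a::euclidean_space \<Rightarrow> real" where
  "y_kernel t x = (LINT \<tau>|lborel. indicator {0<..} \<tau> * (subordinator_re t \<tau> * gauss \<tau> x))"

lemma y_kernel_measurable [measurable (raw)]:
  fixes f2 :: "'b \<Rightarrow> 'a::euclidean_space"
  assumes [measurable]: "f1 \<in> borel_measurable M" "f2 \<in> borel_measurable M"
  shows "(\<lambda>z. y_kernel (f1 z) (f2 z)) \<in> borel_measurable M"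
  unfolding y_kernel_def by measurable

text \<open>
  Away from \<open>x = 0\<close> the heat kernel is bounded in \<open>\<tau>\<close>, so the bound on the density suffices.  It decreases
  in \<open>t\<close>, hence its value at \<open>t / 2\<close> dominates the integrand at all times near \<open>t\<close>, and continuity
  follows by dominated convergence.
\<close>
lemma y_kernel_bound_continuous:
  fixes x :: "'a::euclidean_space"
  assumes x: "x \<noteq> 0"
  obtains C a1 a2 where "0 < a1" "a1 < 1" "0 < a2" "a2 < 1"
    "\<And>t. 0 < t \<Longrightarrow> \<bar>y_kernel t x\<bar> \<le> C * two_powers a1 a2 t" "continuous_on {0<..} (\<lambda>t. y_kernel t x)"
proof -
  obtain W a1 a2 where W: "integrable lborel W" "\<And>\<tau>. 0 \<le> W \<tau>" and a: "0 < a1" "a1 < 1" "0 < a2" "a2 < 1"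
    and le: "\<And>t \<tau>. 0 < t \<Longrightarrow> 0 < \<tau> \<Longrightarrow> norm (subordinator t \<tau>) * \<tau> powr (- 0) \<le> W \<tau> * two_powers a1 a2 t"
    using subordinator_weighted_bound [of 0] \<beta> by auto
  define B where "B = real DIM('a) ^ DIM('a) * exp 1 / (sqrt pi * norm x) ^ DIM('a)"
  have B: "0 \<le> B" "\<And>\<tau>. 0 < \<tau> \<Longrightarrow> gauss \<tau> x \<le> B" using gauss_le [OF _ x] by (auto simp: B_def)
  have [measurable]: "W \<in> borel_measurable borel" using W by auto
  have bound: "norm (indicator {0<..} \<tau> * (subordinator_re t \<tau> * gauss \<tau> x)) \<le> W \<tau> * two_powers a1 a2 r * B" if "0 < r" "r \<le> t" for r t \<tau>
  proof (cases "\<tau> > 0")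
    case True
    have "\<bar>subordinator_re t \<tau>\<bar> \<le> W \<tau> * two_powers a1 a2 t"
      using le [of t \<tau>] abs_subordinator_re_le [of t \<tau>] that True by simp
    also have "\<dots> \<le> W \<tau> * two_powers a1 a2 r" using W a that by (intro mult_left_mono two_powers_antimono) auto
    finally show ?thesis using True B gauss_nonneg [OF True, of x]
      by (auto simp: abs_mult intro!: mult_mono)
  next
    case False
    have "0 \<le> two_powers a1 a2 r" by (simp add: two_powers_def)
    then show ?thesis using False W B by simp
  qed
  have Wi: "integrable lborel (\<lambda>\<tau>. W \<tau> * two_powers a1 a2 r * B)" for r using W by auto
  show ?thesis
  proof (rule that [OF a, of "(LINT \<tau>|lborel. W \<tau>) * B"])
    fix t :: real assume t: "0 < t"
    have "\<bar>y_kernel t x\<bar> \<le> (LINT \<tau>|lborel. W \<tau> * two_powers a1 a2 t * B)"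
      unfolding y_kernel_def real_norm_def [symmetric]
    proof (rule order_trans [OF integral_norm_bound integral_mono])
      show "integrable lborel (\<lambda>\<tau>. norm (indicator {0<..} \<tau> * (subordinator_re t \<tau> * gauss \<tau> x)))"
        by (intro integrable_norm Bochner_Integration.integrable_bound [OF Wi [of t]] AE_I2)
           (measurable, use bound [OF t order_refl] in \<open>metis abs_ge_self order_trans real_norm_def\<close>)
    qed (use Wi bound [OF t order_refl] in auto)
    then show "\<bar>y_kernel t x\<bar> \<le> (LINT \<tau>|lborel. W \<tau>) * B * two_powers a1 a2 t" by (simp add: mult_ac)
  next
    show "continuous_on {0<..} (\<lambda>t. y_kernel t x)"
    proof (rule continuous_at_imp_continuous_on, rule ballI)
      fix t :: real assume "t \<in> {0<..}"
      then have t: "0 < t" by simp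
      show "isCont (\<lambda>t. y_kernel t x) t"
        unfolding continuous_at_sequentially comp_def
      proof (intro allI impI)
        fix T0 :: "nat \<Rightarrow> real" assume T0: "T0 \<longlonglongrightarrow> t"
        then have "\<forall>\<^sub>F n in sequentially. t / 2 < T0 n" using t by (intro order_tendstoD) auto
        then obtain n0 where n0: "\<And>n. n \<ge> n0 \<Longrightarrow> t / 2 < T0 n" by (auto simp: eventually_sequentially)
        define T where "T = (\<lambda>n. T0 (n + n0))"
        have T: "T \<longlonglongrightarrow> t" "\<And>n. t / 2 \<le> T n"
          using T0 n0 by (auto simp: T_def LIMSEQ_ignore_initial_segment less_imp_le)
        have "(\<lambda>n. y_kernel (T n) x) \<longlonglongrightarrow> y_kernel t x"
          unfolding y_kernel_def
        proof (rule integral_dominated_convergence [where w = "\<lambda>\<tau>. W \<tau> * two_powers a1 a2 (t / 2) * B"])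
          show "AE \<tau> in lborel. (\<lambda>n. indicator {0<..} \<tau> * (subordinator_re (T n) \<tau> * gauss \<tau> x)) \<longlonglongrightarrow> indicator {0<..} \<tau> * (subordinator_re t \<tau> * gauss \<tau> x)"
          proof (rule AE_I2)
            fix \<tau> :: real
            show "(\<lambda>n. indicator {0<..} \<tau> * (subordinator_re (T n) \<tau> * gauss \<tau> x)) \<longlonglongrightarrow> indicator {0<..} \<tau> * (subordinator_re t \<tau> * gauss \<tau> x)"
              using subordinator_tendsto [OF t _ T, of \<tau>]
              by (cases "0 < \<tau>") (auto simp: subordinator_re_def intro!: tendsto_intros)
          qed
          show "AE \<tau> in lborel. norm (indicator {0<..} \<tau> * (subordinator_re (T n) \<tau> * gauss \<tau> x)) \<le> W \<tau> * two_powers a1 a2 (t / 2) * B" for n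
            using bound [of "t / 2" "T n"] t T by (intro AE_I2) auto
        qed (use Wi in auto)
        then show "(\<lambda>n. y_kernel (T0 n) x) \<longlonglongrightarrow> y_kernel t x"
          unfolding T_def by (rule LIMSEQ_offset)
      qed
    qed
  qed
qed

end

section \<open>Identification of the kernel Y\<close>

text \<open>
  By completeness of Lebesgue measure, statements about a function that is only almost everywhere
  equal to a Borel function carry over to that Borel function, for which product measures and
  Fubini's theorem are available.
\<close>
lemma lebesgue_AE_eq_borel:
  fixes f g :: "'a::euclidean_space \<Rightarrow> 'b::{banach,second_countable_topology}"
  assumes g: "g \<in> borel_measurable borel" and eq: "AE x in lborel. f x = g x"
  shows "f \<in> borel_measurable lebesgue"
    and "integrable lebesgue f \<longleftrightarrow> integrable lborel g"
    and "integral\<^sup>L lebesgue f = integral\<^sup>L lborel g"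
proof -
  have eq': "AE x in lebesgue. f x = g x" using eq by (rule AE_completion)
  have gl: "g \<in> borel_measurable lebesgue" using g by (intro measurable_completion) simp
  show fl: "f \<in> borel_measurable lebesgue"
  proof (rule measurableI)
    fix A :: "'b set" assume A: "A \<in> sets borel"
    show "f -` A \<inter> space lebesgue \<in> sets lebesgue"
    proof (rule completion.in_sets_AE [where A = "g -` A \<inter> space lebesgue"])
      show "AE x in lebesgue. (x \<in> g -` A \<inter> space lebesgue) \<longleftrightarrow> (x \<in> f -` A \<inter> space lebesgue)"
        using eq' by eventually_elim auto
    qed (use measurable_sets [OF gl A] in auto)
  qed auto
  show "integrable lebesgue f \<longleftrightarrow> integrable lborel g"
    using integrable_cong_AE [OF fl gl eq'] integrable_completion [of g lborel] g by simp
  show "integral\<^sup>L lebesgue f = integral\<^sup>L lborel g"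
    using integral_cong_AE [OF fl gl eq'] integral_completion [of g lborel] g by simp
qed

lemma lebesgue_borel_representative:
  fixes f :: "'a::euclidean_space \<Rightarrow> real"
  assumes "f \<in> borel_measurable lebesgue"
  obtains g where "g \<in> borel_measurable borel" "AE x in lborel. f x = g x"
  using completion_ex_borel_measurable_real [OF assms] by auto

lemma lebesgue_on_borel_representative:
  fixes f :: "'a::euclidean_space \<Rightarrow> real"
  assumes "f \<in> borel_measurable (lebesgue_on S)" and "S \<in> sets lebesgue"
  obtains g where "g \<in> borel_measurable borel" "AE x in lborel. x \<in> S \<longrightarrow> f x = g x"
proof -
  have "(\<lambda>x. if x \<in> S then f x else 0) \<in> borel_measurable lebesgue"
    using assms by (simp add: borel_measurable_if)
  from lebesgue_borel_representative [OF this]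
  obtain g where "g \<in> borel_measurable borel" "AE x in lborel. (if x \<in> S then f x else 0) = g x" .
  moreover from this have "AE x in lborel. x \<in> S \<longrightarrow> f x = g x" by (auto elim!: eventually_mono)
  ultimately show ?thesis using that by blast
qed

lemma lborel_AE_pair:
  fixes P :: "'a::euclidean_space \<times> 'b::euclidean_space \<Rightarrow> bool"
  assumes "AE z in lborel. P z"
  shows "AE x in lborel. AE y in lborel. P (x, y)" "AE y in lborel. AE x in lborel. P (x, y)"
proof -
  have P: "AE z in (lborel \<Otimes>\<^sub>M lborel). P z" using assms unfolding lborel_prod .
  show "AE x in lborel. AE y in lborel. P (x, y)" by (rule lborel_pair.AE_pair [OF P])
  obtain N where N: "N \<in> null_sets (lborel \<Otimes>\<^sub>M lborel)" "{z. \<not> P z} \<subseteq> N"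
    using P by (auto simp: eventually_ae_filter space_pair_measure)
  then have [measurable]: "N \<in> sets (lborel \<Otimes>\<^sub>M lborel)" by auto
  have "AE z in (lborel \<Otimes>\<^sub>M lborel). z \<notin> N" using N(1) by (rule AE_not_in)
  then have "AE x in lborel. AE y in lborel. (x, y) \<notin> N" by (rule lborel_pair.AE_pair)
  then have "AE y in lborel. AE x in lborel. (x, y) \<notin> N"
  proof (subst (asm) lborel_pair.AE_commute)
    show "{z \<in> space (lborel \<Otimes>\<^sub>M lborel). (fst z, snd z) \<notin> N} \<in> sets (lborel \<Otimes>\<^sub>M lborel)" by measurable
  qed
  then show "AE y in lborel. AE x in lborel. P (x, y)"
  proof eventually_elim
    case (elim y)
    then show ?case by eventually_elim (use N(2) in auto)
  qed
qed

lemma lborel_AE_pairI: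
  fixes P :: "'a::euclidean_space \<times> 'b::euclidean_space \<Rightarrow> bool"
  assumes P: "{z. P z} \<in> sets borel"
    and ae: "(AE x in lborel. AE y in lborel. P (x, y)) \<or> (AE y in lborel. AE x in lborel. P (x, y))"
  shows "AE z in lborel. P z"
proof -
  have P': "{z \<in> space (lborel \<Otimes>\<^sub>M lborel). P z} \<in> sets (lborel \<Otimes>\<^sub>M (lborel :: 'b measure))"
    using P unfolding lborel_prod by simp
  have "(AE x in lborel. AE y in lborel. P (x, y))"
    using ae lborel_pair.AE_commute [of "\<lambda>x y. P (x, y)"] P' by auto
  from lborel_pair.AE_pair_measure [OF P' this] show ?thesis unfolding lborel_prod .
qed

text \<open>
  The frequency \<open>0\<close> may be left out because it is a null set.
\<close>
lemma fourier_injective_lebesgue: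
  fixes f g :: "'a::euclidean_space \<Rightarrow> real"
  assumes f: "integrable lebesgue f" and g: "integrable lborel g"
    and eq: "\<And>\<xi>. \<xi> \<noteq> 0 \<Longrightarrow> fourier f \<xi> = (LINT x|lborel. cis (- (x \<bullet> \<xi>)) * complex_of_real (g x))"
  shows "AE x in lborel. f x = g x"
proof -
  obtain f' where f': "f' \<in> borel_measurable borel" "AE x in lborel. f x = f' x"
    using lebesgue_borel_representative [OF borel_measurable_integrable [OF f]] .
  note [measurable] = f'(1)
  have [measurable]: "g \<in> borel_measurable borel" using g by auto
  have f'i: "integrable lborel f'" using lebesgue_AE_eq_borel(2) [OF f'] f by simp
  have ff: "fourier f \<xi> = (LINT x|lborel. cis (- (x \<bullet> \<xi>)) * complex_of_real (f' x))" for \<xi>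
    unfolding fourier_def by (rule lebesgue_AE_eq_borel(3)) (measurable, use f'(2) in eventually_elim, simp)
  have ci: "integrable lborel (\<lambda>x. cis (- (x \<bullet> \<xi>)) * complex_of_real (u x))" if "integrable lborel u" for u \<xi>
  proof -
    have [measurable]: "u \<in> borel_measurable borel" using that by auto
    show ?thesis by (rule Bochner_Integration.integrable_bound [OF that]) (auto simp: norm_mult)
  qed
  have "AE x in lborel. f' x - g x = 0"
  proof (rule fourier_injective)
    show "integrable lborel (\<lambda>x. f' x - g x)" using f'i g by auto
    show "AE \<xi> in lborel. (LINT x|lborel. cis (- (x \<bullet> \<xi>)) * complex_of_real (f' x - g x)) = 0"
      using AE_lborel_singleton [of 0]
    proof eventually_elim
      case (elim \<xi>)
      then show ?case
        using eq [OF elim] ff [of \<xi>] ci [OF f'i, of \<xi>] ci [OF g, of \<xi>]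
        by (simp add: right_diff_distrib)
    qed
  qed
  then show ?thesis using f'(2) by eventually_elim simp
qed

lemma has_bochner_integral_beta_shift:
  assumes a: "0 < a" and b: "0 < b" and t: "\<sigma> < (t::real)"
  shows "has_bochner_integral lborel (\<lambda>s. indicator {\<sigma><..<t} s * ((t - s) powr (a - 1) * (s - \<sigma>) powr (b - 1)))
    ((t - \<sigma>) powr (a + b - 1) * Beta a b)"
proof -
  have "has_bochner_integral lborel (\<lambda>s. indicator {0<..<t - \<sigma>} (- \<sigma> + 1 * s) * ((t - \<sigma> - (- \<sigma> + 1 * s)) powr (a - 1) * (- \<sigma> + 1 * s) powr (b - 1)))
    (((t - \<sigma>) powr (a + b - 1) * Beta a b) /\<^sub>R \<bar>1\<bar>)"
    using has_bochner_integral_beta [OF a b, of "t - \<sigma>"] t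
    by (subst lborel_has_bochner_integral_real_affine_iff [of 1 _ _ "- \<sigma>", symmetric]) auto
  moreover have "indicator {0<..<t - \<sigma>} (- \<sigma> + 1 * s) * ((t - \<sigma> - (- \<sigma> + 1 * s)) powr (a - 1) * (- \<sigma> + 1 * s) powr (b - 1))
    = indicator {\<sigma><..<t} s * ((t - s) powr (a - 1) * (s - \<sigma>) powr (b - 1))" for s
    by (auto simp: indicator_def)
  moreover have "((t - \<sigma>) powr (a + b - 1) * Beta a b) /\<^sub>R \<bar>1\<bar> = (t - \<sigma>) powr (a + b - 1) * Beta a b" by simp
  ultimately show ?thesis by (simp only:)
qed

context subdiffusion_kernel
begin

lemma two_powers_fractional_integrable:
  assumes t: "0 < t" and a: "0 < a1" "0 < a2" and b: "0 < b"
  shows "integrable lborel (\<lambda>s. indicator {0<..<t} s * ((t - s) powr (b - 1) * two_powers a1 a2 s))"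
proof -
  have "integrable lborel (\<lambda>s. indicator {0<..<t} s * ((t - s) powr (b - 1) * s powr (a1 - 1))
      + indicator {0<..<t} s * ((t - s) powr (b - 1) * s powr (a2 - 1)))"
    using has_bochner_integral_beta [OF b a(1) t] has_bochner_integral_beta [OF b a(2) t]
    by (auto simp: has_bochner_integral_iff)
  then show ?thesis by (simp add: two_powers_def distrib_left)
qed

text \<open>
  As \<open>Y\<close> is the Riemann-Liouville derivative of order \<open>1 - \<alpha>\<close> of \<open>Z\<close>, the candidate for \<open>Z\<close> is the
  fractional integral of order \<open>1 - \<alpha>\<close> of the candidate for \<open>Y\<close>.
\<close>
definition z_kernel :: "real \<Rightarrow> 'a::euclidean_space \<Rightarrow> real" where
  "z_kernel t x = (LINT s|lborel. indicator {0<..<t} s * ((t - s) powr (- \<alpha>) * y_kernel s x)) / Gamma (1 - \<alpha>)"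

lemma Gamma_pos: "0 < Gamma \<alpha>" "0 < Gamma (1 - \<alpha>)"
  using \<alpha> by (auto intro: Gamma_real_pos)

lemma indicator_Ioo_measurable [measurable (raw)]:
  assumes [measurable]: "f1 \<in> borel_measurable M" "f2 \<in> borel_measurable M" "f3 \<in> borel_measurable M"
  shows "(\<lambda>z. indicator {f1 z<..<f2 z} (f3 z :: real) :: real) \<in> borel_measurable M"
proof -
  have "(\<lambda>z. indicator {f1 z<..<f2 z} (f3 z :: real) :: real) = (\<lambda>z. if f1 z < f3 z \<and> f3 z < f2 z then 1 else 0)"
    by (auto simp: indicator_def fun_eq_iff)
  then show ?thesis by simp
qed

lemma z_kernel_measurable [measurable (raw)]:
  fixes f2 :: "'b \<Rightarrow> 'a::euclidean_space"
  assumes [measurable]: "f1 \<in> borel_measurable M" "f2 \<in> borel_measurable M"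
  shows "(\<lambda>z. z_kernel (f1 z) (f2 z)) \<in> borel_measurable M"
  unfolding z_kernel_def by measurable

text \<open>
  The fractional integral and the superposition of heat kernels form one integral over \<open>(s, \<tau>)\<close>,
  which converges absolutely by the bound on the density.  Exchanging it with the Fourier integral
  leaves the fractional integral of a Mittag-Leffler function.
\<close>
proposition z_kernel_fourier:
  assumes t: "0 < t"
  shows "integrable lborel (z_kernel t :: 'a::euclidean_space \<Rightarrow> real)"
    and "\<xi> \<noteq> 0 \<Longrightarrow> (LINT x|lborel. cis (- (x \<bullet> \<xi>)) * complex_of_real (z_kernel t (x :: 'a)))
      = complex_of_real (mittag_leffler \<alpha> 1 (- (norm \<xi> powr (2 * \<beta>)) * t powr \<alpha>))"
proof -
  obtain W a1 a2 where W: "integrable lborel W" "\<And>\<tau>. 0 \<le> W \<tau>" and a: "0 < a1" "a1 < 1" "0 < a2" "a2 < 1"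
    and le: "\<And>t \<tau>. 0 < t \<Longrightarrow> 0 < \<tau> \<Longrightarrow> norm (subordinator t \<tau>) * \<tau> powr (- 0) \<le> W \<tau> * two_powers a1 a2 t"
    using subordinator_weighted_bound [of 0] \<beta> by auto
  have [measurable]: "W \<in> borel_measurable borel" using W by auto
  \<comment> \<open>The weight of the heat kernel at time \<open>\<tau>\<close> for \<open>p = (s, \<tau>)\<close>, and an integrable bound \<open>D\<close> for it.\<close>
  define A where "A = (\<lambda>p. indicator {0<..<t} (fst p) * (t - fst p) powr (- \<alpha>) * (indicator {0<..} (snd p) * subordinator_re (fst p) (snd p)))"
  have [measurable]: "A \<in> borel_measurable borel" unfolding A_def by measurable
  define D where "D = (\<lambda>p. (indicator {0<..<t} (fst p) * ((t - fst p) powr ((1 - \<alpha>) - 1) * two_powers a1 a2 (fst p))) * W (snd p))"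
  have Di: "integrable lborel D"
    unfolding D_def by (rule integrable.intros [OF lborel_prod_mult [OF two_powers_fractional_integrable [OF t a(1,3)] W(1)]]) (use \<alpha> in auto)
  have AD: "\<bar>A p\<bar> \<le> D p" for p
  proof (cases "0 < fst p \<and> fst p < t \<and> 0 < snd p")
    case True
    then have "\<bar>subordinator_re (fst p) (snd p)\<bar> \<le> W (snd p) * two_powers a1 a2 (fst p)"
      using le [of "fst p" "snd p"] abs_subordinator_re_le [of "fst p" "snd p"] by simp
    then have "(t - fst p) powr (- \<alpha>) * \<bar>subordinator_re (fst p) (snd p)\<bar> \<le> (t - fst p) powr (- \<alpha>) * (W (snd p) * two_powers a1 a2 (fst p))"
      by (intro mult_left_mono) auto
    then show ?thesis using True by (simp add: A_def D_def abs_mult mult_ac)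
  next
    case False
    have "0 \<le> D p" using W by (simp add: D_def two_powers_def)
    then show ?thesis using False by (auto simp: A_def indicator_def)
  qed
  have Ai: "integrable lborel A"
    by (rule Bochner_Integration.integrable_bound [OF Di]) (use AD in \<open>auto intro!: AE_I2 order_trans [OF _ abs_ge_self]\<close>)
  have z_kernel_eq: "z_kernel t x = (LINT p|lborel. A p * gauss (snd p) x) / Gamma (1 - \<alpha>)" if x: "x \<noteq> 0" for x :: 'a
  proof -
    define B where "B = real DIM('a) ^ DIM('a) * exp 1 / (sqrt pi * norm x) ^ DIM('a)"
    have B: "0 \<le> B" "\<And>\<tau>. 0 < \<tau> \<Longrightarrow> gauss \<tau> x \<le> B" using gauss_le [OF _ x] by (auto simp: B_def)
    have "integrable lborel (\<lambda>p. A p * gauss (snd p) x)"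
    proof (rule Bochner_Integration.integrable_bound)
      show "integrable lborel (\<lambda>p. D p * B)" using Di by auto
      show "AE p in lborel. norm (A p * gauss (snd p) x) \<le> norm (D p * B)"
      proof (rule AE_I2)
        fix p :: "real \<times> real"
        show "norm (A p * gauss (snd p) x) \<le> norm (D p * B)"
        proof (cases "0 < snd p")
          case True
          then show ?thesis using AD [of p] B gauss_nonneg [OF True, of x]
            by (auto simp: abs_mult intro!: mult_mono order_trans [OF AD abs_ge_self])
        qed (simp add: A_def)
      qed
    qed auto
    then have "integrable (lborel \<Otimes>\<^sub>M lborel) (\<lambda>p. A p * gauss (snd p) x)" by (simp add: lborel_prod)
    from lborel_pair.integral_fst' [OF this]
    have "(LINT p|lborel. A p * gauss (snd p) x) = (LINT s|lborel. LINT \<tau>|lborel. A (s, \<tau>) * gauss \<tau> x)"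
      by (simp add: lborel_prod)
    also have "\<dots> = (LINT s|lborel. indicator {0<..<t} s * ((t - s) powr (- \<alpha>) * y_kernel s x))"
    proof (rule Bochner_Integration.integral_cong)
      fix s :: real
      have "A (s, \<tau>) * gauss \<tau> x = (indicator {0<..<t} s * (t - s) powr (- \<alpha>)) * (indicator {0<..} \<tau> * (subordinator_re s \<tau> * gauss \<tau> x))" for \<tau>
        by (simp add: A_def)
      then show "(LINT \<tau>|lborel. A (s, \<tau>) * gauss \<tau> x) = indicator {0<..<t} s * ((t - s) powr (- \<alpha>) * y_kernel s x)"
        by (simp only: integral_mult_right_zero y_kernel_def mult.assoc)
    qed simp
    finally show ?thesis by (simp add: z_kernel_def)
  qed
  have AE0: "AE x in lborel. x \<noteq> (0::'a)" by (rule AE_lborel_singleton)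
  have Fi: "integrable (lborel \<Otimes>\<^sub>M lborel) (\<lambda>(p, x::'a). A p * gauss (snd p) x)"
  proof (rule lborel_pair.Fubini_integrable)
    have "(LINT x|lborel. norm ((\<lambda>(p, x::'a). A p * gauss (snd p) x) (p, x))) = \<bar>A p\<bar>" for p
    proof (cases "0 < snd p")
      case True
      have "(LINT x|lborel. gauss (snd p) (x::'a)) = 1"
        using integral_eq_nn_integral [of "gauss (snd p) :: 'a \<Rightarrow> real" lborel] gauss_nn_integral [OF True, where 'a = 'a] gauss_nonneg [OF True]
        by auto
      moreover have "\<bar>gauss (snd p) x\<bar> = gauss (snd p) x" for x :: 'a using gauss_nonneg [OF True, of x] by simp
      ultimately show ?thesis by (simp add: abs_mult)
    qed (simp add: A_def)
    then show "integrable lborel (\<lambda>p. LINT x|lborel. norm ((\<lambda>(p, x::'a). A p * gauss (snd p) x) (p, x)))"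
      using Ai by simp
    show "AE p in lborel. integrable lborel (\<lambda>x. (\<lambda>(p, x::'a). A p * gauss (snd p) x) (p, x))"
    proof (rule AE_I2)
      fix p :: "real \<times> real"
      show "integrable lborel (\<lambda>x. (\<lambda>(p, x::'a). A p * gauss (snd p) x) (p, x))"
        using gauss_integrable [of "snd p", where 'a = 'a] by (cases "0 < snd p") (auto simp: A_def)
    qed
  qed measurable
  have "integrable lborel (\<lambda>x::'a. (LINT p|lborel. A p * gauss (snd p) x) / Gamma (1 - \<alpha>))"
    using lborel_pair.integrable_snd [OF Fi] by auto
  then show "integrable lborel (z_kernel t :: 'a \<Rightarrow> real)"
    by (rule integrable_cong_AE_imp) (use AE0 in \<open>auto simp: z_kernel_eq elim!: eventually_mono\<close>)
  assume \<xi>: "\<xi> \<noteq> 0"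
  define L where "L = norm \<xi> powr (2 * \<beta>)"
  have L: "L > 0" "((norm \<xi>)\<^sup>2) powr \<beta> = L" using \<xi> by (auto simp: L_def powr_powr simp flip: powr_numeral)
  have Fc: "integrable (lborel \<Otimes>\<^sub>M lborel) (\<lambda>(p, x::'a). complex_of_real (A p) * (cis (- (x \<bullet> \<xi>)) * complex_of_real (gauss (snd p) x)))"
    by (rule Bochner_Integration.integrable_bound [OF Fi]) (auto simp: norm_mult split_beta)
  have "(LINT x|lborel. cis (- (x \<bullet> \<xi>)) * complex_of_real (z_kernel t (x :: 'a)))
     = (LINT x|lborel. (LINT p|lborel. complex_of_real (A p) * (cis (- (x \<bullet> \<xi>)) * complex_of_real (gauss (snd p) x))) / complex_of_real (Gamma (1 - \<alpha>)))"
  proof (rule integral_cong_AE)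
    show "AE x in lborel. cis (- (x \<bullet> \<xi>)) * complex_of_real (z_kernel t (x :: 'a))
      = (LINT p|lborel. complex_of_real (A p) * (cis (- (x \<bullet> \<xi>)) * complex_of_real (gauss (snd p) x))) / complex_of_real (Gamma (1 - \<alpha>))"
      using AE0
    proof eventually_elim
      case (elim x)
      have "(LINT p|lborel. complex_of_real (A p) * (cis (- (x \<bullet> \<xi>)) * complex_of_real (gauss (snd p) x)))
        = (LINT p|lborel. cis (- (x \<bullet> \<xi>)) * complex_of_real (A p * gauss (snd p) x))"
        by (simp add: mult_ac)
      also have "\<dots> = cis (- (x \<bullet> \<xi>)) * complex_of_real (LINT p|lborel. A p * gauss (snd p) x)"
        by (simp only: integral_mult_right_zero integral_complex_of_real)
      finally show ?case by (simp add: z_kernel_eq [OF elim])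
    qed
  qed auto
  also have "\<dots> = (LINT x|lborel. (LINT p|lborel. complex_of_real (A p) * (cis (- (x \<bullet> \<xi>)) * complex_of_real (gauss (snd p) (x::'a))))) / complex_of_real (Gamma (1 - \<alpha>))"
    by simp
  also have "(LINT x|lborel. (LINT p|lborel. complex_of_real (A p) * (cis (- (x \<bullet> \<xi>)) * complex_of_real (gauss (snd p) (x::'a)))))
     = (LINT p|lborel. (LINT x|lborel. complex_of_real (A p) * (cis (- (x \<bullet> \<xi>)) * complex_of_real (gauss (snd p) (x::'a)))))"
    by (rule lborel_pair.Fubini_integral [OF Fc])
  also have "\<dots> = (LINT p|lborel. complex_of_real (A p * exp (- (norm \<xi>)\<^sup>2 * snd p)))"
  proof (rule Bochner_Integration.integral_cong)
    fix p :: "real \<times> real"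
    show "(LINT x|lborel. complex_of_real (A p) * (cis (- (x \<bullet> \<xi>)) * complex_of_real (gauss (snd p) (x::'a)))) = complex_of_real (A p * exp (- (norm \<xi>)\<^sup>2 * snd p))"
    proof (cases "0 < snd p")
      case True
      then show ?thesis by (simp add: gauss_fourier [OF True] mult.commute)
    next
      case False
      then have "A p = 0" by (simp add: A_def)
      then show ?thesis by simp
    qed
  qed simp
  also have "\<dots> = complex_of_real (LINT p|lborel. A p * exp (- (norm \<xi>)\<^sup>2 * snd p))"
    by (rule integral_complex_of_real)
  also have "(LINT p|lborel. A p * exp (- (norm \<xi>)\<^sup>2 * snd p)) = Gamma (1 - \<alpha>) * mittag_leffler \<alpha> 1 (- L * t powr \<alpha>)"
  proof -
    have "integrable lborel (\<lambda>p. A p * exp (- (norm \<xi>)\<^sup>2 * snd p))"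
    proof (rule Bochner_Integration.integrable_bound [OF Ai])
      show "AE p in lborel. norm (A p * exp (- (norm \<xi>)\<^sup>2 * snd p)) \<le> norm (A p)"
      proof (rule AE_I2)
        fix p :: "real \<times> real"
        show "norm (A p * exp (- (norm \<xi>)\<^sup>2 * snd p)) \<le> norm (A p)"
          by (cases "0 < snd p") (auto simp: abs_mult A_def intro!: mult_left_le mult_nonneg_nonneg)
      qed
    qed auto
    then have "integrable (lborel \<Otimes>\<^sub>M lborel) (\<lambda>p. A p * exp (- (norm \<xi>)\<^sup>2 * snd p))" by (simp add: lborel_prod)
    from lborel_pair.integral_fst' [OF this]
    have "(LINT p|lborel. A p * exp (- (norm \<xi>)\<^sup>2 * snd p)) = (LINT s|lborel. LINT \<tau>|lborel. A (s, \<tau>) * exp (- (norm \<xi>)\<^sup>2 * \<tau>))"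
      by (simp add: lborel_prod)
    also have "\<dots> = (LINT s|lborel. indicator {0<..<t} s * ((t - s) powr (- \<alpha>) * Re (inv_laplace L s)))"
    proof (rule Bochner_Integration.integral_cong)
      fix s :: real
      have "A (s, \<tau>) * exp (- (norm \<xi>)\<^sup>2 * \<tau>) = (indicator {0<..<t} s * (t - s) powr (- \<alpha>)) * (indicator {0<..} \<tau> * (exp (- (norm \<xi>)\<^sup>2 * \<tau>) * subordinator_re s \<tau>))" for \<tau>
        by (simp add: A_def)
      then have "(LINT \<tau>|lborel. A (s, \<tau>) * exp (- (norm \<xi>)\<^sup>2 * \<tau>)) = (indicator {0<..<t} s * (t - s) powr (- \<alpha>)) * (LINT \<tau>|lborel. indicator {0<..} \<tau> * (exp (- (norm \<xi>)\<^sup>2 * \<tau>) * subordinator_re s \<tau>))"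
        by (simp only: integral_mult_right_zero)
      also have "\<dots> = (indicator {0<..<t} s * (t - s) powr (- \<alpha>)) * Re (inv_laplace L s)"
        using laplace_subordinator_re [of s "(norm \<xi>)\<^sup>2"] \<xi> L by (cases "0 < s") (auto simp: has_bochner_integral_iff)
      finally show "(LINT \<tau>|lborel. A (s, \<tau>) * exp (- (norm \<xi>)\<^sup>2 * \<tau>)) = indicator {0<..<t} s * ((t - s) powr (- \<alpha>) * Re (inv_laplace L s))"
        by simp
    qed simp
    also have "\<dots> = (LINT s|lborel. indicator {0<..<t} s * ((t - s) powr (- \<alpha>) * (s powr (\<alpha> - 1) * mittag_leffler \<alpha> \<alpha> (- L * s powr \<alpha>))))"
    proof (rule integral_cong_AE)
      show "AE s in lborel. indicator {0<..<t} s * ((t - s) powr (- \<alpha>) * Re (inv_laplace L s)) = indicator {0<..<t} s * ((t - s) powr (- \<alpha>) * (s powr (\<alpha> - 1) * mittag_leffler \<alpha> \<alpha> (- L * s powr \<alpha>)))"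
        using inv_laplace_eq_mittag_leffler [OF L(1)] by eventually_elim (auto simp: indicator_def)
    qed (use mittag_leffler_fractional_integral [OF \<alpha> less_imp_le [OF L(1)] t] in \<open>auto dest: borel_measurable_has_bochner_integral\<close>)
    also have "\<dots> = Gamma (1 - \<alpha>) * mittag_leffler \<alpha> 1 (- L * t powr \<alpha>)"
      using mittag_leffler_fractional_integral [OF \<alpha> less_imp_le [OF L(1)] t] by (simp add: has_bochner_integral_iff)
    finally show ?thesis .
  qed
  finally show "(LINT x|lborel. cis (- (x \<bullet> \<xi>)) * complex_of_real (z_kernel t (x :: 'a)))
      = complex_of_real (mittag_leffler \<alpha> 1 (- (norm \<xi> powr (2 * \<beta>)) * t powr \<alpha>))"
    using Gamma_pos by (simp add: L_def)
qed

end

text \<open>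
  The integrand may be singular at \<open>0\<close>; the part up to \<open>t / 2\<close> is constant in the upper limit, and the
  fundamental theorem of calculus applies to the rest.
\<close>
lemma deriv_integral_from_zero:
  fixes f :: "real \<Rightarrow> real"
  assumes int: "\<And>T. 0 < T \<Longrightarrow> integrable lborel (\<lambda>s. indicator {0<..<T} s * f s)"
    and cont: "continuous_on {0<..} f" and t: "0 < t"
  shows "((\<lambda>\<tau>. LINT s|lborel. indicator {0<..<\<tau>} s * f s) has_real_derivative f t) (at t)"
proof -
  define a b where "a = t / 2" and "b = 2 * t"
  have ab: "0 < a" "a < t" "t < b" using t by (auto simp: a_def b_def)
  have ci: "continuous_on {a..b} f" using cont ab by (rule_tac continuous_on_subset) auto
  have eq: "(LINT s|lborel. indicator {0<..<a} s * f s) + integral {a..\<tau>} f = (LINT s|lborel. indicator {0<..<\<tau>} s * f s)"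
    if \<tau>: "\<tau> \<in> {a<..<b}" for \<tau>
  proof -
    have si: "set_integrable lborel {a..\<tau>} f"
      using \<tau> ci by (intro borel_integrable_atLeastAtMost' continuous_on_subset [OF ci]) auto
    have m1: "integrable lborel (\<lambda>s. indicator {a..\<tau>} s * f s)" using si by (simp add: set_integrable_def)
    have "integral {a..\<tau>} f = (LINT s|lborel. indicator {a..\<tau>} s * f s)"
      using set_borel_integral_eq_integral(2) [OF si] by (simp add: set_lebesgue_integral_def)
    then have "(LINT s|lborel. indicator {0<..<a} s * f s) + integral {a..\<tau>} f
       = (LINT s|lborel. indicator {0<..<a} s * f s + indicator {a..\<tau>} s * f s)"
      using int [OF ab(1)] m1 by simp
    also have "\<dots> = (LINT s|lborel. indicator {0<..<\<tau>} s * f s)"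
    proof (rule integral_cong_AE)
      show "AE s in lborel. indicator {0<..<a} s * f s + indicator {a..\<tau>} s * f s = indicator {0<..<\<tau>} s * f s"
        using AE_lborel_singleton [of \<tau>] by eventually_elim (use \<tau> ab in \<open>auto simp: indicator_def\<close>)
      show "(\<lambda>s. indicator {0<..<a} s * f s + indicator {a..\<tau>} s * f s) \<in> borel_measurable lborel"
        using int [OF ab(1)] m1 by (intro borel_measurable_add borel_measurable_integrable)
      show "(\<lambda>s. indicator {0<..<\<tau>} s * f s) \<in> borel_measurable lborel"
        using int [of \<tau>] \<tau> ab by (intro borel_measurable_integrable) auto
    qed
    finally show ?thesis .
  qed
  have "((\<lambda>\<tau>. integral {a..\<tau>} f) has_real_derivative f t) (at t within {a..b})"
    using ci ab by (intro integral_has_real_derivative) auto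
  then have "((\<lambda>\<tau>. integral {a..\<tau>} f) has_real_derivative f t) (at t)"
    using ab by (simp add: at_within_Icc_at)
  then have "((\<lambda>\<tau>. (LINT s|lborel. indicator {0<..<a} s * f s) + integral {a..\<tau>} f) has_real_derivative 0 + f t) (at t)"
    by (intro DERIV_add DERIV_const)
  then have "((\<lambda>\<tau>. (LINT s|lborel. indicator {0<..<a} s * f s) + integral {a..\<tau>} f) has_real_derivative f t) (at t)"
    by simp
  then show ?thesis
    by (rule has_field_derivative_transform_within_open [of _ _ _ "{a<..<b}"]) (use ab eq in auto)
qed

context subdiffusion_kernel
begin

lemma y_kernel_integrable:
  fixes x :: "'a::euclidean_space"
  assumes x: "x \<noteq> 0" and t: "0 < t"
  shows "integrable lborel (\<lambda>s. indicator {0<..<t} s * y_kernel s x)"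
proof -
  obtain C a1 a2 where a: "0 < a1" "a1 < 1" "0 < a2" "a2 < 1"
    and C: "\<And>t. 0 < t \<Longrightarrow> \<bar>y_kernel t x\<bar> \<le> C * two_powers a1 a2 t" using y_kernel_bound_continuous [OF x] by metis
  have "integrable lborel (\<lambda>s. C * (indicator {0<..<t} s * ((t - s) powr (1 - 1) * two_powers a1 a2 s)))"
    using two_powers_fractional_integrable [OF t a(1,3), of 1] by auto
  then show ?thesis
  proof (rule Bochner_Integration.integrable_bound)
    show "AE s in lborel. norm (indicator {0<..<t} s * y_kernel s x) \<le> norm (C * (indicator {0<..<t} s * ((t - s) powr (1 - 1) * two_powers a1 a2 s)))"
    proof (rule AE_I2)
      fix s :: real
      show "norm (indicator {0<..<t} s * y_kernel s x) \<le> norm (C * (indicator {0<..<t} s * ((t - s) powr (1 - 1) * two_powers a1 a2 s)))"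
        using C [of s] by (cases "s \<in> {0<..<t}") auto
    qed
  qed measurable
qed

text \<open>
  Fractional integrals of orders \<open>\<alpha>\<close> and \<open>1 - \<alpha>\<close> compose to the ordinary integral, by Fubini's theorem
  and \<open>\<integral> (t - s)\<^sup>\<alpha>\<^sup>-\<^sup>1 (s - \<sigma>)\<^sup>-\<^sup>\<alpha> ds = \<Gamma>(\<alpha>) \<Gamma>(1 - \<alpha>)\<close> over \<open>\<sigma> < s < t\<close>.
\<close>
lemma z_kernel_fractional_integral:
  fixes x :: "'a::euclidean_space"
  assumes x: "x \<noteq> 0" and t: "0 < t"
  shows "(LINT s|lborel. indicator {0<..<t} s * ((t - s) powr (\<alpha> - 1) * z_kernel s x)) = Gamma \<alpha> * (LINT s|lborel. indicator {0<..<t} s * y_kernel s x)"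
proof -
  define H where "H = (\<lambda>\<sigma> s. (indicator {0<..<t} \<sigma> * y_kernel \<sigma> x) * (indicator {\<sigma><..<t} s * ((t - s) powr (\<alpha> - 1) * (s - \<sigma>) powr ((1 - \<alpha>) - 1))))"
  have bi: "has_bochner_integral lborel (\<lambda>s. indicator {\<sigma><..<t} s * ((t - s) powr (\<alpha> - 1) * (s - \<sigma>) powr ((1 - \<alpha>) - 1))) (Gamma \<alpha> * Gamma (1 - \<alpha>))"
    if "\<sigma> < t" for \<sigma>
  proof -
    have "(t - \<sigma>) powr (\<alpha> + (1 - \<alpha>) - 1) * Beta \<alpha> (1 - \<alpha>) = Gamma \<alpha> * Gamma (1 - \<alpha>)"
      using that by (simp add: Beta_def)
    then show ?thesis
      using has_bochner_integral_beta_shift [of \<alpha> "1 - \<alpha>" \<sigma> t] \<alpha> that by simp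
  qed
  have inner: "(LINT s|lborel. H \<sigma> s) = (Gamma \<alpha> * Gamma (1 - \<alpha>)) * (indicator {0<..<t} \<sigma> * y_kernel \<sigma> x)" for \<sigma>
    unfolding H_def using bi [of \<sigma>] by (cases "\<sigma> < t") (auto simp: has_bochner_integral_iff)
  have innern: "(LINT s|lborel. norm (H \<sigma> s)) = (Gamma \<alpha> * Gamma (1 - \<alpha>)) * norm (indicator {0<..<t} \<sigma> * y_kernel \<sigma> x)" for \<sigma>
  proof -
    have "norm (H \<sigma> s) = norm (indicator {0<..<t} \<sigma> * y_kernel \<sigma> x) * (indicator {\<sigma><..<t} s * ((t - s) powr (\<alpha> - 1) * (s - \<sigma>) powr ((1 - \<alpha>) - 1)))" for s
      by (simp add: H_def abs_mult)
    then show ?thesis using bi [of \<sigma>] by (cases "\<sigma> < t") (auto simp: has_bochner_integral_iff)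
  qed
  have Hi: "integrable (lborel \<Otimes>\<^sub>M lborel) (\<lambda>(\<sigma>, s). H \<sigma> s)"
  proof (rule lborel_pair.Fubini_integrable)
    show "integrable lborel (\<lambda>\<sigma>. LINT s|lborel. norm ((\<lambda>(\<sigma>, s). H \<sigma> s) (\<sigma>, s)))"
      unfolding prod.case innern using y_kernel_integrable [OF x t] by auto
    show "AE \<sigma> in lborel. integrable lborel (\<lambda>s. (\<lambda>(\<sigma>, s). H \<sigma> s) (\<sigma>, s))"
    proof (rule AE_I2)
      fix \<sigma> :: real
      show "integrable lborel (\<lambda>s. (\<lambda>(\<sigma>, s). H \<sigma> s) (\<sigma>, s))"
        unfolding prod.case H_def using bi [of \<sigma>] by (cases "\<sigma> < t") (auto simp: has_bochner_integral_iff)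
    qed
    show "(\<lambda>(\<sigma>, s). H \<sigma> s) \<in> borel_measurable (lborel \<Otimes>\<^sub>M lborel)" unfolding H_def by measurable
  qed
  have "Gamma (1 - \<alpha>) * (LINT s|lborel. indicator {0<..<t} s * ((t - s) powr (\<alpha> - 1) * z_kernel s x)) = (LINT s|lborel. LINT \<sigma>|lborel. H \<sigma> s)"
  proof -
    have "(LINT \<sigma>|lborel. H \<sigma> s) = Gamma (1 - \<alpha>) * (indicator {0<..<t} s * ((t - s) powr (\<alpha> - 1) * z_kernel s x))" for s
    proof -
      have "H \<sigma> s = (indicator {0<..<t} s * (t - s) powr (\<alpha> - 1)) * (indicator {0<..<s} \<sigma> * ((s - \<sigma>) powr (- \<alpha>) * y_kernel \<sigma> x))" for \<sigma>
        by (auto simp: H_def indicator_def)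
      then have "(LINT \<sigma>|lborel. H \<sigma> s) = (indicator {0<..<t} s * (t - s) powr (\<alpha> - 1)) * (LINT \<sigma>|lborel. indicator {0<..<s} \<sigma> * ((s - \<sigma>) powr (- \<alpha>) * y_kernel \<sigma> x))"
        by (simp only: integral_mult_right_zero)
      then show ?thesis using Gamma_pos by (simp add: z_kernel_def)
    qed
    then show ?thesis by simp
  qed
  also have "\<dots> = (LINT \<sigma>|lborel. LINT s|lborel. H \<sigma> s)"
    by (rule lborel_pair.Fubini_integral [OF Hi])
  also have "\<dots> = Gamma (1 - \<alpha>) * (Gamma \<alpha> * (LINT s|lborel. indicator {0<..<t} s * y_kernel s x))"
    unfolding inner by simp
  finally show ?thesis using Gamma_pos by simp
qed

text \<open>
  Injectivity of the Fourier transform gives equality almost everywhere in \<open>x\<close> for each time.  The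
  order of the two quantifiers matters, because the time derivative is taken for fixed \<open>x\<close>; they are
  exchanged on a Borel representative, for which the set of equality is measurable.
\<close>
lemma fundamental_solution_AE_eq:
  fixes Z :: "'a::euclidean_space \<Rightarrow> real \<Rightarrow> real"
  assumes Z: "fundamental_solution \<alpha> \<beta> Z"
  shows "AE x in lborel. AE s in lborel. 0 < s \<longrightarrow> Z x s = z_kernel s x"
proof -
  have S: "UNIV \<times> {0<..} \<in> sets (lebesgue :: ('a \<times> real) measure)"
    by (intro sets_completionI_sets) (simp add: borel_open open_Times)
  have Zm: "(\<lambda>(x, t). Z x t) \<in> borel_measurable (lebesgue_on (UNIV \<times> {0<..}))"
    using Z by (simp add: fundamental_solution_def)
  obtain Z' where Z': "Z' \<in> borel_measurable borel"
    "AE z in lborel. z \<in> UNIV \<times> {0<..} \<longrightarrow> (\<lambda>(x, t). Z x t) z = Z' z"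
    using lebesgue_on_borel_representative [OF Zm S] .
  note [measurable] = Z'(1)
  have slice: "AE x in lborel. Z x t = z_kernel t x" if t: "0 < t" for t
  proof (rule fourier_injective_lebesgue)
    show "integrable lebesgue (\<lambda>x. Z x t)" using Z t by (simp add: fundamental_solution_def)
    show "integrable lborel (z_kernel t :: 'a \<Rightarrow> real)" by (rule z_kernel_fourier(1) [OF t])
    show "fourier (\<lambda>x. Z x t) \<xi> = (LINT x|lborel. cis (- (x \<bullet> \<xi>)) * complex_of_real (z_kernel t x))" if "\<xi> \<noteq> 0" for \<xi>
      using Z t z_kernel_fourier(2) [OF t that] by (simp add: fundamental_solution_def)
  qed
  have ae: "AE t in lborel. AE x in lborel. 0 < t \<longrightarrow> Z x t = Z' (x, t)"
    using lborel_AE_pair(2) [OF Z'(2)] by simp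
  have "AE t in lborel. AE x in lborel. 0 < t \<longrightarrow> Z' (x, t) = z_kernel t x"
    using ae
  proof eventually_elim
    case (elim t)
    show ?case
    proof (cases "0 < t")
      case True
      show ?thesis using slice [OF True] elim by eventually_elim simp
    qed simp
  qed
  then have "AE z in lborel. 0 < snd z \<longrightarrow> Z' z = z_kernel (snd z) (fst z)"
    by (intro lborel_AE_pairI) auto
  from lborel_AE_pair(1) [OF this] lborel_AE_pair(1) [OF Z'(2)]
  show ?thesis
  proof eventually_elim
    case (elim x)
    from elim(1,2) show ?case by eventually_elim simp
  qed
qed

text \<open>
  For almost every \<open>x\<close> the functions \<open>Z(x,\<cdot>)\<close> and \<open>z_kernel\<close> agree up to a null set of times, which the
  fractional integral in the definition of \<open>Y\<close> does not see.  So that integral is, for all times,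
  \<open>\<Gamma>(\<alpha>)\<close> times the integral of a continuous function.
\<close>
proposition kernel_Y_eq:
  fixes Z :: "'a::euclidean_space \<Rightarrow> real \<Rightarrow> real"
  assumes Z: "fundamental_solution \<alpha> \<beta> Z"
  shows "AE x in lborel. \<forall>t>0. kernel_Y \<alpha> Z x t = y_kernel t x"
  using fundamental_solution_AE_eq [OF Z] AE_lborel_singleton [of 0]
proof eventually_elim
  case (elim x)
  show ?case
  proof (intro allI impI)
    fix t :: real assume t: "0 < t"
    have cont: "continuous_on {0<..} (\<lambda>s. y_kernel s x)" using y_kernel_bound_continuous [OF elim(2)] by metis
    have eq: "Gamma \<alpha> * (LINT s|lborel. indicator {0<..<\<tau>} s * y_kernel s x) = (LINT s:{0<..<\<tau>}|lebesgue. Z x s / (\<tau> - s) powr (1 - \<alpha>))" if \<tau>: "0 < \<tau>" for \<tau>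
    proof -
      have "(LINT s:{0<..<\<tau>}|lebesgue. Z x s / (\<tau> - s) powr (1 - \<alpha>)) = (LINT s|lborel. indicator {0<..<\<tau>} s * ((\<tau> - s) powr (\<alpha> - 1) * z_kernel s x))"
        unfolding set_lebesgue_integral_def
      proof (rule lebesgue_AE_eq_borel(3))
        have p: "Y / (\<tau> - s) powr (1 - \<alpha>) = (\<tau> - s) powr (\<alpha> - 1) * Y" for s Y
          using powr_minus_divide [of "\<tau> - s" "1 - \<alpha>"] by simp
        show "AE s in lborel. indicat_real {0<..<\<tau>} s *\<^sub>R (Z x s / (\<tau> - s) powr (1 - \<alpha>)) = indicator {0<..<\<tau>} s * ((\<tau> - s) powr (\<alpha> - 1) * z_kernel s x)"
          using elim(1)
        proof eventually_elim
          case (elim s)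
          then show ?case by (cases "s \<in> {0<..<\<tau>}") (simp_all add: p)
        qed
      qed measurable
      then show ?thesis using z_kernel_fractional_integral [OF elim(2) \<tau>] by simp
    qed
    have "((\<lambda>\<tau>. Gamma \<alpha> * (LINT s|lborel. indicator {0<..<\<tau>} s * y_kernel s x)) has_real_derivative Gamma \<alpha> * y_kernel t x) (at t)"
      by (intro DERIV_cmult deriv_integral_from_zero y_kernel_integrable elim(2) cont t)
    then have "((\<lambda>\<tau>. LINT s:{0<..<\<tau>}|lebesgue. Z x s / (\<tau> - s) powr (1 - \<alpha>)) has_real_derivative Gamma \<alpha> * y_kernel t x) (at t)"
      by (rule has_field_derivative_transform_within_open [of _ _ _ "{0<..}"]) (use t eq in auto)
    then have "deriv (\<lambda>\<tau>. LINT s:{0<..<\<tau>}|lebesgue. Z x s / (\<tau> - s) powr (1 - \<alpha>)) t = Gamma \<alpha> * y_kernel t x"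
      by (rule DERIV_imp_deriv)
    then show "kernel_Y \<alpha> Z x t = y_kernel t x"
      using Gamma_pos by (simp add: kernel_Y_def riemann_liouville_deriv_def)
  qed
qed

end

section \<open>Inequalities for the nonlinear estimate\<close>

text \<open>
  The weighted inequality of arithmetic and geometric means for \<open>x\<^sup>q\<close>, \<open>y\<^sup>q\<close> and \<open>1\<close> with the weights
  \<open>1/q\<close>, \<open>(p-1)/q\<close> and \<open>1 - p/q\<close>.  With \<open>G\<close> the left-hand side it follows from \<open>ln z \<le> z - 1\<close>, applied
  to the three numbers divided by \<open>G\<close>: the weighted sum of the logarithms is \<open>0\<close>.
\<close>
lemma weighted_young:
  fixes x y p q :: real
  assumes "0 \<le> x" "0 \<le> y" "1 \<le> p" "p \<le> q"
  shows "x * y powr (p - 1) \<le> x powr q / q + (p - 1) / q * y powr q + (1 - p / q)"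
proof (cases "x = 0 \<or> y = 0")
  case True
  have "0 \<le> x powr q / q + (p - 1) / q * y powr q + (1 - p / q)" using assms by simp
  then show ?thesis using True by auto
next
  case False
  then have xy: "0 < x" "0 < y" using assms by auto
  define G where "G = x * y powr (p - 1)"
  have G: "0 < G" "ln G = ln x + (p - 1) * ln y" using xy by (auto simp: G_def ln_mult ln_powr)
  have "1 / q * ln (x powr q / G) + (p - 1) / q * ln (y powr q / G) + (1 - p / q) * ln (1 / G) = 0"
  proof -
    have "1 / q * (q * X - g) + (p - 1) / q * (q * Y - g) + (1 - p / q) * (0 - g) = X + (p - 1) * Y - g" for X Y g
      using assms by (simp add: field_simps)
    moreover have "ln (x powr q / G) = q * ln x - ln G" "ln (y powr q / G) = q * ln y - ln G" "ln (1 / G) = 0 - ln G"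
      using xy G(1) by (simp_all add: ln_div ln_powr)
    ultimately show ?thesis using G(2) by (simp only:)
  qed
  moreover have "1 / q * ln (x powr q / G) \<le> 1 / q * (x powr q / G - 1)"
    "(p - 1) / q * ln (y powr q / G) \<le> (p - 1) / q * (y powr q / G - 1)"
    "(1 - p / q) * ln (1 / G) \<le> (1 - p / q) * (1 / G - 1)"
    using assms xy G by (intro mult_left_mono ln_le_minus_one; simp)+
  ultimately have "0 \<le> 1 / q * (x powr q / G - 1) + (p - 1) / q * (y powr q / G - 1) + (1 - p / q) * (1 / G - 1)"
    by linarith
  also have "\<dots> = (x powr q / q + (p - 1) / q * y powr q + (1 - p / q)) / G - 1"
    using assms G by (simp add: field_simps)
  finally show ?thesis using G by (simp add: field_simps flip: G_def)
qed

text \<open>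
  By symmetry \<open>a\<close> is the number of larger modulus and positive.  If \<open>b\<close> has the same sign, this is
  Bernoulli's inequality \<open>y\<^sup>p \<ge> 1 + p (y - 1)\<close> for \<open>y = b/a\<close>; if not, the two terms add up and already
  the factor \<open>1\<close> suffices.
\<close>
lemma power_nonlinearity_lipschitz:
  fixes a b p :: real
  assumes p: "1 \<le> p"
  shows "\<bar>\<bar>a\<bar> powr (p - 1) * a - \<bar>b\<bar> powr (p - 1) * b\<bar> \<le> p * (\<bar>a - b\<bar> * max \<bar>a\<bar> \<bar>b\<bar> powr (p - 1))"
proof -
  have pos: "\<bar>\<bar>a\<bar> powr (p - 1) * a - \<bar>b\<bar> powr (p - 1) * b\<bar> \<le> p * (\<bar>a - b\<bar> * a powr (p - 1))"
    if ab: "\<bar>b\<bar> \<le> a" for a b :: real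
  proof (cases "a = 0")
    case True
    then show ?thesis using ab by simp
  next
    case False
    then have a: "0 < a" using ab by linarith
    show ?thesis
    proof (cases "0 \<le> b")
      case True
      define y where "y = b / a"
      have y: "0 \<le> y" "b = a * y" using True a by (auto simp: y_def)
      have "y * 1 powr (1 - 1) \<le> y powr p / p + (1 - 1) / p * 1 powr p + (1 - 1 / p)"
        using p y by (intro weighted_young) auto
      then have "p * y \<le> p * (y powr p / p + (1 - 1 / p))" using p by (intro mult_left_mono) auto
      also have "\<dots> = y powr p + p - 1" using p by (simp add: field_simps)
      finally have "p * y \<le> y powr p + p - 1" .
      then have "a powr p * (p * y) \<le> a powr p * (y powr p + p - 1)" by (intro mult_left_mono) auto
      then have *: "a powr p - a powr p * y powr p \<le> p * (a powr p - a powr p * y)" by (simp add: algebra_simps)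
      have ap: "a powr p = a powr (p - 1) * a"
        using a powr_add [of a "p - 1" 1] by simp
      have bp: "\<bar>b\<bar> powr (p - 1) * b = a powr p * y powr p"
      proof -
        have "\<bar>b\<bar> powr (p - 1) * b = b powr p"
          using True powr_add [of b "p - 1" 1] by (cases "b = 0") auto
        then show ?thesis using y a by (simp add: powr_mult)
      qed
      have "b \<le> a" using ab by simp
      have "\<bar>b\<bar> powr (p - 1) * b \<le> a powr (p - 1) * a"
        using True ab p by (intro mult_mono powr_mono2) auto
      then have "\<bar>\<bar>a\<bar> powr (p - 1) * a - \<bar>b\<bar> powr (p - 1) * b\<bar> = a powr p - a powr p * y powr p"
        using a ap bp by simp
      also have "\<dots> \<le> p * (a powr p - a powr p * y)" by (rule *)
      also have "a powr p - a powr p * y = (a - b) * a powr (p - 1)"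
        unfolding ap y(2) by (simp add: algebra_simps)
      finally show ?thesis using \<open>b \<le> a\<close> by simp
    next
      case False
      have "\<bar>\<bar>a\<bar> powr (p - 1) * a - \<bar>b\<bar> powr (p - 1) * b\<bar> \<le> \<bar>a\<bar> powr (p - 1) * a + \<bar>b\<bar> powr (p - 1) * \<bar>b\<bar>"
        using abs_triangle_ineq4 [of "\<bar>a\<bar> powr (p - 1) * a" "\<bar>b\<bar> powr (p - 1) * b"] a by (simp add: abs_mult)
      also have "\<dots> \<le> a powr (p - 1) * a + a powr (p - 1) * \<bar>b\<bar>"
        using ab p a by (intro add_mono mult_right_mono powr_mono2) auto
      also have "\<dots> = 1 * (\<bar>a - b\<bar> * a powr (p - 1))"
        using False a by (simp add: algebra_simps)
      also have "\<dots> \<le> p * (\<bar>a - b\<bar> * a powr (p - 1))"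
        using p by (intro mult_right_mono) auto
      finally show ?thesis .
    qed
  qed
  have pos': "\<bar>\<bar>a\<bar> powr (p - 1) * a - \<bar>b\<bar> powr (p - 1) * b\<bar> \<le> p * (\<bar>a - b\<bar> * \<bar>a\<bar> powr (p - 1))"
    if ab: "\<bar>b\<bar> \<le> \<bar>a\<bar>" for a b :: real
  proof (cases "0 \<le> a")
    case True
    then show ?thesis using pos [of b a] ab by simp
  next
    case False
    have "\<bar>\<bar>- a\<bar> powr (p - 1) * (- a) - \<bar>- b\<bar> powr (p - 1) * (- b)\<bar> \<le> p * (\<bar>- a - (- b)\<bar> * (- a) powr (p - 1))"
      using False ab by (intro pos) auto
    moreover have "\<bar>- a\<bar> powr (p - 1) * (- a) - \<bar>- b\<bar> powr (p - 1) * (- b) = - (\<bar>a\<bar> powr (p - 1) * a - \<bar>b\<bar> powr (p - 1) * b)"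
      by simp
    moreover have "\<bar>- a - (- b)\<bar> = \<bar>a - b\<bar>" by simp
    ultimately show ?thesis using False by (simp only: abs_minus_cancel) simp
  qed
  show ?thesis
  proof (cases "\<bar>b\<bar> \<le> \<bar>a\<bar>")
    case True
    then show ?thesis using pos' [OF True] by (simp add: max_def)
  next
    case False
    then show ?thesis using pos' [of a b] by (simp add: max_def abs_minus_commute)
  qed
qed

text \<open>
  Hoelder's inequality for the factors \<open>a\<close>, \<open>b\<^sup>p\<^sup>-\<^sup>1\<close> and \<open>1\<close> with exponents \<open>q\<close>, \<open>q/(p-1)\<close> and \<open>q/(q-p)\<close>,
  in a form that covers the limiting cases \<open>p = 1\<close> and \<open>p = q\<close>: normalise \<open>a\<close> and \<open>b\<close> and integrate the
  weighted Young inequality.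
\<close>
lemma holder_three:
  fixes a b :: "'z \<Rightarrow> real"
  assumes [measurable]: "a \<in> borel_measurable M" "b \<in> borel_measurable M"
    and nn: "\<And>z. 0 \<le> a z" "\<And>z. 0 \<le> b z"
    and pq: "1 \<le> p" "p \<le> q" and pos: "0 < \<kappa>" "0 < D"
    and mass: "(\<integral>\<^sup>+z. 1 \<partial>M) \<le> ennreal \<kappa>"
    and b: "(\<integral>\<^sup>+z. ennreal (b z powr q) \<partial>M) \<le> ennreal (D * \<kappa>)"
    and r: "0 \<le> r" "ennreal r \<le> (\<integral>\<^sup>+z. ennreal (a z * b z powr (p - 1)) \<partial>M)"
  shows "ennreal (r powr q) \<le> (\<integral>\<^sup>+z. ennreal (a z powr q) \<partial>M) * ennreal (\<kappa> powr (q - 1) * D powr (p - 1))"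
proof -
  define S where "S = (\<integral>\<^sup>+z. ennreal (a z powr q) \<partial>M)"
  have q: "q > 0" using pq by linarith
  have cpos: "\<kappa> powr (q - 1) * D powr (p - 1) > 0" using pos by simp
  show ?thesis
  proof (cases "S = \<infinity> \<or> r = 0")
    case True
    then show ?thesis using cpos by (auto simp: S_def [symmetric] ennreal_top_mult ennreal_mult_eq_top_iff)
  next
    case False
    then obtain S' where S': "S = ennreal S'" "0 \<le> S'" by (cases S) auto
    have "S' \<noteq> 0"
    proof
      assume "S' = 0"
      then have "AE z in M. ennreal (a z powr q) = 0"
        using S' by (subst nn_integral_0_iff_AE [symmetric]) (auto simp: S_def)
      then have "AE z in M. a z * b z powr (p - 1) = 0"
        by eventually_elim (use nn in \<open>auto simp: ennreal_eq_0_iff\<close>)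
      then have "(\<integral>\<^sup>+z. ennreal (a z * b z powr (p - 1)) \<partial>M) = 0"
        by (subst nn_integral_0_iff_AE) (auto elim: eventually_mono)
      then show False using r False by (simp add: ennreal_eq_0_iff)
    qed
    then have S0: "0 < S'" using S' by simp
    \<comment> \<open>Divided by \<open>A\<close> and \<open>B\<close>, the functions \<open>a\<close> and \<open>b\<close> have \<open>q\<close>-th moments of at most \<open>\<kappa>\<close>.\<close>
    define A where "A = (S' / \<kappa>) powr (1 / q)"
    define B where "B = D powr (1 / q)"
    have A: "0 < A" "A powr q = S' / \<kappa>" and B: "0 < B" "B powr q = D"
      using S0 pos q by (auto simp: A_def B_def powr_powr)
    define C where "C = A * B powr (p - 1)"
    have C: "0 < C" using A B by (simp add: C_def)
    have pw: "a z * b z powr (p - 1) \<le> C / (q * A powr q) * a z powr q + (C * (p - 1) / (q * B powr q)) * b z powr q + C * (1 - p / q)" for z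
    proof -
      have "(a z / A) * (b z / B) powr (p - 1) \<le> (a z / A) powr q / q + (p - 1) / q * (b z / B) powr q + (1 - p / q)"
        using nn A B pq by (intro weighted_young) auto
      then have "C * ((a z / A) * (b z / B) powr (p - 1)) \<le> C * ((a z / A) powr q / q + (p - 1) / q * (b z / B) powr q + (1 - p / q))"
        using C by (intro mult_left_mono) auto
      moreover have "C * ((a z / A) * (b z / B) powr (p - 1)) = a z * b z powr (p - 1)"
        using nn A B by (simp add: C_def powr_divide)
      moreover have "C * ((a z / A) powr q / q + (p - 1) / q * (b z / B) powr q + (1 - p / q))
        = C / (q * A powr q) * a z powr q + (C * (p - 1) / (q * B powr q)) * b z powr q + C * (1 - p / q)"
        using nn A B by (simp add: powr_divide distrib_left mult_ac)
      ultimately show ?thesis by simp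
    qed
    have c: "0 \<le> C / (q * A powr q)" "0 \<le> C * (p - 1) / (q * B powr q)" "0 \<le> C * (1 - p / q)"
      using A B C pq q pos S0 by (auto intro!: divide_nonneg_nonneg mult_nonneg_nonneg)
    have "ennreal r \<le> (\<integral>\<^sup>+z. ennreal (C / (q * A powr q)) * ennreal (a z powr q) + ennreal (C * (p - 1) / (q * B powr q)) * ennreal (b z powr q) + ennreal (C * (1 - p / q)) * 1 \<partial>M)"
    proof (rule order_trans [OF r(2) nn_integral_mono])
      fix z
      have "ennreal (C / (q * A powr q)) * ennreal (a z powr q) + ennreal (C * (p - 1) / (q * B powr q)) * ennreal (b z powr q) + ennreal (C * (1 - p / q)) * 1
        = ennreal (C / (q * A powr q) * a z powr q + (C * (p - 1) / (q * B powr q)) * b z powr q + C * (1 - p / q))"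
        using c by (simp only: ennreal_plus ennreal_mult mult_nonneg_nonneg add_nonneg_nonneg powr_ge_zero mult_1_right)
      then show "ennreal (a z * b z powr (p - 1)) \<le> ennreal (C / (q * A powr q)) * ennreal (a z powr q) + ennreal (C * (p - 1) / (q * B powr q)) * ennreal (b z powr q) + ennreal (C * (1 - p / q)) * 1"
        using pw [of z] by (simp only: ennreal_leI)
    qed
    also have "\<dots> = ennreal (C / (q * A powr q)) * S + ennreal (C * (p - 1) / (q * B powr q)) * (\<integral>\<^sup>+z. ennreal (b z powr q) \<partial>M) + ennreal (C * (1 - p / q)) * (\<integral>\<^sup>+z. 1 \<partial>M)"
      unfolding S_def by (simp add: nn_integral_add nn_integral_cmult)
    also have "\<dots> \<le> ennreal (C / (q * A powr q)) * ennreal S' + ennreal (C * (p - 1) / (q * B powr q)) * ennreal (D * \<kappa>) + ennreal (C * (1 - p / q)) * ennreal \<kappa>"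
      using b mass S' by (intro add_mono mult_left_mono) auto
    also have "\<dots> = ennreal (C / (q * A powr q) * S' + C * (p - 1) / (q * B powr q) * (D * \<kappa>) + C * (1 - p / q) * \<kappa>)"
    proof -
      have dk: "0 \<le> D * \<kappa>" "0 \<le> \<kappa>" using pos by auto
      show ?thesis
        using c S'(2) dk by (simp only: ennreal_plus ennreal_mult mult_nonneg_nonneg add_nonneg_nonneg)
    qed
    also have "C / (q * A powr q) * S' + C * (p - 1) / (q * B powr q) * (D * \<kappa>) + C * (1 - p / q) * \<kappa> = C * \<kappa>"
      unfolding A(2) B(2) using S0 pos q by (simp add: field_simps)
    finally have "r \<le> C * \<kappa>" using C pos by (simp add: ennreal_le_iff)
    then have "r powr q \<le> (C * \<kappa>) powr q" using r q by (intro powr_mono2) auto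
    also have "(C * \<kappa>) powr q = S' * (\<kappa> powr (q - 1) * D powr (p - 1))"
    proof -
      have "(B powr (p - 1)) powr q = D powr (p - 1)"
        using B(2) by (metis powr_powr mult.commute)
      moreover have "\<kappa> powr q = \<kappa> powr (q - 1) * \<kappa>" using pos powr_add [of \<kappa> "q - 1" 1] by simp
      ultimately show ?thesis using A B pos C by (simp add: C_def powr_mult)
    qed
    finally show ?thesis using S' cpos by (simp add: S_def [symmetric] ennreal_mult [symmetric] ennreal_leI)
  qed
qed

context subdiffusion_kernel
begin

definition abs_subordinator :: "real \<Rightarrow> real \<times> real \<Rightarrow> real" where
  "abs_subordinator t r = indicator {0<..<t} (fst r) * (indicator {0<..} (snd r) * norm (subordinator (t - fst r) (snd r)))"

lemma abs_subordinator_nonneg: "0 \<le> abs_subordinator t r" by (simp add: abs_subordinator_def)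

lemma abs_subordinator_measurable [measurable (raw)]:
  assumes [measurable]: "f \<in> borel_measurable M"
  shows "(\<lambda>z. abs_subordinator t (f z)) \<in> borel_measurable M"
  unfolding abs_subordinator_def by measurable

text \<open>
  The weight \<open>e\<^sup>\<rho>\<^sup>s\<close> at time \<open>s\<close> amounts to a factor \<open>e\<^sup>\<rho>\<^sup>t\<close> and the Laplace transform of a sum of two
  integrable powers at \<open>\<rho>\<close>, which tends to \<open>0\<close> as \<open>\<rho>\<close> grows.  The weight \<open>\<tau>\<^sup>-\<^sup>\<delta>\<close> pays for the mapping
  from \<open>L\<^sup>q\<^sup>/\<^sup>p\<close> to \<open>L\<^sup>q\<close>.
\<close>
proposition abs_subordinator_mass:
  assumes \<delta>: "0 \<le> \<delta>" "\<delta> < \<beta>"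
  obtains \<kappa>0 where "\<And>\<rho>. 0 < \<rho> \<Longrightarrow> 0 < \<kappa>0 \<rho>" "(\<kappa>0 \<longlongrightarrow> 0) at_top"
    "\<And>\<rho> t. 0 < \<rho> \<Longrightarrow> 0 < t \<Longrightarrow> (\<integral>\<^sup>+r. ennreal (abs_subordinator t r * (exp (\<rho> * fst r) * snd r powr (- \<delta>))) \<partial>lborel) \<le> ennreal (exp (\<rho> * t) * \<kappa>0 \<rho>)"
proof -
  obtain W a1 a2 where W: "integrable lborel W" "\<And>\<tau>. 0 \<le> W \<tau>" and a: "0 < a1" "a1 < 1" "0 < a2" "a2 < 1"
    and le: "\<And>t \<tau>. 0 < t \<Longrightarrow> 0 < \<tau> \<Longrightarrow> norm (subordinator t \<tau>) * \<tau> powr (- \<delta>) \<le> W \<tau> * two_powers a1 a2 t"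
    using subordinator_weighted_bound [OF \<delta>] by metis
  define I where "I = (LINT \<tau>|lborel. W \<tau>)"
  have I: "0 \<le> I" using W by (simp add: I_def)
  define V where "V = (\<lambda>\<rho>. Gamma a1 * \<rho> powr (- a1) + Gamma a2 * \<rho> powr (- a2))"
  \<comment> \<open>The term \<open>1 / \<rho>\<close> makes the bound strictly positive also when \<open>I = 0\<close>.\<close>
  define \<kappa>0 where "\<kappa>0 = (\<lambda>\<rho>. V \<rho> * I + 1 / \<rho>)"
  have G: "0 < Gamma a1" "0 < Gamma a2" using a by (auto intro: Gamma_real_pos)
  show ?thesis
  proof (rule that [of \<kappa>0])
    show "0 < \<kappa>0 \<rho>" if "0 < \<rho>" for \<rho>
      unfolding \<kappa>0_def V_def using that I G by (intro add_nonneg_pos mult_nonneg_nonneg add_nonneg_nonneg) auto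
    have "((\<lambda>\<rho>. \<rho> powr (- a)) \<longlongrightarrow> 0) at_top" if "0 < a" for a :: real
      using that by real_asymp
    note pz = this
    have "((\<lambda>\<rho>::real. 1 / \<rho>) \<longlongrightarrow> 0) at_top" by real_asymp
    then have "(\<kappa>0 \<longlongrightarrow> (Gamma a1 * 0 + Gamma a2 * 0) * I + 0) at_top"
      unfolding \<kappa>0_def V_def using a by (intro tendsto_add tendsto_mult tendsto_const pz) auto
    then show "(\<kappa>0 \<longlongrightarrow> 0) at_top" by simp
  next
    fix \<rho> t :: real assume \<rho>: "0 < \<rho>" and t: "0 < t"
    define f where "f = (\<lambda>\<sigma>. indicator {0<..} \<sigma> * (two_powers a1 a2 \<sigma> * exp (- \<rho> * \<sigma>)))"
    have f: "has_bochner_integral lborel f (V \<rho>)"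
      using has_bochner_integral_add [OF has_bochner_integral_powr_exp [OF a(1) \<rho>] has_bochner_integral_powr_exp [OF a(3) \<rho>]] \<rho>
      by (simp add: f_def V_def two_powers_def algebra_simps powr_minus divide_inverse)
    have f2: "has_bochner_integral lborel (\<lambda>s. exp (\<rho> * t) * f (t + (-1) * s)) (exp (\<rho> * t) * V \<rho>)"
      using f by (intro has_bochner_integral_mult_right) (subst (asm) lborel_has_bochner_integral_real_affine_iff [of "-1" _ _ t], auto)
    have prod: "has_bochner_integral lborel (\<lambda>r. (exp (\<rho> * t) * f (t + (-1) * fst r)) * W (snd r)) (exp (\<rho> * t) * V \<rho> * I)"
      using lborel_prod_mult [OF integrable.intros [OF f2] W(1)] f2 by (simp add: has_bochner_integral_iff I_def)
    have f0: "0 \<le> f \<sigma>" for \<sigma> by (simp add: f_def two_powers_def)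
    have "(\<integral>\<^sup>+r. ennreal (abs_subordinator t r * (exp (\<rho> * fst r) * snd r powr (- \<delta>))) \<partial>lborel)
       \<le> (\<integral>\<^sup>+r. ennreal ((exp (\<rho> * t) * f (t + (-1) * fst r)) * W (snd r)) \<partial>lborel)"
    proof (intro nn_integral_mono ennreal_leI)
      fix r :: "real \<times> real"
      show "abs_subordinator t r * (exp (\<rho> * fst r) * snd r powr (- \<delta>)) \<le> (exp (\<rho> * t) * f (t + (-1) * fst r)) * W (snd r)"
      proof (cases "0 < fst r \<and> fst r < t \<and> 0 < snd r")
        case True
        have "abs_subordinator t r * (exp (\<rho> * fst r) * snd r powr (- \<delta>)) = exp (\<rho> * fst r) * (norm (subordinator (t - fst r) (snd r)) * snd r powr (- \<delta>))"
          using True by (simp add: abs_subordinator_def)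
        also have "\<dots> \<le> exp (\<rho> * fst r) * (W (snd r) * two_powers a1 a2 (t - fst r))"
          using True by (intro mult_left_mono le) auto
        also have "\<dots> = (exp (\<rho> * t) * f (t + (-1) * fst r)) * W (snd r)"
        proof -
          have "exp (\<rho> * t) * exp (- \<rho> * (t - fst r)) = exp (\<rho> * fst r)"
            unfolding mult_exp_exp by (rule arg_cong [where f = exp]) (simp add: algebra_simps)
          then show ?thesis using True by (simp add: f_def mult_ac)
        qed
        finally show ?thesis .
      next
        case False
        then have "abs_subordinator t r = 0" by (auto simp: abs_subordinator_def indicator_def)
        then show ?thesis using f0 W by simp
      qed
    qed
    also have "\<dots> = ennreal (exp (\<rho> * t) * V \<rho> * I)"
      using prod f0 W by (subst nn_integral_eq_integral) (auto simp: has_bochner_integral_iff)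
    also have "\<dots> \<le> ennreal (exp (\<rho> * t) * \<kappa>0 \<rho>)"
      unfolding \<kappa>0_def using \<rho> by (intro ennreal_leI) (simp add: algebra_simps)
    finally show "(\<integral>\<^sup>+r. ennreal (abs_subordinator t r * (exp (\<rho> * fst r) * snd r powr (- \<delta>))) \<partial>lborel) \<le> ennreal (exp (\<rho> * t) * \<kappa>0 \<rho>)" .
  qed
qed

end

section \<open>The difference of two solutions\<close>

lemma lborel_reflect_eq: "lborel = distr lborel borel (\<lambda>y. x - y :: 'a::euclidean_space)"
  using lborel_affine [of "-1" x] by (simp add: density_1)

lemma nn_integral_lborel_reflect:
  fixes f :: "'a::euclidean_space \<Rightarrow> ennreal"
  assumes [measurable]: "f \<in> borel_measurable borel"
  shows "(\<integral>\<^sup>+y. f (x - y) \<partial>lborel) = (\<integral>\<^sup>+y. f y \<partial>lborel)"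
  by (subst (2) lborel_reflect_eq [of x]) (simp add: nn_integral_distr)

lemma lborel_AE_reflect:
  fixes P :: "'a::euclidean_space \<Rightarrow> bool"
  assumes "AE y in lborel. P y"
  shows "AE y in lborel. P (x - y)"
proof -
  obtain N where N: "N \<in> null_sets lborel" "{y. \<not> P y} \<subseteq> N"
    using assms by (auto simp: eventually_ae_filter)
  then have [measurable]: "N \<in> sets borel" by auto
  have "emeasure lborel ((\<lambda>y. x - y) -` N) = emeasure (distr lborel borel (\<lambda>y. x - y)) N"
    by (subst emeasure_distr) auto
  also have "\<dots> = emeasure lborel N" by (simp only: lborel_reflect_eq [symmetric])
  also have "\<dots> = 0" using N(1) by (rule null_setsD1)
  finally have "(\<lambda>y. x - y) -` N \<in> null_sets lborel"
    using measurable_sets [of "\<lambda>y. x - y" borel borel N] by (auto simp: null_sets_def)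
  then show ?thesis by (rule AE_I') (use N(2) in auto)
qed

lemma lborel_AE_fst:
  fixes P :: "'a::euclidean_space \<Rightarrow> bool"
  assumes "AE x in lborel. P x"
  shows "AE z in (lborel :: ('a \<times> 'b::euclidean_space) measure). P (fst z)"
proof -
  obtain N where N: "N \<in> null_sets lborel" "{y. \<not> P y} \<subseteq> N"
    using assms by (auto simp: eventually_ae_filter)
  then have [measurable]: "N \<in> sets borel" by auto
  have "AE z in (lborel :: ('a \<times> 'b) measure). fst z \<notin> N"
  proof (rule lborel_AE_pairI)
    show "{z :: 'a \<times> 'b. fst z \<notin> N} \<in> sets borel"
    proof -
      have "{z :: 'a \<times> 'b. fst z \<notin> N} = fst -` (- N)" by auto
      then show ?thesis using measurable_sets [of "fst :: 'a \<times> 'b \<Rightarrow> 'a" borel borel "- N"] by auto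
    qed
    show "(AE x in lborel. AE y in lborel. fst (x, y) \<notin> N) \<or> (AE y in lborel. AE x in lborel. fst (x, y) \<notin> N)"
      using AE_not_in [OF N(1)] by auto
  qed
  then show ?thesis by eventually_elim (use N(2) in auto)
qed

lemma nn_integral_lborel_pair:
  fixes f :: "'a::euclidean_space \<times> 'b::euclidean_space \<Rightarrow> ennreal"
  assumes f: "f \<in> borel_measurable borel"
  shows "(\<integral>\<^sup>+z. f z \<partial>lborel) = (\<integral>\<^sup>+x. \<integral>\<^sup>+y. f (x, y) \<partial>lborel \<partial>lborel)"
    and "(\<integral>\<^sup>+z. f z \<partial>lborel) = (\<integral>\<^sup>+y. \<integral>\<^sup>+x. f (x, y) \<partial>lborel \<partial>lborel)"
proof -
  have f': "f \<in> borel_measurable (lborel \<Otimes>\<^sub>M lborel)" using f by (simp add: lborel_prod)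
  show "(\<integral>\<^sup>+z. f z \<partial>lborel) = (\<integral>\<^sup>+x. \<integral>\<^sup>+y. f (x, y) \<partial>lborel \<partial>lborel)"
    using lborel.nn_integral_fst [OF f'] unfolding lborel_prod by simp
  show "(\<integral>\<^sup>+z. f z \<partial>lborel) = (\<integral>\<^sup>+y. \<integral>\<^sup>+x. f (x, y) \<partial>lborel \<partial>lborel)"
    using lborel_pair.nn_integral_snd [OF f'] unfolding lborel_prod by simp
qed

lemma nn_integral_section_measurable:
  fixes f :: "'a::euclidean_space \<times> 'b::euclidean_space \<Rightarrow> ennreal"
  assumes "f \<in> borel_measurable borel"
  shows "(\<lambda>x. \<integral>\<^sup>+y. f (x, y) \<partial>lborel) \<in> borel_measurable borel"
proof (rule lborel.borel_measurable_nn_integral)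
  show "(\<lambda>(x, y). f (x, y)) \<in> borel_measurable (borel \<Otimes>\<^sub>M lborel)"
  proof -
    have "sets (borel \<Otimes>\<^sub>M lborel :: ('a \<times> 'b) measure) = sets (borel \<Otimes>\<^sub>M borel)"
      by (intro sets_pair_measure_cong) auto
    then have "sets (borel \<Otimes>\<^sub>M lborel :: ('a \<times> 'b) measure) = sets borel"
      by (simp only: borel_prod)
    then have "(borel_measurable (borel \<Otimes>\<^sub>M lborel) :: ('a \<times> 'b \<Rightarrow> ennreal) set) = borel_measurable borel"
      by (rule measurable_cong_sets) (rule refl)
    then show ?thesis using assms by (simp only: case_prod_eta)
  qed
qed

lemma nn_integral_lborel_triple:
  fixes f :: "(real \<times> real) \<times> 'a::euclidean_space \<Rightarrow> ennreal"
  assumes [measurable]: "f \<in> borel_measurable borel"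
  shows "(\<integral>\<^sup>+z. \<integral>\<^sup>+\<tau>. f ((snd z, \<tau>), fst z) \<partial>lborel \<partial>lborel) = (\<integral>\<^sup>+P. f P \<partial>lborel)"
proof -
  have "(\<integral>\<^sup>+z. \<integral>\<^sup>+\<tau>. f ((snd z, \<tau>), fst z) \<partial>lborel \<partial>lborel) = (\<integral>\<^sup>+s. \<integral>\<^sup>+y. \<integral>\<^sup>+\<tau>. f ((s, \<tau>), y) \<partial>lborel \<partial>lborel \<partial>lborel)"
  proof -
    have "(\<lambda>P :: ('a \<times> real) \<times> real. ((snd (fst P), snd P), fst (fst P))) \<in> borel_measurable borel"
      by (intro borel_measurable_continuous_onI continuous_intros)
    from nn_integral_section_measurable [OF measurable_compose [OF this assms]]
    have "(\<lambda>z :: 'a \<times> real. \<integral>\<^sup>+\<tau>. f ((snd z, \<tau>), fst z) \<partial>lborel) \<in> borel_measurable borel"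
      by simp
    from nn_integral_lborel_pair(2) [OF this] show ?thesis by simp
  qed
  also have "\<dots> = (\<integral>\<^sup>+s. \<integral>\<^sup>+\<tau>. \<integral>\<^sup>+y. f ((s, \<tau>), y) \<partial>lborel \<partial>lborel \<partial>lborel)"
  proof (rule nn_integral_cong)
    fix s :: real
    have m: "(\<lambda>z :: 'a \<times> real. f ((s, snd z), fst z)) \<in> borel_measurable borel" by measurable
    show "(\<integral>\<^sup>+y. \<integral>\<^sup>+\<tau>. f ((s, \<tau>), y) \<partial>lborel \<partial>lborel) = (\<integral>\<^sup>+\<tau>. \<integral>\<^sup>+y. f ((s, \<tau>), y) \<partial>lborel \<partial>lborel)"
      using nn_integral_lborel_pair [OF m] by simp
  qed
  also have "\<dots> = (\<integral>\<^sup>+r. \<integral>\<^sup>+y. f (r, y) \<partial>lborel \<partial>lborel)"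
    using nn_integral_lborel_pair(1) [OF nn_integral_section_measurable [OF assms]] by simp
  also have "\<dots> = (\<integral>\<^sup>+P. f P \<partial>lborel)"
    by (simp add: nn_integral_lborel_pair(1))
  finally show ?thesis .
qed

context subdiffusion_kernel
begin

lemma abs_y_kernel_le: "ennreal \<bar>y_kernel t x\<bar> \<le> (\<integral>\<^sup>+\<tau>. ennreal (indicator {0<..} \<tau> * (norm (subordinator t \<tau>) * gauss \<tau> x)) \<partial>lborel)"
proof (cases "integrable lborel (\<lambda>\<tau>. indicator {0<..} \<tau> * (subordinator_re t \<tau> * gauss \<tau> x))")
  case True
  have "ennreal \<bar>y_kernel t x\<bar> \<le> (\<integral>\<^sup>+\<tau>. ennreal (norm (indicator {0<..} \<tau> * (subordinator_re t \<tau> * gauss \<tau> x))) \<partial>lborel)"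
    unfolding y_kernel_def using integral_norm_bound_ennreal [OF True] by simp
  also have "\<dots> \<le> (\<integral>\<^sup>+\<tau>. ennreal (indicator {0<..} \<tau> * (norm (subordinator t \<tau>) * gauss \<tau> x)) \<partial>lborel)"
  proof (intro nn_integral_mono ennreal_leI)
    fix \<tau> :: real
    show "norm (indicator {0<..} \<tau> * (subordinator_re t \<tau> * gauss \<tau> x)) \<le> indicator {0<..} \<tau> * (norm (subordinator t \<tau>) * gauss \<tau> x)"
      using abs_subordinator_re_le [of t \<tau>] gauss_nonneg [of \<tau> x]
      by (cases "0 < \<tau>") (auto simp: abs_mult intro!: mult_right_mono)
  qed
  finally show ?thesis .
next
  case False
  then show ?thesis by (simp add: y_kernel_def not_integrable_integral_eq)
qed

text \<open>
  The exceptional null set of \<open>kernel_Y_eq\<close> consists of points \<open>x - y\<close>; reflected and extended to all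
  times it is a null set of pairs \<open>(y, s)\<close> for every single \<open>x\<close>.
\<close>
lemma duhamel_borel_form:
  fixes Z u :: "'a::euclidean_space \<Rightarrow> real \<Rightarrow> real" and v :: "'a \<times> real \<Rightarrow> real"
  assumes Z: "fundamental_solution \<alpha> \<beta> Z"
    and [measurable]: "v \<in> borel_measurable borel"
    and uv: "AE z in lborel. snd z \<in> {0<..<t} \<longrightarrow> u (fst z) (snd z) = v z"
    and int: "set_integrable lebesgue (UNIV \<times> {0<..<t}) (\<lambda>(y, s). \<bar>u y s\<bar> powr (p - 1) * u y s * kernel_Y \<alpha> Z (x - y) (t - s))"
  defines "G \<equiv> \<lambda>z. indicator {0<..<t} (snd z) * (\<bar>v z\<bar> powr (p - 1) * v z * y_kernel (t - snd z) (x - fst z))"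
  shows "integrable lborel G"
    and "(LINT s:{0<..<t}|lebesgue. LINT y|lebesgue. \<bar>u y s\<bar> powr (p - 1) * u y s * kernel_Y \<alpha> Z (x - y) (t - s)) = (LINT z|lborel. G z)"
proof -
  define integrand where "integrand = (\<lambda>y s. \<bar>u y s\<bar> powr (p - 1) * u y s * kernel_Y \<alpha> Z (x - y) (t - s))"
  have [measurable]: "G \<in> borel_measurable borel" unfolding G_def by measurable
  have "AE y in lborel. \<forall>t>0. kernel_Y \<alpha> Z (x - y) t = y_kernel t (x - y)"
    by (rule lborel_AE_reflect [OF kernel_Y_eq [OF Z]])
  then have "AE z in (lborel :: ('a \<times> real) measure). \<forall>t>0. kernel_Y \<alpha> Z (x - fst z) t = y_kernel t (x - fst z)"
    by (rule lborel_AE_fst)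
  with uv have FG: "AE z in lborel. indicator {0<..<t} (snd z) * integrand (fst z) (snd z) = G z"
    by eventually_elim (auto simp: integrand_def G_def indicator_def)
  have ind: "indicator (UNIV \<times> {0<..<t}) z *\<^sub>R (\<lambda>(y, s). integrand y s) z = indicator {0<..<t} (snd z) * integrand (fst z) (snd z)" for z
    by (auto simp: indicator_def split_beta mem_Times_iff)
  have "integrable lebesgue (\<lambda>z. indicator {0<..<t} (snd z) * integrand (fst z) (snd z))"
    using int unfolding set_integrable_def integrand_def [symmetric] ind .
  then show Gi: "integrable lborel G"
    using lebesgue_AE_eq_borel(2) [OF _ FG] by simp
  have Gi': "integrable (lborel \<Otimes>\<^sub>M lborel) (case_prod (\<lambda>y s. G (y, s)))" using Gi by (simp add: lborel_prod)
  have "(LINT s:{0<..<t}|lebesgue. LINT y|lebesgue. integrand y s) = (LINT s|lborel. LINT y|lborel. G (y, s))"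
    unfolding set_lebesgue_integral_def
  proof (rule lebesgue_AE_eq_borel(3))
    show "(\<lambda>s. LINT y|lborel. G (y, s)) \<in> borel_measurable borel" by measurable
    show "AE s in lborel. indicat_real {0<..<t} s *\<^sub>R (LINT y|lebesgue. integrand y s) = (LINT y|lborel. G (y, s))"
      using lborel_AE_pair(2) [OF FG]
    proof eventually_elim
      case (elim s)
      show ?case
      proof (cases "s \<in> {0<..<t}")
        case True
        have "(LINT y|lebesgue. integrand y s) = (LINT y|lborel. G (y, s))"
          by (rule lebesgue_AE_eq_borel(3)) (measurable, use elim True in simp)
        then show ?thesis using True by simp
      qed (simp add: G_def)
    qed
  qed
  also have "\<dots> = (LINT z|lborel. G z)"
    using lborel_pair.integral_snd [OF Gi'] by (simp add: lborel_prod)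
  finally show "(LINT s:{0<..<t}|lebesgue. LINT y|lebesgue. \<bar>u y s\<bar> powr (p - 1) * u y s * kernel_Y \<alpha> Z (x - y) (t - s)) = (LINT z|lborel. G z)"
    by (simp add: integrand_def)
qed

text \<open>
  The linear terms cancel.  The points \<open>P\<close> of the triple integral are \<open>((s, \<tau>), y)\<close>, in an order that
  lets the integral in \<open>y\<close> be carried out first.
\<close>
proposition duhamel_difference:
  fixes Z u1 u2 :: "'a::euclidean_space \<Rightarrow> real \<Rightarrow> real" and v1 v2 :: "'a \<times> real \<Rightarrow> real"
  assumes Z: "fundamental_solution \<alpha> \<beta> Z" and p: "1 \<le> p"
    and v: "v1 \<in> borel_measurable borel" "v2 \<in> borel_measurable borel"
    and uv: "AE z in lborel. snd z \<in> {0<..<t} \<longrightarrow> u1 (fst z) (snd z) = v1 z"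
      "AE z in lborel. snd z \<in> {0<..<t} \<longrightarrow> u2 (fst z) (snd z) = v2 z"
    and duh: "duhamel_identity \<alpha> p q Z u0 u1 t" "duhamel_identity \<alpha> p q Z u0 u2 t"
  defines "w \<equiv> \<lambda>z. \<bar>v1 z - v2 z\<bar> * max \<bar>v1 z\<bar> \<bar>v2 z\<bar> powr (p - 1)"
  shows "AE x in lborel. ennreal \<bar>u1 x t - u2 x t\<bar>
    \<le> (\<integral>\<^sup>+P. ennreal (p * (abs_subordinator t (fst P) * gauss (snd (fst P)) (x - snd P) * w (snd P, fst (fst P)))) \<partial>lborel)"
proof -
  note [measurable] = v
  have w0: "0 \<le> w z" for z by (simp add: w_def)
  have [measurable]: "w \<in> borel_measurable borel" unfolding w_def by measurable
  have "AE x in lborel.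
        set_integrable lebesgue (UNIV \<times> {0<..<t}) (\<lambda>(y, s). \<bar>u y s\<bar> powr (p - 1) * u y s * kernel_Y \<alpha> Z (x - y) (t - s)) \<and>
        u x t = (LINT y|lebesgue. u0 y * Z (x - y) t) +
          (LINT s:{0<..<t}|lebesgue. LINT y|lebesgue. \<bar>u y s\<bar> powr (p - 1) * u y s * kernel_Y \<alpha> Z (x - y) (t - s))"
    if "duhamel_identity \<alpha> p q Z u0 u t" for u
    using that unfolding duhamel_identity_def AE_completion_iff by (auto elim!: eventually_mono)
  from this [OF duh(1)] this [OF duh(2)] show ?thesis
  proof eventually_elim
    case (elim x)
    define G where "G = (\<lambda>v z. indicator {0<..<t} (snd z) * (\<bar>v z\<bar> powr (p - 1) * v z * y_kernel (t - snd z) (x - fst z)))"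
    have [measurable]: "G v1 \<in> borel_measurable borel" "G v2 \<in> borel_measurable borel" unfolding G_def by measurable
    have i: "integrable lborel (G v1)" "integrable lborel (G v2)"
      unfolding G_def using elim by (auto intro!: duhamel_borel_form(1) [OF Z _ uv(1)] duhamel_borel_form(1) [OF Z _ uv(2)] v)
    have e: "(LINT s:{0<..<t}|lebesgue. LINT y|lebesgue. \<bar>u1 y s\<bar> powr (p - 1) * u1 y s * kernel_Y \<alpha> Z (x - y) (t - s)) = (LINT z|lborel. G v1 z)"
      "(LINT s:{0<..<t}|lebesgue. LINT y|lebesgue. \<bar>u2 y s\<bar> powr (p - 1) * u2 y s * kernel_Y \<alpha> Z (x - y) (t - s)) = (LINT z|lborel. G v2 z)"
      unfolding G_def
      by (rule duhamel_borel_form(2) [OF Z v(1) uv(1)], use elim in simp)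
         (rule duhamel_borel_form(2) [OF Z v(2) uv(2)], use elim in simp)
    have "u1 x t - u2 x t = (LINT z|lborel. G v1 z - G v2 z)"
      using elim e i by simp
    then have "ennreal \<bar>u1 x t - u2 x t\<bar> \<le> (\<integral>\<^sup>+z. ennreal (norm (G v1 z - G v2 z)) \<partial>lborel)"
      using integral_norm_bound_ennreal [OF Bochner_Integration.integrable_diff [OF i]] by simp
    also have "\<dots> \<le> (\<integral>\<^sup>+z. \<integral>\<^sup>+\<tau>. ennreal (p * (abs_subordinator t (snd z, \<tau>) * gauss \<tau> (x - fst z) * w z)) \<partial>lborel \<partial>lborel)"
    proof (rule nn_integral_mono)
      fix z :: "'a \<times> real"
      define A where "A = indicator {0<..<t} (snd z) * (p * w z)"
      have A: "0 \<le> A" using p w0 by (simp add: A_def)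
      have "norm (G v1 z - G v2 z) = indicator {0<..<t} (snd z) * (\<bar>\<bar>v1 z\<bar> powr (p - 1) * v1 z - \<bar>v2 z\<bar> powr (p - 1) * v2 z\<bar> * \<bar>y_kernel (t - snd z) (x - fst z)\<bar>)"
        by (simp add: G_def abs_mult flip: left_diff_distrib right_diff_distrib)
      also have "\<dots> \<le> A * \<bar>y_kernel (t - snd z) (x - fst z)\<bar>"
        unfolding A_def w_def mult.assoc
        using power_nonlinearity_lipschitz [OF p, of "v1 z" "v2 z"]
        by (intro mult_left_mono) (auto simp flip: mult.assoc intro!: mult_right_mono)
      finally have "ennreal (norm (G v1 z - G v2 z)) \<le> ennreal A * ennreal \<bar>y_kernel (t - snd z) (x - fst z)\<bar>"
        using A by (simp add: ennreal_leI flip: ennreal_mult)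
      also have "\<dots> \<le> ennreal A * (\<integral>\<^sup>+\<tau>. ennreal (indicator {0<..} \<tau> * (norm (subordinator (t - snd z) \<tau>) * gauss \<tau> (x - fst z))) \<partial>lborel)"
        by (intro mult_left_mono abs_y_kernel_le) auto
      also have "\<dots> = (\<integral>\<^sup>+\<tau>. ennreal A * ennreal (indicator {0<..} \<tau> * (norm (subordinator (t - snd z) \<tau>) * gauss \<tau> (x - fst z))) \<partial>lborel)"
        by (rule nn_integral_cmult [symmetric]) measurable
      also have "\<dots> = (\<integral>\<^sup>+\<tau>. ennreal (p * (abs_subordinator t (snd z, \<tau>) * gauss \<tau> (x - fst z) * w z)) \<partial>lborel)"
        using A by (intro nn_integral_cong) (simp add: ennreal_mult' [symmetric] A_def abs_subordinator_def mult_ac)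
      finally show "ennreal (norm (G v1 z - G v2 z)) \<le> (\<integral>\<^sup>+\<tau>. ennreal (p * (abs_subordinator t (snd z, \<tau>) * gauss \<tau> (x - fst z) * w z)) \<partial>lborel)" .
    qed
    also have "\<dots> = (\<integral>\<^sup>+P. ennreal (p * (abs_subordinator t (fst P) * gauss (snd (fst P)) (x - snd P) * w (snd P, fst (fst P)))) \<partial>lborel)"
      using nn_integral_lborel_triple [of "\<lambda>P. ennreal (p * (abs_subordinator t (fst P) * gauss (snd (fst P)) (x - snd P) * w (snd P, fst (fst P))))"]
      by simp
    finally show ?case .
  qed
qed

end

section \<open>The contraction estimate\<close>

text \<open>
  The bound \<open>\<parallel>f\<parallel>\<^sub>q \<le> b\<close>, written with an integral that has a meaning for every function.  It depends on
  the almost everywhere class of \<open>f\<close> only, so that solutions and their Borel representatives can be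
  exchanged freely.
\<close>
definition Lq_le :: "ereal \<Rightarrow> ('a::euclidean_space \<Rightarrow> real) \<Rightarrow> real \<Rightarrow> bool" where
  "Lq_le q f b \<longleftrightarrow> (if q = \<infinity> then AE x in lborel. \<bar>f x\<bar> \<le> b
     else (\<integral>\<^sup>+x. ennreal (\<bar>f x\<bar> powr real_of_ereal q) \<partial>lborel) \<le> ennreal (b powr real_of_ereal q))"

lemma Lq_le_cong:
  assumes "AE x in lborel. f x = g x"
  shows "Lq_le q f b \<longleftrightarrow> Lq_le q g b"
proof -
  have "(\<integral>\<^sup>+x. ennreal (\<bar>f x\<bar> powr real_of_ereal q) \<partial>lborel) = (\<integral>\<^sup>+x. ennreal (\<bar>g x\<bar> powr real_of_ereal q) \<partial>lborel)"
    using assms by (intro nn_integral_cong_AE) (auto elim: eventually_mono)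
  moreover have "(AE x in lborel. \<bar>f x\<bar> \<le> b) \<longleftrightarrow> (AE x in lborel. \<bar>g x\<bar> \<le> b)"
  proof
    show "AE x in lborel. \<bar>g x\<bar> \<le> b" if "AE x in lborel. \<bar>f x\<bar> \<le> b"
      using that assms by eventually_elim simp
    show "AE x in lborel. \<bar>f x\<bar> \<le> b" if "AE x in lborel. \<bar>g x\<bar> \<le> b"
      using that assms by eventually_elim simp
  qed
  ultimately show ?thesis by (simp add: Lq_le_def)
qed

lemma Lq_le_mono:
  assumes "Lq_le q f b" "0 \<le> b" "b \<le> b'" "0 \<le> q"
  shows "Lq_le q f b'"
proof (cases "q = \<infinity>")
  case True
  then show ?thesis using assms by (auto simp: Lq_le_def elim!: eventually_mono)
next
  case False
  have "b powr real_of_ereal q \<le> b' powr real_of_ereal q"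
    using assms by (intro powr_mono2 real_of_ereal_pos) auto
  then show ?thesis using assms False by (auto simp: Lq_le_def intro: order_trans ennreal_leI)
qed

lemma Lq_le_of_norm:
  fixes f :: "'a::euclidean_space \<Rightarrow> real"
  assumes f: "Lq q f" and le: "Lq_norm q f \<le> b" and q: "0 < q"
  shows "Lq_le q f b"
proof (cases "q = \<infinity>")
  case True
  obtain C where C: "AE x in lebesgue. \<bar>f x\<bar> \<le> C" using f True by (auto simp: Lq_def)
  have fm: "f \<in> borel_measurable lebesgue" using f by (simp add: Lq_def)
  define e where "e = esssup lebesgue (\<lambda>x. ereal \<bar>f x\<bar>)"
  have 1: "AE x in lebesgue. ereal \<bar>f x\<bar> \<le> e" unfolding e_def by (rule esssup_AE)
  have "e \<le> ereal C"
    unfolding e_def using C fm by (intro esssup_I) (auto elim: eventually_mono)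
  then have "AE x in lebesgue. \<bar>f x\<bar> \<le> real_of_ereal e"
    using 1 by (cases e) (auto elim!: eventually_mono)
  moreover have "real_of_ereal e \<le> b" using le True by (simp add: Lq_norm_def e_def)
  ultimately show ?thesis using True
    by (auto simp: Lq_le_def AE_completion_iff elim!: eventually_mono)
next
  case False
  then obtain r where r: "q = ereal r" "0 < r" using q by (cases q) auto
  have i: "integrable lebesgue (\<lambda>x. \<bar>f x\<bar> powr r)" using f r by (simp add: Lq_def)
  have n: "(LINT x|lebesgue. \<bar>f x\<bar> powr r) powr (1 / r) \<le> b" using le r by (simp add: Lq_norm_def)
  have "(LINT x|lebesgue. \<bar>f x\<bar> powr r) = ((LINT x|lebesgue. \<bar>f x\<bar> powr r) powr (1 / r)) powr r"
    using r by (simp add: powr_powr)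
  also have "\<dots> \<le> b powr r" using n r by (intro powr_mono2) auto
  finally have "(\<integral>\<^sup>+x. ennreal (\<bar>f x\<bar> powr r) \<partial>lebesgue) \<le> ennreal (b powr r)"
    using nn_integral_eq_integral [OF i] by (simp add: ennreal_leI)
  then show ?thesis using r by (simp add: Lq_le_def nn_integral_completion)
qed

text \<open>
  The factor \<open>4\<close> comes from \<open>|a - b|\<^sup>q \<le> 2\<^sup>q (|a|\<^sup>q + |b|\<^sup>q)\<close> and \<open>2 \<le> 2\<^sup>q\<close>.
\<close>
lemma Lq_le_diff:
  fixes f g :: "'a::euclidean_space \<Rightarrow> real"
  assumes [measurable]: "f \<in> borel_measurable borel" "g \<in> borel_measurable borel"
    and f: "Lq_le q f b" and g: "Lq_le q g b" and q: "1 \<le> q" and b: "0 \<le> b"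
  shows "Lq_le q (\<lambda>x. f x - g x) (4 * b)"
proof (cases "q = \<infinity>")
  case True
  have "AE x in lborel. \<bar>f x\<bar> \<le> b" "AE x in lborel. \<bar>g x\<bar> \<le> b" using f g True by (auto simp: Lq_le_def)
  then have "AE x in lborel. \<bar>f x - g x\<bar> \<le> 4 * b"
    by eventually_elim (use b in linarith)
  then show ?thesis using True by (simp add: Lq_le_def)
next
  case False
  then obtain r where r: "q = ereal r" "1 \<le> r" using q by (cases q) (auto simp: one_ereal_def)
  have le: "\<bar>a - c\<bar> powr r \<le> 2 powr r * (\<bar>a\<bar> powr r + \<bar>c\<bar> powr r)" for a c :: real
  proof -
    have "\<bar>a - c\<bar> powr r \<le> (2 * max \<bar>a\<bar> \<bar>c\<bar>) powr r" using r by (intro powr_mono2) auto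
    also have "\<dots> = 2 powr r * max \<bar>a\<bar> \<bar>c\<bar> powr r" by (rule powr_mult)
    also have "\<dots> \<le> 2 powr r * (\<bar>a\<bar> powr r + \<bar>c\<bar> powr r)" by (intro mult_left_mono) (auto simp: max_def)
    finally show ?thesis .
  qed
  have "(\<integral>\<^sup>+x. ennreal (\<bar>f x - g x\<bar> powr r) \<partial>lborel) \<le> (\<integral>\<^sup>+x. ennreal (2 powr r) * (ennreal (\<bar>f x\<bar> powr r) + ennreal (\<bar>g x\<bar> powr r)) \<partial>lborel)"
    using le by (intro nn_integral_mono) (simp flip: ennreal_mult ennreal_plus add: ennreal_leI)
  also have "\<dots> = ennreal (2 powr r) * ((\<integral>\<^sup>+x. ennreal (\<bar>f x\<bar> powr r) \<partial>lborel) + (\<integral>\<^sup>+x. ennreal (\<bar>g x\<bar> powr r) \<partial>lborel))"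
    by (simp add: nn_integral_cmult nn_integral_add)
  also have "\<dots> \<le> ennreal (2 powr r) * (ennreal (b powr r) + ennreal (b powr r))"
    using f g r by (intro mult_left_mono add_mono) (auto simp: Lq_le_def)
  also have "\<dots> = ennreal (2 powr r * (2 powr 1 * b powr r))"
    by (simp flip: ennreal_mult ennreal_plus)
  also have "\<dots> \<le> ennreal ((4 * b) powr r)"
  proof (rule ennreal_leI)
    have "2 powr r * (2 powr 1 * b powr r) \<le> 2 powr r * (2 powr r * b powr r)"
      using r by (intro mult_left_mono mult_right_mono powr_mono) auto
    also have "\<dots> = (4 * b) powr r" using b powr_mult [of 2 2 r] by (simp add: powr_mult)
    finally show "2 powr r * (2 powr 1 * b powr r) \<le> (4 * b) powr r" .
  qed
  finally show ?thesis using r by (simp add: Lq_le_def)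
qed

lemma AE_zero_if_Lq_le:
  fixes f :: "'a::euclidean_space \<Rightarrow> real"
  assumes f: "f \<in> borel_measurable lebesgue" and q: "0 < q"
    and le: "\<And>n. Lq_le q f (b n)" and b: "b \<longlonglongrightarrow> 0" "\<And>n. 0 \<le> b n"
  shows "AE x in lborel. f x = 0"
proof (cases "q = \<infinity>")
  case True
  have "AE x in lborel. \<forall>n. \<bar>f x\<bar> \<le> b n" using le True by (simp add: Lq_le_def AE_all_countable)
  then show ?thesis
  proof eventually_elim
    case (elim x)
    then have "\<bar>f x\<bar> \<le> 0" using b(1) by (intro LIMSEQ_le_const) auto
    then show ?case by simp
  qed
next
  case False
  then obtain r where r: "q = ereal r" "0 < r" using q by (cases q) auto
  define I where "I = (\<integral>\<^sup>+x. ennreal (\<bar>f x\<bar> powr r) \<partial>lborel)"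
  have I: "I \<le> ennreal (b n powr r)" for n using le [of n] r by (simp add: Lq_le_def I_def)
  have "(\<lambda>n. b n powr r) \<longlonglongrightarrow> 0 powr r"
    using b r by (intro tendsto_powr' tendsto_const) auto
  then have "(\<lambda>n. ennreal (b n powr r)) \<longlonglongrightarrow> ennreal 0" using r by (intro tendsto_ennrealI) simp
  then have "I \<le> 0" using I by (intro LIMSEQ_le_const [of _ "0::ennreal"]) auto
  then have "(\<integral>\<^sup>+x. ennreal (\<bar>f x\<bar> powr r) \<partial>lebesgue) = 0" by (simp add: I_def nn_integral_completion)
  then have "AE x in lebesgue. ennreal (\<bar>f x\<bar> powr r) = 0"
    using f by (subst (asm) nn_integral_0_iff_AE) auto
  then show ?thesis unfolding AE_completion_iff
    by eventually_elim (auto simp: ennreal_eq_0_iff)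
qed

lemma gauss_mult_powr_le:
  assumes "0 < \<tau>"
  shows "gauss \<tau> (x::'a::euclidean_space) * \<tau> powr (real DIM('a) / 2) \<le> 1"
proof -
  have "\<tau> powr (real DIM('a) / 2) = (\<tau> powr (1 / 2)) powr real DIM('a)" by (simp add: powr_powr)
  then have 1: "\<tau> powr (real DIM('a) / 2) = sqrt \<tau> ^ DIM('a)"
    using assms by (simp add: powr_half_sqrt powr_realpow)
  have "1 * \<tau> \<le> (4 * pi) * \<tau>" using assms pi_ge_two by (intro mult_right_mono) auto
  then have 2: "sqrt \<tau> \<le> sqrt (4 * pi * \<tau>)" by (intro real_sqrt_le_mono) simp
  have "gauss \<tau> x * sqrt \<tau> ^ DIM('a) \<le> 1 / sqrt (4 * pi * \<tau>) ^ DIM('a) * sqrt (4 * pi * \<tau>) ^ DIM('a)"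
    unfolding gauss_def using assms 2 by (intro mult_mono divide_right_mono power_mono) auto
  then show ?thesis using assms by (simp add: 1)
qed

lemma gauss_nn_integral_shift:
  assumes "0 < \<tau>"
  shows "(\<integral>\<^sup>+y. ennreal (gauss \<tau> (x - y :: 'a::euclidean_space)) \<partial>lborel) = 1"
    and "(\<integral>\<^sup>+x. ennreal (gauss \<tau> (x - y :: 'a)) \<partial>lborel) = 1"
proof -
  show 1: "(\<integral>\<^sup>+y. ennreal (gauss \<tau> (x - y :: 'a)) \<partial>lborel) = 1" for x
    using nn_integral_lborel_reflect [of "\<lambda>y. ennreal (gauss \<tau> (y::'a))" x] gauss_nn_integral [OF assms, where 'a = 'a] by simp
  have "gauss \<tau> (x - y) = gauss \<tau> (y - x)" for x y :: 'a by (simp add: gauss_def norm_minus_commute)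
  then show "(\<integral>\<^sup>+x. ennreal (gauss \<tau> (x - y :: 'a)) \<partial>lborel) = 1" using 1 [of y] by simp
qed

context subdiffusion_kernel
begin

text \<open>
  For \<open>q = \<infinity>\<close> the difference of the nonlinear terms is at most \<open>p M\<^sup>p\<^sup>-\<^sup>1\<close> times \<open>B e\<^sup>\<rho>\<^sup>s\<close>, and the heat
  kernels have mass \<open>1\<close>.  For finite \<open>q\<close> the three-factor Hoelder inequality is applied at each \<open>x\<close>
  with respect to the measure \<open>|m(t-s,\<tau>)| G\<^sub>\<tau>(x - y) e\<^sup>\<rho>\<^sup>s \<tau>\<^sup>-\<^sup>\<delta>\<close> on the points \<open>(s, \<tau>, y)\<close>, to the factors
  \<open>a = p |w| e\<^sup>-\<^sup>\<rho>\<^sup>s\<close> and \<open>b = U \<tau>\<^sup>N\<^sup>/\<^sup>(\<^sup>2\<^sup>q\<^sup>)\<close> with \<open>U = max(|u\<^sub>1|,|u\<^sub>2|)\<close>.  Since \<open>G\<^sub>\<tau> \<tau>\<^sup>N\<^sup>/\<^sup>2 \<le> 1\<close>, the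
  integral of \<open>b\<^sup>q\<close> is bounded uniformly in \<open>x\<close>, while that of \<open>a\<^sup>q\<close> is integrated over \<open>x\<close> afterwards,
  where \<open>G\<^sub>\<tau>\<close> has mass \<open>1\<close> again.  The weights cancel exactly for \<open>\<delta> = N(p-1)/(2q)\<close>, and
  \<open>\<delta> < \<beta>\<close> says that \<open>q > N(p-1)/(2\<beta>)\<close>.
\<close>
proposition duhamel_contraction:
  fixes Z :: "'a::euclidean_space \<Rightarrow> real \<Rightarrow> real"
  assumes Z: "fundamental_solution \<alpha> \<beta> Z" and p: "1 \<le> p" and pq: "ereal p \<le> q"
    and sub: "ereal (real DIM('a) / (2 * \<beta>) * (p - 1)) < q" and M: "0 < M"
  obtains \<rho> where "0 < \<rho>"
    "\<And>u1 u2 u0 v1 v2 t B. 0 < t \<Longrightarrow> 0 < B \<Longrightarrow>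
      v1 \<in> borel_measurable borel \<Longrightarrow> v2 \<in> borel_measurable borel \<Longrightarrow>
      AE z in lborel. snd z \<in> {0<..<t} \<longrightarrow> u1 (fst z) (snd z) = v1 z \<Longrightarrow>
      AE z in lborel. snd z \<in> {0<..<t} \<longrightarrow> u2 (fst z) (snd z) = v2 z \<Longrightarrow>
      duhamel_identity \<alpha> p q Z u0 u1 t \<Longrightarrow> duhamel_identity \<alpha> p q Z u0 u2 t \<Longrightarrow>
      AE s in lborel. s \<in> {0<..<t} \<longrightarrow> Lq_le q (\<lambda>y. v1 (y, s)) M \<and> Lq_le q (\<lambda>y. v2 (y, s)) M
        \<and> Lq_le q (\<lambda>y. v1 (y, s) - v2 (y, s)) (B * exp (\<rho> * s)) \<Longrightarrow>
      Lq_le q (\<lambda>x. u1 x t - u2 x t) (B / 2 * exp (\<rho> * t))"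
proof -
  define \<delta> where "\<delta> = (if q = \<infinity> then 0 else real DIM('a) * (p - 1) / (2 * real_of_ereal q))"
  \<comment> \<open>A bound for the integral of \<open>U\<^sup>q\<close>, followed by the resulting factor in front of the mass.\<close>
  define D where "D = 2 * M powr real_of_ereal q"
  define C where "C = (if q = \<infinity> then p * M powr (p - 1) else p * D powr ((p - 1) / real_of_ereal q))"
  have D: "0 < D" using M by (simp add: D_def)
  have C: "0 < C" using p M D by (simp add: C_def)
  have \<delta>: "0 \<le> \<delta>" "\<delta> < \<beta>"
  proof -
    have "0 \<le> \<delta> \<and> \<delta> < \<beta>"
    proof (cases "q = \<infinity>")
      case False
      then obtain r where r: "q = ereal r" "p \<le> r" using pq by (cases q) auto
      then have "real DIM('a) / (2 * \<beta>) * (p - 1) < r" using sub by simp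
      then have "real DIM('a) * (p - 1) < r * (2 * \<beta>)" using \<beta> by (simp add: field_simps)
      then have "real DIM('a) * (p - 1) / (2 * r) < \<beta>" using r p by (simp add: field_simps)
      then show ?thesis using r p by (simp add: \<delta>_def)
    qed (use \<beta> in \<open>simp add: \<delta>_def\<close>)
    then show "0 \<le> \<delta>" "\<delta> < \<beta>" by auto
  qed
  obtain \<kappa>0 where \<kappa>0: "\<And>\<rho>. 0 < \<rho> \<Longrightarrow> 0 < \<kappa>0 \<rho>" "(\<kappa>0 \<longlongrightarrow> 0) at_top"
    "\<And>\<rho> t. 0 < \<rho> \<Longrightarrow> 0 < t \<Longrightarrow> (\<integral>\<^sup>+r. ennreal (abs_subordinator t r * (exp (\<rho> * fst r) * snd r powr (- \<delta>))) \<partial>lborel) \<le> ennreal (exp (\<rho> * t) * \<kappa>0 \<rho>)"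
    by (rule abs_subordinator_mass [OF \<delta>]) blast
  \<comment> \<open>A large \<open>\<rho>\<close> makes the mass small enough for the factor \<open>1/2\<close>.\<close>
  have "\<forall>\<^sub>F \<rho> in at_top. \<kappa>0 \<rho> < 1 / (2 * C) \<and> 0 < \<rho>"
    using order_tendstoD(2) [OF \<kappa>0(2), of "1 / (2 * C)"] C eventually_gt_at_top [of "0::real"]
    by (intro eventually_conj) auto
  then obtain \<rho> where \<rho>: "\<kappa>0 \<rho> < 1 / (2 * C)" "0 < \<rho>"
    using eventually_happens'[OF trivial_limit_at_top_linorder] by blast
  have \<rho>C: "\<kappa>0 \<rho> * C \<le> 1 / 2" using \<rho> C by (simp add: field_simps)
  show ?thesis
  proof (rule that [OF \<rho>(2)])
    fix u1 u2 :: "'a \<Rightarrow> real \<Rightarrow> real" and u0 v1 v2 t and B :: real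
    assume t: "0 < t" and B: "0 < B" and v: "v1 \<in> borel_measurable borel" "v2 \<in> borel_measurable borel"
      and uv: "AE z in lborel. snd z \<in> {0<..<t} \<longrightarrow> u1 (fst z) (snd z) = v1 z"
        "AE z in lborel. snd z \<in> {0<..<t} \<longrightarrow> u2 (fst z) (snd z) = v2 z"
      and duh: "duhamel_identity \<alpha> p q Z u0 u1 t" "duhamel_identity \<alpha> p q Z u0 u2 t"
      and ae: "AE s in lborel. s \<in> {0<..<t} \<longrightarrow> Lq_le q (\<lambda>y. v1 (y, s)) M \<and> Lq_le q (\<lambda>y. v2 (y, s)) M
        \<and> Lq_le q (\<lambda>y. v1 (y, s) - v2 (y, s)) (B * exp (\<rho> * s))"
    note [measurable] = v
    define \<kappa> where "\<kappa> = exp (\<rho> * t) * \<kappa>0 \<rho>"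
    have \<kappa>: "0 < \<kappa>" using \<kappa>0(1) [OF \<rho>(2)] by (simp add: \<kappa>_def)
    have \<kappa>C: "\<kappa> * C \<le> exp (\<rho> * t) / 2"
      using mult_left_mono [OF \<rho>C, of "exp (\<rho> * t)"] by (simp add: \<kappa>_def mult.assoc)
    define k where "k = (\<lambda>r. abs_subordinator t r * (exp (\<rho> * fst r) * snd r powr (- \<delta>)))"
    have [measurable]: "k \<in> borel_measurable borel" unfolding k_def by measurable
    have k0: "0 \<le> k r" for r using abs_subordinator_nonneg by (simp add: k_def)
    have kz: "k r = 0" "abs_subordinator t r = 0" if "\<not> (0 < fst r \<and> fst r < t \<and> 0 < snd r)" for r
      using that by (auto simp: k_def abs_subordinator_def indicator_def)
    have mass: "(\<integral>\<^sup>+r. ennreal (k r) \<partial>lborel) \<le> ennreal \<kappa>"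
      unfolding k_def \<kappa>_def by (rule \<kappa>0(3) [OF \<rho>(2) t])
    have kg0: "0 \<le> k r * gauss (snd r) y" for r and y :: 'a
      using k0 [of r] kz(1) [of r] gauss_nonneg [of "snd r" y] by (cases "0 < snd r") auto
    have kgauss: "(\<integral>\<^sup>+y. ennreal (k r * gauss (snd r) (x - y)) \<partial>lborel) = ennreal (k r)"
      "(\<integral>\<^sup>+x. ennreal (k r * gauss (snd r) (x - y)) \<partial>lborel) = ennreal (k r)" for r and x y :: 'a
    proof -
      have *: "ennreal (k r * gauss (snd r) y) = ennreal (k r) * ennreal (gauss (snd r) y)" for y :: 'a
        using k0 by (rule ennreal_mult')
      show "(\<integral>\<^sup>+y. ennreal (k r * gauss (snd r) (x - y)) \<partial>lborel) = ennreal (k r)"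
        "(\<integral>\<^sup>+x. ennreal (k r * gauss (snd r) (x - y)) \<partial>lborel) = ennreal (k r)"
        unfolding * by (cases "0 < snd r"; simp add: nn_integral_cmult gauss_nn_integral_shift kz)+
    qed
    have massx: "(\<integral>\<^sup>+P. ennreal (k (fst P) * gauss (snd (fst P)) (x - snd P)) \<partial>lborel) \<le> ennreal \<kappa>" for x :: 'a
      using mass by (subst nn_integral_lborel_pair(1)) (simp_all add: kgauss)
    define U where "U = (\<lambda>z. max \<bar>v1 z\<bar> \<bar>v2 z\<bar>)"
    have [measurable]: "U \<in> borel_measurable borel" unfolding U_def by measurable
    have U0: "0 \<le> U z" for z by (simp add: U_def)
    have dd: "AE x in lborel. ennreal \<bar>u1 x t - u2 x t\<bar>
      \<le> (\<integral>\<^sup>+P. ennreal (p * (abs_subordinator t (fst P) * gauss (snd (fst P)) (x - snd P) * (\<bar>v1 (snd P, fst (fst P)) - v2 (snd P, fst (fst P))\<bar> * U (snd P, fst (fst P)) powr (p - 1)))) \<partial>lborel)"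
      using duhamel_difference [OF Z p v uv duh] by (simp add: U_def)
    have aer: "AE r in (lborel :: (real \<times> real) measure). fst r \<in> {0<..<t} \<longrightarrow> Lq_le q (\<lambda>y. v1 (y, fst r)) M \<and> Lq_le q (\<lambda>y. v2 (y, fst r)) M
        \<and> Lq_le q (\<lambda>y. v1 (y, fst r) - v2 (y, fst r)) (B * exp (\<rho> * fst r))"
      by (rule lborel_AE_fst [OF ae])
    show "Lq_le q (\<lambda>x. u1 x t - u2 x t) (B / 2 * exp (\<rho> * t))"
    proof (cases "q = \<infinity>")
      case True
      have ae2: "AE r in (lborel :: (real \<times> real) measure). AE y in (lborel :: 'a measure). fst r \<in> {0<..<t} \<longrightarrow>
          \<bar>v1 (y, fst r) - v2 (y, fst r)\<bar> \<le> B * exp (\<rho> * fst r) \<and> U (y, fst r) \<le> M"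
        using aer
      proof eventually_elim
        case (elim r)
        show ?case
        proof (cases "fst r \<in> {0<..<t}")
          case in_t: True
          with elim have "AE y in lborel. \<bar>v1 (y, fst r)\<bar> \<le> M" "AE y in lborel. \<bar>v2 (y, fst r)\<bar> \<le> M"
            "AE y in lborel. \<bar>v1 (y, fst r) - v2 (y, fst r)\<bar> \<le> B * exp (\<rho> * fst r)"
            using True by (auto simp: Lq_le_def)
          then show ?thesis by eventually_elim (auto simp: U_def)
        qed auto
      qed
      have aeP: "AE P in (lborel :: ((real \<times> real) \<times> 'a) measure). fst (fst P) \<in> {0<..<t} \<longrightarrow>
          \<bar>v1 (snd P, fst (fst P)) - v2 (snd P, fst (fst P))\<bar> \<le> B * exp (\<rho> * fst (fst P)) \<and> U (snd P, fst (fst P)) \<le> M"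
      proof (rule lborel_AE_pairI)
        show "{P :: (real \<times> real) \<times> 'a. fst (fst P) \<in> {0<..<t} \<longrightarrow>
          \<bar>v1 (snd P, fst (fst P)) - v2 (snd P, fst (fst P))\<bar> \<le> B * exp (\<rho> * fst (fst P)) \<and> U (snd P, fst (fst P)) \<le> M} \<in> sets borel"
          by measurable
      qed (use ae2 in simp)
      have \<delta>0: "\<delta> = 0" using True by (simp add: \<delta>_def)
      have "AE x in lborel. \<bar>u1 x t - u2 x t\<bar> \<le> B / 2 * exp (\<rho> * t)"
        using dd
      proof eventually_elim
        case (elim x)
        note elim
        also have "(\<integral>\<^sup>+P. ennreal (p * (abs_subordinator t (fst P) * gauss (snd (fst P)) (x - snd P) * (\<bar>v1 (snd P, fst (fst P)) - v2 (snd P, fst (fst P))\<bar> * U (snd P, fst (fst P)) powr (p - 1)))) \<partial>lborel)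
          \<le> (\<integral>\<^sup>+P. ennreal (k (fst P) * gauss (snd (fst P)) (x - snd P)) * ennreal (C * B) \<partial>lborel)"
        proof (rule nn_integral_mono_AE, use aeP in eventually_elim)
          case (elim P)
          show ?case
          proof (cases "0 < fst (fst P) \<and> fst (fst P) < t \<and> 0 < snd (fst P)")
            case True
            let ?z = "(snd P, fst (fst P))"
            have "\<bar>v1 ?z - v2 ?z\<bar> * U ?z powr (p - 1) \<le> (B * exp (\<rho> * fst (fst P))) * M powr (p - 1)"
              using elim True p B U0 by (intro mult_mono powr_mono2) auto
            then have "(p * (abs_subordinator t (fst P) * gauss (snd (fst P)) (x - snd P))) * (\<bar>v1 ?z - v2 ?z\<bar> * U ?z powr (p - 1))
               \<le> (p * (abs_subordinator t (fst P) * gauss (snd (fst P)) (x - snd P))) * ((B * exp (\<rho> * fst (fst P))) * M powr (p - 1))"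
              using p abs_subordinator_nonneg gauss_nonneg True by (intro mult_left_mono mult_nonneg_nonneg) auto
            also have "\<dots> = (k (fst P) * gauss (snd (fst P)) (x - snd P)) * (C * B)"
              using True \<open>q = \<infinity>\<close> by (simp add: k_def \<delta>0 C_def)
            finally show ?thesis using kg0 by (simp add: ennreal_mult' [symmetric] ennreal_leI mult.assoc)
          qed (simp add: kz)
        qed
        also have "\<dots> = (\<integral>\<^sup>+P. ennreal (k (fst P) * gauss (snd (fst P)) (x - snd P)) \<partial>lborel) * ennreal (C * B)"
          by (rule nn_integral_multc) measurable
        also have "\<dots> \<le> ennreal \<kappa> * ennreal (C * B)" by (intro mult_right_mono massx) auto
        also have "\<dots> = ennreal (\<kappa> * C * B)" using \<kappa> by (simp add: ennreal_mult' [symmetric] mult.assoc)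
        finally have "\<bar>u1 x t - u2 x t\<bar> \<le> \<kappa> * C * B"
          using \<kappa> C B by (simp add: ennreal_le_iff)
        also have "\<dots> \<le> (exp (\<rho> * t) / 2) * B" using \<kappa>C B by (intro mult_right_mono) auto
        finally show ?case by (simp add: mult.commute)
      qed
      then show ?thesis using True by (simp add: Lq_le_def)
    next
      case False
      then obtain r where r: "q = ereal r" "p \<le> r" using pq by (cases q) auto
      have r0: "0 < r" using r p by linarith
      have rq: "real_of_ereal q = r" using r by simp
      define a where "a = (\<lambda>P :: (real \<times> real) \<times> 'a. p * \<bar>v1 (snd P, fst (fst P)) - v2 (snd P, fst (fst P))\<bar> * exp (- \<rho> * fst (fst P)))"
      define b where "b = (\<lambda>P :: (real \<times> real) \<times> 'a. U (snd P, fst (fst P)) * snd (fst P) powr (real DIM('a) / (2 * r)))"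
      have [measurable]: "a \<in> borel_measurable borel" "b \<in> borel_measurable borel" unfolding a_def b_def by measurable
      have nn: "0 \<le> a P" "0 \<le> b P" for P using p U0 by (auto simp: a_def b_def)
      define kg where "kg = (\<lambda>x P. k (fst P) * gauss (snd (fst P)) (x - snd P :: 'a))"
      have [measurable]: "(\<lambda>z. kg (fst z) (snd z)) \<in> borel_measurable borel" "\<And>x. kg x \<in> borel_measurable borel"
        unfolding kg_def by measurable
      have kg: "0 \<le> kg x P" for x P using kg0 by (simp add: kg_def)
      have bint: "(\<integral>\<^sup>+P. ennreal (kg x P) * ennreal (b P powr r) \<partial>lborel) \<le> ennreal (D * \<kappa>)" for x
      proof -
        have "(\<integral>\<^sup>+P. ennreal (kg x P) * ennreal (b P powr r) \<partial>lborel) \<le> (\<integral>\<^sup>+P. ennreal (k (fst P)) * ennreal (U (snd P, fst (fst P)) powr r) \<partial>lborel)"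
        proof (rule nn_integral_mono)
          fix P :: "(real \<times> real) \<times> 'a"
          show "ennreal (kg x P) * ennreal (b P powr r) \<le> ennreal (k (fst P)) * ennreal (U (snd P, fst (fst P)) powr r)"
          proof (cases "0 < snd (fst P)")
            case True
            have "b P powr r = U (snd P, fst (fst P)) powr r * snd (fst P) powr (real DIM('a) / 2)"
              using U0 r0 by (simp add: b_def powr_mult powr_powr)
            then have "kg x P * b P powr r = (k (fst P) * U (snd P, fst (fst P)) powr r) * (gauss (snd (fst P)) (x - snd P) * snd (fst P) powr (real DIM('a) / 2))"
              by (simp add: kg_def)
            also have "\<dots> \<le> (k (fst P) * U (snd P, fst (fst P)) powr r) * 1"
              using k0 by (intro mult_left_mono gauss_mult_powr_le True) auto
            finally show ?thesis using kg k0 by (simp add: ennreal_mult' [symmetric] ennreal_leI)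
          qed (simp add: kg_def kz)
        qed
        also have "\<dots> = (\<integral>\<^sup>+r'. \<integral>\<^sup>+y. ennreal (k r') * ennreal (U (y, fst r') powr r) \<partial>lborel \<partial>lborel)"
          by (subst nn_integral_lborel_pair(1)) auto
        also have "\<dots> = (\<integral>\<^sup>+r'. ennreal (k r') * (\<integral>\<^sup>+y. ennreal (U (y, fst r') powr r) \<partial>lborel) \<partial>lborel)"
          by (intro nn_integral_cong nn_integral_cmult) measurable
        also have "\<dots> \<le> (\<integral>\<^sup>+r'. ennreal (k r') * ennreal D \<partial>lborel)"
        proof (rule nn_integral_mono_AE, use aer in eventually_elim)
          case (elim r')
          show ?case
          proof (cases "fst r' \<in> {0<..<t}")
            case True
            have "(\<integral>\<^sup>+y. ennreal (U (y, fst r') powr r) \<partial>lborel) \<le> (\<integral>\<^sup>+y. ennreal (\<bar>v1 (y, fst r')\<bar> powr r) + ennreal (\<bar>v2 (y, fst r')\<bar> powr r) \<partial>lborel)"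
              by (intro nn_integral_mono) (auto simp: U_def max_def simp flip: ennreal_plus)
            also have "\<dots> = (\<integral>\<^sup>+y. ennreal (\<bar>v1 (y, fst r')\<bar> powr r) \<partial>lborel) + (\<integral>\<^sup>+y. ennreal (\<bar>v2 (y, fst r')\<bar> powr r) \<partial>lborel)"
              by (rule nn_integral_add) measurable
            also have "\<dots> \<le> ennreal (M powr r) + ennreal (M powr r)"
              using elim True r by (intro add_mono) (auto simp: Lq_le_def)
            also have "\<dots> = ennreal D" by (simp add: D_def rq flip: ennreal_plus)
            finally show ?thesis by (rule mult_left_mono) simp
          next
            case False
            then have "k r' = 0" by (intro kz(1)) auto
            then show ?thesis by simp
          qed
        qed
        also have "\<dots> = (\<integral>\<^sup>+r'. ennreal (k r') \<partial>lborel) * ennreal D"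
          by (rule nn_integral_multc) measurable
        also have "\<dots> \<le> ennreal \<kappa> * ennreal D" by (intro mult_right_mono mass) auto
        finally show ?thesis using \<kappa> D by (simp add: ennreal_mult mult.commute)
      qed
      define H where "H = \<kappa> powr (r - 1) * D powr (p - 1)"
      have H: "0 < H" using \<kappa> D by (simp add: H_def)
      have pt: "AE x in lborel. ennreal (\<bar>u1 x t - u2 x t\<bar> powr r) \<le> (\<integral>\<^sup>+P. ennreal (kg x P) * ennreal (a P powr r) \<partial>lborel) * ennreal H"
        using dd
      proof eventually_elim
        case (elim x)
        let ?Mx = "density lborel (\<lambda>P. ennreal (kg x P))"
        have eq: "ennreal (p * (abs_subordinator t (fst P) * gauss (snd (fst P)) (x - snd P) * (\<bar>v1 (snd P, fst (fst P)) - v2 (snd P, fst (fst P))\<bar> * U (snd P, fst (fst P)) powr (p - 1))))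
          = ennreal (kg x P) * ennreal (a P * b P powr (p - 1))" for P
        proof (cases "0 < snd (fst P)")
          case True
          have e1: "real DIM('a) / (2 * r) * (p - 1) = \<delta>" using False rq by (simp add: \<delta>_def)
          have "b P powr (p - 1) = U (snd P, fst (fst P)) powr (p - 1) * snd (fst P) powr \<delta>"
            unfolding b_def by (simp only: powr_mult powr_powr e1)
          moreover have "snd (fst P) powr (- \<delta>) * snd (fst P) powr \<delta> = 1" using True by (simp flip: powr_add)
          moreover have "exp (\<rho> * fst (fst P)) * exp (- \<rho> * fst (fst P)) = 1" by (simp flip: exp_add)
          ultimately have "kg x P * (a P * b P powr (p - 1))
            = p * (abs_subordinator t (fst P) * gauss (snd (fst P)) (x - snd P) * (\<bar>v1 (snd P, fst (fst P)) - v2 (snd P, fst (fst P))\<bar> * U (snd P, fst (fst P)) powr (p - 1)))"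
          proof -
            assume A: "b P powr (p - 1) = U (snd P, fst (fst P)) powr (p - 1) * snd (fst P) powr \<delta>"
              and T: "snd (fst P) powr (- \<delta>) * snd (fst P) powr \<delta> = 1"
              and X: "exp (\<rho> * fst (fst P)) * exp (- \<rho> * fst (fst P)) = 1"
            have "kg x P * (a P * b P powr (p - 1))
              = p * (abs_subordinator t (fst P) * gauss (snd (fst P)) (x - snd P) * (\<bar>v1 (snd P, fst (fst P)) - v2 (snd P, fst (fst P))\<bar> * U (snd P, fst (fst P)) powr (p - 1)))
                * (exp (\<rho> * fst (fst P)) * exp (- \<rho> * fst (fst P))) * (snd (fst P) powr (- \<delta>) * snd (fst P) powr \<delta>)"
              unfolding kg_def k_def a_def A by (simp only: mult_ac)
            then show ?thesis unfolding T X by simp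
          qed
          then show ?thesis using kg by (simp add: ennreal_mult' [symmetric])
        qed (simp add: kg_def kz)
        have "ennreal (\<bar>u1 x t - u2 x t\<bar> powr r) \<le> (\<integral>\<^sup>+P. ennreal (a P powr r) \<partial>?Mx) * ennreal (\<kappa> powr (r - 1) * D powr (p - 1))"
        proof (rule holder_three [where b = b])
          show "(\<integral>\<^sup>+P. 1 \<partial>?Mx) \<le> ennreal \<kappa>"
            using massx [of x] by (subst nn_integral_density) (auto simp: kg_def)
          show "(\<integral>\<^sup>+P. ennreal (b P powr r) \<partial>?Mx) \<le> ennreal (D * \<kappa>)"
            using bint [of x] by (subst nn_integral_density) auto
          show "ennreal \<bar>u1 x t - u2 x t\<bar> \<le> (\<integral>\<^sup>+P. ennreal (a P * b P powr (p - 1)) \<partial>?Mx)"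
            using elim unfolding eq by (subst nn_integral_density) auto
        qed (use nn p r \<kappa> D in auto)
        then show ?case unfolding H_def by (subst (asm) nn_integral_density) auto
      qed
      have kg_meas: "(\<lambda>z. ennreal (kg (fst z) (snd z)) * ennreal (a (snd z) powr r)) \<in> borel_measurable borel" by measurable
      have "(\<integral>\<^sup>+x. ennreal (\<bar>u1 x t - u2 x t\<bar> powr r) \<partial>lborel) \<le> (\<integral>\<^sup>+x. (\<integral>\<^sup>+P. ennreal (kg x P) * ennreal (a P powr r) \<partial>lborel) * ennreal H \<partial>lborel)"
        by (rule nn_integral_mono_AE [OF pt])
      also have "\<dots> = (\<integral>\<^sup>+x. \<integral>\<^sup>+P. ennreal (kg x P) * ennreal (a P powr r) \<partial>lborel \<partial>lborel) * ennreal H"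
        using nn_integral_section_measurable [OF kg_meas] by (intro nn_integral_multc) simp
      also have "(\<integral>\<^sup>+x. \<integral>\<^sup>+P. ennreal (kg x P) * ennreal (a P powr r) \<partial>lborel \<partial>lborel) \<le> ennreal ((p * B) powr r * \<kappa>)"
      proof -
        have "(\<integral>\<^sup>+x. \<integral>\<^sup>+P. ennreal (kg x P) * ennreal (a P powr r) \<partial>lborel \<partial>lborel) = (\<integral>\<^sup>+P. \<integral>\<^sup>+x. ennreal (kg x P) * ennreal (a P powr r) \<partial>lborel \<partial>lborel)"
          using nn_integral_lborel_pair [OF kg_meas] by simp
        also have "\<dots> = (\<integral>\<^sup>+P. ennreal (k (fst P)) * ennreal (a P powr r) \<partial>lborel)"
          by (intro nn_integral_cong, subst nn_integral_multc) (auto simp: kg_def kgauss)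
        also have "\<dots> = (\<integral>\<^sup>+r'. \<integral>\<^sup>+y. ennreal (k r') * ennreal (a (r', y) powr r) \<partial>lborel \<partial>lborel)"
          by (subst nn_integral_lborel_pair(1)) auto
        also have "\<dots> = (\<integral>\<^sup>+r'. ennreal (k r') * (\<integral>\<^sup>+y. ennreal (a (r', y) powr r) \<partial>lborel) \<partial>lborel)"
          by (intro nn_integral_cong nn_integral_cmult) measurable
        also have "\<dots> \<le> (\<integral>\<^sup>+r'. ennreal (k r') * ennreal ((p * B) powr r) \<partial>lborel)"
        proof (rule nn_integral_mono_AE, use aer in eventually_elim)
          case (elim r')
          show ?case
          proof (cases "fst r' \<in> {0<..<t}")
            case True
            define s where "s = fst r'"
            have "(\<integral>\<^sup>+y. ennreal (a (r', y) powr r) \<partial>lborel) = (\<integral>\<^sup>+y. ennreal ((p * exp (- \<rho> * s)) powr r) * ennreal (\<bar>v1 (y, s) - v2 (y, s)\<bar> powr r) \<partial>lborel)"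
              using p by (intro nn_integral_cong) (simp add: a_def s_def powr_mult mult_ac flip: ennreal_mult)
            also have "\<dots> = ennreal ((p * exp (- \<rho> * s)) powr r) * (\<integral>\<^sup>+y. ennreal (\<bar>v1 (y, s) - v2 (y, s)\<bar> powr r) \<partial>lborel)"
              by (rule nn_integral_cmult) measurable
            also have "\<dots> \<le> ennreal ((p * exp (- \<rho> * s)) powr r) * ennreal ((B * exp (\<rho> * s)) powr r)"
              using elim True r by (intro mult_left_mono) (auto simp: Lq_le_def s_def)
            also have "\<dots> = ennreal ((p * B) powr r)"
            proof -
              have "(p * exp (- \<rho> * s)) * (B * exp (\<rho> * s)) = p * B" by (simp add: exp_minus)
              then have "(p * exp (- \<rho> * s)) powr r * (B * exp (\<rho> * s)) powr r = (p * B) powr r"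
                using p B by (metis powr_mult)
              then show ?thesis by (simp flip: ennreal_mult)
            qed
            finally show ?thesis by (rule mult_left_mono) simp
          next
            case False
            then have "k r' = 0" by (intro kz(1)) auto
            then show ?thesis by simp
          qed
        qed
        also have "\<dots> = (\<integral>\<^sup>+r'. ennreal (k r') \<partial>lborel) * ennreal ((p * B) powr r)"
          by (rule nn_integral_multc) measurable
        also have "\<dots> \<le> ennreal \<kappa> * ennreal ((p * B) powr r)" by (intro mult_right_mono mass) auto
        finally show ?thesis using \<kappa> by (simp add: ennreal_mult mult.commute)
      qed
      also have "ennreal ((p * B) powr r * \<kappa>) * ennreal H = ennreal ((p * B) powr r * \<kappa> * H)"
        using \<kappa> H by (simp add: ennreal_mult)
      also have "(p * B) powr r * \<kappa> * H = (\<kappa> * C * B) powr r"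
      proof -
        have "\<kappa> powr r = \<kappa> powr (r - 1) * \<kappa>" using \<kappa> powr_add [of \<kappa> "r - 1" 1] by simp
        moreover have "(D powr ((p - 1) / r)) powr r = D powr (p - 1)" using r0 by (simp add: powr_powr)
        ultimately show ?thesis using False rq \<kappa> p B D by (simp add: H_def C_def powr_mult mult_ac)
      qed
      also have "ennreal ((\<kappa> * C * B) powr r) \<le> ennreal ((B / 2 * exp (\<rho> * t)) powr r)"
        using \<kappa>C B \<kappa> C r0 mult_right_mono [OF \<kappa>C, of B] by (intro ennreal_leI powr_mono2) (auto simp: mult.commute)
      finally show ?thesis using False rq by (simp add: Lq_le_def mult_right_mono)
    qed
  qed
qed

end

section \<open>Uniqueness\<close>

lemma open_time_domain: "open (time_domain T)"
proof -
  have "time_domain T = {0<..} \<inter> (ereal -` {..<T})" by (auto simp: time_domain_def)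
  moreover have "open (ereal -` {..<T})" by (intro open_vimage continuous_on_ereal) auto
  ultimately show ?thesis by (metis open_Int open_greaterThan)
qed

lemma time_domain_strip_borel: "UNIV \<times> time_domain T \<in> sets (borel :: ('a::euclidean_space \<times> real) measure)"
  by (intro borel_open open_Times open_time_domain open_UNIV)

lemma Lq_solution_borel_representative:
  fixes u :: "'a::euclidean_space \<Rightarrow> real \<Rightarrow> real"
  assumes u: "Lq_solution \<alpha> p q Z u0 T u"
  obtains v where "v \<in> borel_measurable borel"
    "AE z in lborel. snd z \<in> time_domain T \<longrightarrow> u (fst z) (snd z) = v z"
proof -
  have S: "UNIV \<times> time_domain T \<in> sets (lebesgue :: ('a \<times> real) measure)"
    using time_domain_strip_borel by (intro sets_completionI_sets) simp
  have "(\<lambda>(x, t). u x t) \<in> borel_measurable (lebesgue_on (UNIV \<times> time_domain T))"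
    using u by (simp add: Lq_solution_def Linf_loc_Lq_def)
  from lebesgue_on_borel_representative [OF this S]
  obtain v where "v \<in> borel_measurable borel" "AE z in lborel. z \<in> UNIV \<times> time_domain T \<longrightarrow> (\<lambda>(x, t). u x t) z = v z" .
  then show ?thesis using that [of v] by (auto simp: mem_Times_iff split_beta elim!: eventually_mono)
qed

lemma Lq_solution_locally_bounded:
  fixes u :: "'a::euclidean_space \<Rightarrow> real \<Rightarrow> real"
  assumes u: "Lq_solution \<alpha> p q Z u0 T u" and can: "canonical_representative \<alpha> p q Z u0 T u"
    and T': "T' \<in> time_domain T" and q: "0 < q"
  obtains M where "0 < M" "AE s in lborel. s \<in> {0<..<T'} \<longrightarrow> Lq_le q (\<lambda>x. u x s) M"
proof -
  obtain M where M: "AE s in lebesgue_on {0<..<T'}. Lq_norm q (\<lambda>x. u x s) \<le> M"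
    using u T' by (auto simp: Lq_solution_def Linf_loc_Lq_def)
  have "AE s in lebesgue. s \<in> {0<..<T'} \<longrightarrow> Lq_norm q (\<lambda>x. u x s) \<le> M"
    using M by (subst (asm) AE_restrict_space_iff) auto
  then have "AE s in lborel. s \<in> {0<..<T'} \<longrightarrow> Lq_norm q (\<lambda>x. u x s) \<le> M"
    by (simp add: AE_completion_iff)
  then have "AE s in lborel. s \<in> {0<..<T'} \<longrightarrow> Lq_le q (\<lambda>x. u x s) (max 1 M)"
  proof eventually_elim
    case (elim s)
    show ?case
    proof
      assume s: "s \<in> {0<..<T'}"
      then have "ereal s < ereal T'" by auto
      also have "ereal T' < T" using T' by (simp add: time_domain_def)
      finally have "s \<in> time_domain T" using s by (simp add: time_domain_def)
      then have "Lq q (\<lambda>x. u x s)" using can by (simp add: canonical_representative_def duhamel_identity_def)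
      then show "Lq_le q (\<lambda>x. u x s) (max 1 M)" using elim s q by (intro Lq_le_of_norm) auto
    qed
  qed
  then show ?thesis by (rule that [rotated]) simp
qed

text \<open>
  The two conditions on the angle are compatible because \<open>\<alpha> + \<beta> < 2\<close>.
\<close>
lemma exists_contour_angle:
  assumes "0 < \<alpha>" "\<alpha> < 1" "0 < \<beta>" "\<beta> \<le> (1::real)"
  obtains \<theta> where "subdiffusion_kernel \<alpha> \<beta> \<theta>"
proof -
  have "pi / 2 < pi / (\<alpha> + \<beta>)" using assms by (intro divide_strict_left_mono) auto
  then have "pi / 2 < min pi (pi / (\<alpha> + \<beta>))" using pi_gt_zero by simp
  then obtain \<theta> where "pi / 2 < \<theta>" "\<theta> < min pi (pi / (\<alpha> + \<beta>))" using dense by blast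
  then have "subdiffusion_kernel \<alpha> \<beta> \<theta>"
    using assms by unfold_locales (auto simp: field_simps)
  then show ?thesis by (rule that)
qed

theorem theorem3p3:
  fixes \<alpha> \<beta> p l :: real
    and q T\<^sub>1 T\<^sub>2 :: ereal
    and Z u\<^sub>1 u\<^sub>2 :: "real ^ 'n \<Rightarrow> real \<Rightarrow> real"
    and u\<^sub>0 :: "real ^ 'n \<Rightarrow> real"
  assumes "0 < \<alpha>" and "\<alpha> < 1"
    and "0 < \<beta>" and "\<beta> \<le> 1"
    and "4 * \<beta> < real CARD('n)"
    and "fundamental_solution \<alpha> \<beta> Z"
    and "1 \<le> p"
    and "l = real CARD('n) / (2 * \<beta>) * (p - 1)"
    and "ereal l < q" and "ereal p \<le> q"
    and "Lq q u\<^sub>0"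
    and "Lq_solution \<alpha> p q Z u\<^sub>0 T\<^sub>1 u\<^sub>1" and "canonical_representative \<alpha> p q Z u\<^sub>0 T\<^sub>1 u\<^sub>1"
    and "Lq_solution \<alpha> p q Z u\<^sub>0 T\<^sub>2 u\<^sub>2" and "canonical_representative \<alpha> p q Z u\<^sub>0 T\<^sub>2 u\<^sub>2"
  shows "\<forall>t. 0 < t \<and> ereal t < min T\<^sub>1 T\<^sub>2 \<longrightarrow> (AE x in lebesgue. u\<^sub>1 x t = u\<^sub>2 x t)"
proof (intro allI impI)
  fix t assume t: "0 < t \<and> ereal t < min T\<^sub>1 T\<^sub>2"
  note sol = assms(12,14) and can = assms(13,15)
  have q1: "1 \<le> q" using assms(7,10) by (metis ereal_less_eq(3) one_ereal_def order_trans)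
  have q0: "0 < q" using q1 by (rule less_le_trans [rotated]) simp
  obtain \<theta> where "subdiffusion_kernel \<alpha> \<beta> \<theta>" using exists_contour_angle assms(1-4) by metis
  then interpret subdiffusion_kernel \<alpha> \<beta> \<theta> .
  obtain T where T: "t < T" "ereal T < min T\<^sub>1 T\<^sub>2" using ereal_dense2 [of "ereal t" "min T\<^sub>1 T\<^sub>2"] t by auto
  have dom: "s \<in> time_domain T\<^sub>1" "s \<in> time_domain T\<^sub>2" if "0 < s" "s \<le> T" for s
  proof -
    have "ereal s \<le> ereal T" using that by simp
    also have "\<dots> < min T\<^sub>1 T\<^sub>2" by (rule T)
    finally show "s \<in> time_domain T\<^sub>1" "s \<in> time_domain T\<^sub>2" using that by (auto simp: time_domain_def)
  qed
  have T0: "0 < T" using t T by simp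
  obtain v\<^sub>1 where v1: "v\<^sub>1 \<in> borel_measurable borel" "AE z in lborel. snd z \<in> time_domain T\<^sub>1 \<longrightarrow> u\<^sub>1 (fst z) (snd z) = v\<^sub>1 z"
    using Lq_solution_borel_representative [OF sol(1)] .
  obtain v\<^sub>2 where v2: "v\<^sub>2 \<in> borel_measurable borel" "AE z in lborel. snd z \<in> time_domain T\<^sub>2 \<longrightarrow> u\<^sub>2 (fst z) (snd z) = v\<^sub>2 z"
    using Lq_solution_borel_representative [OF sol(2)] .
  note [measurable] = v1(1) v2(1)
  have uv: "AE z in lborel. snd z \<in> {0<..<s} \<longrightarrow> u\<^sub>1 (fst z) (snd z) = v\<^sub>1 z"
    "AE z in lborel. snd z \<in> {0<..<s} \<longrightarrow> u\<^sub>2 (fst z) (snd z) = v\<^sub>2 z" if "s \<le> T" for s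
  proof -
    show "AE z in lborel. snd z \<in> {0<..<s} \<longrightarrow> u\<^sub>1 (fst z) (snd z) = v\<^sub>1 z"
      using v1(2) by eventually_elim (use dom(1) that in auto)
    show "AE z in lborel. snd z \<in> {0<..<s} \<longrightarrow> u\<^sub>2 (fst z) (snd z) = v\<^sub>2 z"
      using v2(2) by eventually_elim (use dom(2) that in auto)
  qed
  have slice: "AE s in lborel. s \<in> {0<..<T} \<longrightarrow> (AE y in lborel. u\<^sub>1 y s = v\<^sub>1 (y, s)) \<and> (AE y in lborel. u\<^sub>2 y s = v\<^sub>2 (y, s))"
    using lborel_AE_pair(2) [OF uv(1) [OF order_refl]] lborel_AE_pair(2) [OF uv(2) [OF order_refl]]
    by eventually_elim auto
  obtain M\<^sub>1 where M1: "0 < M\<^sub>1" "AE s in lborel. s \<in> {0<..<T} \<longrightarrow> Lq_le q (\<lambda>x. u\<^sub>1 x s) M\<^sub>1"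
    using Lq_solution_locally_bounded [OF sol(1) can(1) dom(1) [OF T0 order_refl] q0] .
  obtain M\<^sub>2 where M2: "0 < M\<^sub>2" "AE s in lborel. s \<in> {0<..<T} \<longrightarrow> Lq_le q (\<lambda>x. u\<^sub>2 x s) M\<^sub>2"
    using Lq_solution_locally_bounded [OF sol(2) can(2) dom(2) [OF T0 order_refl] q0] .
  define M where "M = max M\<^sub>1 M\<^sub>2"
  have M: "0 < M" using M1(1) by (simp add: M_def)
  have bound: "AE s in lborel. s \<in> {0<..<T} \<longrightarrow> Lq_le q (\<lambda>y. v\<^sub>1 (y, s)) M \<and> Lq_le q (\<lambda>y. v\<^sub>2 (y, s)) M"
    using slice M1(2) M2(2)
  proof eventually_elim
    case (elim s)
    show ?case
    proof
      assume s: "s \<in> {0<..<T}"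
      then have "Lq_le q (\<lambda>y. v\<^sub>1 (y, s)) M\<^sub>1" "Lq_le q (\<lambda>y. v\<^sub>2 (y, s)) M\<^sub>2"
        using elim Lq_le_cong [of "\<lambda>y. u\<^sub>1 y s" "\<lambda>y. v\<^sub>1 (y, s)"] Lq_le_cong [of "\<lambda>y. u\<^sub>2 y s" "\<lambda>y. v\<^sub>2 (y, s)"] by auto
      then show "Lq_le q (\<lambda>y. v\<^sub>1 (y, s)) M \<and> Lq_le q (\<lambda>y. v\<^sub>2 (y, s)) M"
        using q0 M1(1) M2(1) by (auto simp: M_def elim!: Lq_le_mono)
    qed
  qed
  have sub: "ereal (real DIM(real ^ 'n) / (2 * \<beta>) * (p - 1)) < q" using assms(8,9) by simp
  obtain \<rho> where \<rho>: "0 < \<rho>" and contraction: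
    "\<And>u1 u2 u0 v1 v2 t B. 0 < t \<Longrightarrow> 0 < B \<Longrightarrow>
      v1 \<in> borel_measurable borel \<Longrightarrow> v2 \<in> borel_measurable borel \<Longrightarrow>
      AE z in lborel. snd z \<in> {0<..<t} \<longrightarrow> u1 (fst z) (snd z) = v1 z \<Longrightarrow>
      AE z in lborel. snd z \<in> {0<..<t} \<longrightarrow> u2 (fst z) (snd z) = v2 z \<Longrightarrow>
      duhamel_identity \<alpha> p q Z u0 u1 t \<Longrightarrow> duhamel_identity \<alpha> p q Z u0 u2 t \<Longrightarrow>
      AE s in lborel. s \<in> {0<..<t} \<longrightarrow> Lq_le q (\<lambda>y. v1 (y, s)) M \<and> Lq_le q (\<lambda>y. v2 (y, s)) M
        \<and> Lq_le q (\<lambda>y. v1 (y, s) - v2 (y, s)) (B * exp (\<rho> * s)) \<Longrightarrow>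
      Lq_le q (\<lambda>x. u1 x t - u2 x t) (B / 2 * exp (\<rho> * t))"
    using duhamel_contraction [OF assms(6,7,10) sub M] by blast
  have step: "Lq_le q (\<lambda>x. u\<^sub>1 x s - u\<^sub>2 x s) (B / 2 * exp (\<rho> * s))"
    if B: "0 < B" and ae: "AE s in lborel. s \<in> {0<..<T} \<longrightarrow> Lq_le q (\<lambda>y. v\<^sub>1 (y, s) - v\<^sub>2 (y, s)) (B * exp (\<rho> * s))"
      and s: "0 < s" "s < T" for B s
  proof (rule contraction [OF s(1) B v1(1) v2(1) uv(1) uv(2)])
    show "duhamel_identity \<alpha> p q Z u\<^sub>0 u\<^sub>1 s" "duhamel_identity \<alpha> p q Z u\<^sub>0 u\<^sub>2 s"
      using can dom s by (auto simp: canonical_representative_def)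
    show "AE s' in lborel. s' \<in> {0<..<s} \<longrightarrow> Lq_le q (\<lambda>y. v\<^sub>1 (y, s')) M \<and> Lq_le q (\<lambda>y. v\<^sub>2 (y, s')) M
        \<and> Lq_le q (\<lambda>y. v\<^sub>1 (y, s') - v\<^sub>2 (y, s')) (B * exp (\<rho> * s'))"
      using bound ae by eventually_elim (use s in auto)
  qed (use s in auto)
  \<comment> \<open>The contraction needs its hypothesis for almost every earlier time only, and it yields the
    conclusion for every time; the a priori bound starts the iteration.\<close>
  have iterate: "AE s in lborel. s \<in> {0<..<T} \<longrightarrow> Lq_le q (\<lambda>y. v\<^sub>1 (y, s) - v\<^sub>2 (y, s)) (4 * M / 2 ^ n * exp (\<rho> * s))" for n
  proof (induction n)
    case 0
    show ?case
      using bound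
    proof eventually_elim
      case (elim s)
      show ?case
      proof
        assume s: "s \<in> {0<..<T}"
        have "Lq_le q (\<lambda>y. v\<^sub>1 (y, s) - v\<^sub>2 (y, s)) (4 * M)"
          using elim s M q1 by (intro Lq_le_diff) auto
        moreover have "4 * M * 1 \<le> 4 * M * exp (\<rho> * s)" using s \<rho> M by (intro mult_left_mono) auto
        ultimately show "Lq_le q (\<lambda>y. v\<^sub>1 (y, s) - v\<^sub>2 (y, s)) (4 * M / 2 ^ 0 * exp (\<rho> * s))"
          using M q0 by (auto elim!: Lq_le_mono)
      qed
    qed
  next
    case (Suc n)
    show ?case
      using slice
    proof eventually_elim
      case (elim s)
      show ?case
      proof
        assume s: "s \<in> {0<..<T}"
        have "Lq_le q (\<lambda>x. u\<^sub>1 x s - u\<^sub>2 x s) (4 * M / 2 ^ n / 2 * exp (\<rho> * s))"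
          using s M by (intro step Suc) auto
        moreover have "AE y in lborel. u\<^sub>1 y s - u\<^sub>2 y s = v\<^sub>1 (y, s) - v\<^sub>2 (y, s)"
        proof -
          have "AE y in lborel. u\<^sub>1 y s = v\<^sub>1 (y, s)" "AE y in lborel. u\<^sub>2 y s = v\<^sub>2 (y, s)" using elim s by auto
          then show ?thesis by eventually_elim simp
        qed
        ultimately show "Lq_le q (\<lambda>y. v\<^sub>1 (y, s) - v\<^sub>2 (y, s)) (4 * M / 2 ^ Suc n * exp (\<rho> * s))"
          using Lq_le_cong [of "\<lambda>y. u\<^sub>1 y s - u\<^sub>2 y s" "\<lambda>y. v\<^sub>1 (y, s) - v\<^sub>2 (y, s)"]
          by (simp add: mult.commute)
      qed
    qed
  qed
  have "AE x in lborel. u\<^sub>1 x t - u\<^sub>2 x t = 0"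
  proof (rule AE_zero_if_Lq_le)
    show "(\<lambda>x. u\<^sub>1 x t - u\<^sub>2 x t) \<in> borel_measurable lebesgue"
    proof -
      have "t \<in> time_domain T\<^sub>1" "t \<in> time_domain T\<^sub>2" using dom t T by auto
      then have "Lq q (\<lambda>x. u\<^sub>1 x t)" "Lq q (\<lambda>x. u\<^sub>2 x t)"
        using can by (auto simp: canonical_representative_def duhamel_identity_def)
      then show ?thesis by (intro borel_measurable_diff) (auto simp: Lq_def)
    qed
    show "Lq_le q (\<lambda>x. u\<^sub>1 x t - u\<^sub>2 x t) (4 * M / 2 ^ n / 2 * exp (\<rho> * t))" for n
      using M t T by (intro step iterate) auto
    have "(\<lambda>n. 4 * M / 2 * exp (\<rho> * t) * (1 / 2) ^ n) \<longlonglongrightarrow> 4 * M / 2 * exp (\<rho> * t) * 0"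
      by (intro tendsto_mult tendsto_const LIMSEQ_power_zero) simp
    then show "(\<lambda>n. 4 * M / 2 ^ n / 2 * exp (\<rho> * t)) \<longlonglongrightarrow> 0"
      by (simp add: power_one_over field_simps)
  qed (use M q0 in auto)
  then show "AE x in lebesgue. u\<^sub>1 x t = u\<^sub>2 x t"
    by (simp add: AE_completion_iff)
qed

end
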